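(* Let $w\in\Lambda(3)$, $\mathcal B=\{x\in\Lambda(2): |x-w|=2\}$ ($552$ points), $\mathcal C=\{x\in\Lambda(2): |x-w|=\sqrt6\}$ ($11178$ points), $\overline{\mathcal C}=\{w-x:x\in\mathcal C\}$. With $W=\mathrm{span}\{w\}$ let $C_{552}=N_W(\mathcal B)$, $C_{11178}=N_W(\mathcal C)$ and $C_{22356}=N_W(\mathcal C\cup\overline{\mathcal C})$, codes on $\mathbb S^{22}$. Then: (a) for every potential $h$ with $h^{(6)}(t)>0$ on $(-1,1)$, $m^h(C_{11178})=2025h(-\tfrac{\sqrt3}{5})+7128h(0)+2025h(\tfrac{\sqrt3}{5})$ and $m^h(C_{22356})=4050h(-\tfrac{\sqrt3}{5})+14256h(0)+4050h(\tfrac{\sqrt3}{5})$; moreover $C_{552}$ attains its bound $m^h(C_{552})=100h(-\tfrac{\sqrt3}5)+352h(0)+100h(\tfrac{\sqrt3}5)$, and $m^h(C_{552})/552=m^h(C_{22356})/22356=m^h(C_{11178})/11178$; (b) for every strictly absolutely monotone $h$, the set of minimizers on $\mathbb S^{22}$ of $U_h(\cdot,C_{11178})$ and of $U_h(\cdot,C_{22356})$ is exactly $C_{552}$, and the set of minimizers of $U_h(\cdot,C_{552})$ is exactly $C_{22356}$; i.e. $(C_{552},C_{22356})$ is a universal polar dual pair. (Thus $(C_{552},C_{22356})$ is a maximal PULB-optimal pair.)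
   Context: $\Lambda_{24}$ is the Leech lattice normalized as the unique even unimodular lattice in $\mathbb R^{24}$ with no vectors of squared length $2$; $\Lambda(k)=\{x\in\Lambda_{24}:|x|^2=2k\}$. For a linear subspace $W\subset\mathbb R^{24}$ with orthogonal projection $P_W$ and $x\notin W$, $N_W(x)=(x-P_Wx)/|x-P_Wx|$, a point of the unit sphere of $W^\perp$, identified with $\mathbb S^{23-\dim W}$ by a linear isometry; $N_W(X)=\{N_W(x):x\in X\}$. A potential is $h:[-1,1]\to(-\infty,+\infty]$ continuous in the extended sense and finite on $[-1,1)$; $U_h(x,Z)=\sum_{y\in Z}h(x\cdot y)$, $m^h(Z)=\min_xU_h(x,Z)$ over the unit sphere. $h$ is strictly absolutely monotone if $h^{(j)}>0$ on $(-1,1)$ for all $j\ge0$. *)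

theory Defs
  imports "HOL-Analysis.Analysis"
begin

section \<open>The Leech lattice\<close>

text \<open>The columns of \<open>M\<close> are the generators.\<close>

definition lattice_of :: "real^'n^'n \<Rightarrow> (real^'n) set" where
  "lattice_of M = {M *v z | z. \<forall>i. z $ i \<in> \<int>}"

definition unimodular_lattice :: "(real^'n) set \<Rightarrow> bool" where
  "unimodular_lattice L \<longleftrightarrow> (\<exists>M. \<bar>det M\<bar> = 1 \<and> L = lattice_of M)"

text \<open>Evenness includes integrality: \<open>2 (x \<bullet> y) = (norm (x + y))\<^sup>2 - (norm x)\<^sup>2 - (norm y)\<^sup>2\<close>.\<close>

definition even_lattice :: "(real^'n) set \<Rightarrow> bool" where
  "even_lattice L \<longleftrightarrow> (\<forall>x\<in>L. \<exists>k::int. (norm x)\<^sup>2 = 2 * of_int k)"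

text \<open>The Leech lattice is determined by this property only up to a linear isometry, so it appears
  as a predicate.\<close>

definition leech_lattice :: "(real^24) set \<Rightarrow> bool" where
  "leech_lattice L \<longleftrightarrow>
     unimodular_lattice L \<and> even_lattice L \<and> (\<forall>x\<in>L. (norm x)\<^sup>2 \<noteq> 2)"

definition shell :: "(real^24) set \<Rightarrow> nat \<Rightarrow> (real^24) set" where
  "shell L k = {x \<in> L. (norm x)\<^sup>2 = 2 * real k}"

section \<open>Normalized projections\<close>

definition orth_proj :: "'a::euclidean_space set \<Rightarrow> 'a \<Rightarrow> 'a" where
  "orth_proj W x = (THE y. y \<in> W \<and> x - y \<in> W\<^sup>\<bottom>)"

lemma orth_proj_unique_ex:
  fixes W :: "'a::euclidean_space set"
  assumes "subspace W"
  shows "\<exists>!y. y \<in> W \<and> x - y \<in> W\<^sup>\<bottom>"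
proof -
  have "x \<in> W + W\<^sup>\<bottom>"
    using subspace_sum_orthogonal_comp[OF assms] by simp
  then obtain y z where yz: "y \<in> W" "z \<in> W\<^sup>\<bottom>" "x = y + z"
    by (rule set_plus_elim)
  show ?thesis
  proof (rule ex1I[of _ y])
    show "y \<in> W \<and> x - y \<in> W\<^sup>\<bottom>" using yz by simp
  next
    fix y' assume y': "y' \<in> W \<and> x - y' \<in> W\<^sup>\<bottom>"
    have "(x - y') - (x - y) \<in> W\<^sup>\<bottom>"
      using subspace_diff[OF subspace_orthogonal_comp, of "x - y'" W "x - y"] y' yz by simp
    moreover have "y - y' \<in> W" using y' yz assms by (simp add: subspace_diff)
    ultimately have "orthogonal (y - y') (y - y')"
      by (auto simp: orthogonal_comp_def)
    then show "y' = y" by (simp add: orthogonal_self)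
  qed
qed

definition normalized_proj :: "'a::euclidean_space set \<Rightarrow> 'a \<Rightarrow> 'a" where
  "normalized_proj W x = (x - orth_proj W x) /\<^sub>R norm (x - orth_proj W x)"

section \<open>Potentials and polarization\<close>

definition potential :: "(real \<Rightarrow> ereal) \<Rightarrow> bool" where
  "potential h \<longleftrightarrow> continuous_on {-1..1} h \<and> (\<forall>t\<in>{-1..<1}. \<bar>h t\<bar> \<noteq> \<infinity>) \<and> h 1 \<noteq> -\<infinity>"

text \<open>The \<open>k\<close>-th derivative of \<open>h\<close> exists and is positive on \<open>(-1,1)\<close>. The differentiability
  clause is needed because \<^const>\<open>deriv\<close> is total.\<close>

definition pos_deriv :: "nat \<Rightarrow> (real \<Rightarrow> ereal) \<Rightarrow> bool" where
  "pos_deriv k h \<longleftrightarrow> (\<forall>t\<in>{-1<..<1}.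
     (\<forall>j<k. (deriv ^^ j) (\<lambda>s. real_of_ereal (h s)) field_differentiable at t) \<and>
     (deriv ^^ k) (\<lambda>s. real_of_ereal (h s)) t > 0)"

definition strictly_absolutely_monotone :: "(real \<Rightarrow> ereal) \<Rightarrow> bool" where
  "strictly_absolutely_monotone h \<longleftrightarrow> (\<forall>k. pos_deriv k h)"

definition disc_potential :: "(real \<Rightarrow> ereal) \<Rightarrow> 'a::euclidean_space \<Rightarrow> 'a set \<Rightarrow> ereal" where
  "disc_potential h x Z = (\<Sum>y\<in>Z. h (x \<bullet> y))"

definition minimizers :: "(real \<Rightarrow> ereal) \<Rightarrow> 'a::euclidean_space set \<Rightarrow> 'a set" where
  "minimizers h Z = {x. is_arg_min (\<lambda>x. disc_potential h x Z) (\<lambda>x. x \<in> sphere 0 1) x}"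

text \<open>For a potential and a finite code the infimum is attained; see \<open>polarization_attained\<close>.\<close>

definition polarization :: "(real \<Rightarrow> ereal) \<Rightarrow> 'a::euclidean_space set \<Rightarrow> ereal" where
  "polarization h Z = (INF x\<in>sphere 0 1. disc_potential h x Z)"

definition universal_polar_dual_pair :: "'a::euclidean_space set \<Rightarrow> 'a set \<Rightarrow> bool" where
  "universal_polar_dual_pair C D \<longleftrightarrow>
     (\<forall>h. potential h \<and> strictly_absolutely_monotone h \<longrightarrow>
        minimizers h C = D \<and> minimizers h D = C)"

lemma potential_not_MInf:
  assumes "potential h" "t \<in> {-1..1}"
  shows "h t \<noteq> -\<infinity>"
  using assms by (cases "t = 1") (force simp: potential_def)+

lemma inner_unit_sphere:
  assumes "norm x = 1" "norm y = 1"
  shows "x \<bullet> y \<in> {-1..1}"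
  using Cauchy_Schwarz_ineq2[of x y] assms by (simp add: abs_le_iff)

lemma disc_potential_not_MInf:
  assumes "potential h" "finite Z" "Z \<subseteq> sphere 0 1" "x \<in> sphere 0 1"
  shows "disc_potential h x Z \<noteq> -\<infinity>"
proof -
  have "h (x \<bullet> y) \<noteq> -\<infinity>" if "y \<in> Z" for y
    using that assms by (intro potential_not_MInf[OF assms(1)] inner_unit_sphere) auto
  with assms(2) show ?thesis
    unfolding disc_potential_def by (induction Z) auto
qed

lemma continuous_on_disc_potential:
  assumes h: "potential h" and "finite Z" "Z \<subseteq> sphere 0 1"
  shows "continuous_on (sphere 0 1) (\<lambda>x. disc_potential h x Z)"
  using assms(2,3)
proof (induction Z)
  case empty
  then show ?case by (simp add: disc_potential_def)
next
  case (insert y Z)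
  have y: "continuous_on (sphere 0 1) (\<lambda>x. h (x \<bullet> y))"
  proof (rule continuous_on_compose2[where g = h])
    show "continuous_on {-1..1} h" using h by (simp add: potential_def)
    show "(\<lambda>x. x \<bullet> y) ` sphere 0 1 \<subseteq> {-1..1}"
      using insert.prems inner_unit_sphere[of _ y] by fastforce
  qed (intro continuous_intros)
  have "h (x \<bullet> y) \<noteq> -\<infinity>" if "x \<in> sphere 0 1" for x
    using that insert.prems by (intro potential_not_MInf[OF h] inner_unit_sphere) auto
  moreover have "disc_potential h x Z \<noteq> -\<infinity>" if "x \<in> sphere 0 1" for x
    using that insert by (intro disc_potential_not_MInf[OF h]) auto
  ultimately have "continuous_on (sphere 0 1) (\<lambda>x. h (x \<bullet> y) + disc_potential h x Z)"
    using y insert unfolding continuous_on_def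
    by (intro ballI tendsto_add_ereal_general) auto
  then show ?case using insert by (simp add: disc_potential_def)
qed

lemma polarization_attained:
  fixes Z :: "'a::euclidean_space set"
  assumes "potential h" "finite Z" "Z \<subseteq> sphere 0 1"
  shows "\<exists>x\<in>sphere 0 1. disc_potential h x Z = polarization h Z"
proof -
  obtain x where x: "x \<in> sphere 0 1"
      "\<And>y. y \<in> sphere 0 1 \<Longrightarrow> disc_potential h x Z \<le> disc_potential h y Z"
    using continuous_attains_inf[OF compact_sphere _ continuous_on_disc_potential[OF assms]]
    by auto
  then have "polarization h Z = disc_potential h x Z"
    unfolding polarization_def by (intro antisym INF_lower INF_greatest)
  then show ?thesis using x(1) by auto
qed

end

theory Submission
  imports
    Defs
    "HOL-Probability.Characteristic_Functions"
    "HOL-Complex_Analysis.Conformal_Mappings"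
begin

text \<open>
  For unit vectors \<open>u\<close>, \<open>v\<close> the series \<open>\<Sum>x\<in>\<Lambda>. ((x \<bullet> u)^j - (x \<bullet> v)^j) q^(norm x^2/2)\<close>,
  with \<open>j\<close> minimal such that it is nonzero, is by Poisson summation a modular form of weight \<open>12 + j\<close>
  whose coefficients of \<open>q^0\<close> and \<open>q^1\<close> vanish. A form of weight at most 22 with this property is
  zero, so every shell of \<open>\<Lambda>\<close> is a spherical 11-design. Restricting the design identities to a
  hyperplane section (a polynomial of degree 6 in \<open>x \<bullet> w\<close> serves as indicator of the section) gives
  that the three codes are 5-designs. Each point of one code meets the other one in the inner products
  \<open>-a\<close>, \<open>0\<close>, \<open>a\<close>, where \<open>a = sqrt 3 / 5\<close>, and the Hermite interpolant of \<open>h\<close> at these nodes lies below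
  \<open>h\<close> with equality only at the nodes; since it has degree 5, its potential is constant on the
  sphere. The minimizers are therefore the points all of whose inner products with the code are nodes.
  These correspond to the vectors of norm 2 in a dual of the sublattice generated by a slice, and
  the slices generate \<open>{v \<in> \<Lambda>. 3 dvd v \<bullet> w}\<close> and (together with \<open>w\<close>) \<open>{v \<in> \<Lambda>. even (v \<bullet> w)}\<close>,
  since a shortest vector outside the generated group would be too short.
\<close>

section \<open>Poisson summation for Gaussians in one dimension\<close>

text \<open>The vanishing of the modular form, usually read off from the valence formula, is
  obtained here from the maximum modulus principle. After division by q^2, a form of weight 2m
  changes in absolute value under z -> -1/z by a factor that is below 1 inside the unit circle as
  long as m < 4 pi Im z. Near the corner of the fundamental domain 4 pi Im z is about 10.88, so
  weight 20 is immediate while weight 22 just fails; a forced zero at the corner and the Schwarz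
  lemma settle that case. Comparing two directions u and v takes the place of harmonic polynomials:
  the lowest surviving moment transforms without correction terms. The nodes -a, 0, a are the zeros
  of t^3 - 3 t / 25, which is proportional to the Gegenbauer polynomial of degree 3 for the unit
  sphere in dimension 23. Hence they carry a Gauss quadrature exact up to degree 5, with weights
  25/138, 88/138, 25/138; times the sizes of the codes these are the coefficients in (a).\<close>

text \<open>The symmetry makes \<open>D\<close> a continuous function of cos (2 pi v). Powers of
  that cosine are combinations of the cosines cos (2 pi m v), so \<open>D\<close> is orthogonal to
  every polynomial in it and, by Weierstrass approximation, to itself.\<close>

lemma cosine_uniqueness:
  fixes D :: "real \<Rightarrow> real"
  assumes cont: "continuous_on {0..1} D"
    and sym: "\<And>v. v \<in> {0..1} \<Longrightarrow> D (1 - v) = D v"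
    and orth: "\<And>m::nat. integral {0..1} (\<lambda>v. D v * cos (2 * pi * m * v)) = 0"
    and "v \<in> {0..1}"
  shows "D v = 0"
proof -
  have orth_int: "integral {0..1} (\<lambda>v. D v * cos (2 * pi * of_int m * v)) = 0" for m :: int
  proof (cases "m \<ge> 0")
    case True
    then show ?thesis using orth[of "nat m"] by simp
  next
    case False
    then have "real (nat (- m)) = - of_int m" by simp
    then show ?thesis using orth[of "nat (- m)"] by simp
  qed
  \<comment> \<open>The product formula raises and lowers the frequency by one; integer
    \<open>m\<close> avoids a special case at frequency 0.\<close>
  have pow: "integral {0..1} (\<lambda>v. D v * cos (2 * pi * of_int m * v) * cos (2 * pi * v) ^ k) = 0" for m :: int and k
  proof (induction k arbitrary: m)
    case 0
    then show ?case using orth_int by simp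
  next
    case (Suc k)
    have *: "cos (2 * pi * of_int m * v) * cos (2 * pi * v) =
        (cos (2 * pi * of_int (m + 1) * v) + cos (2 * pi * of_int (m - 1) * v)) / 2" for v
    proof -
      have "2 * pi * of_int (m + 1) * v = 2 * pi * of_int m * v + 2 * pi * v"
           "2 * pi * of_int (m - 1) * v = 2 * pi * of_int m * v - 2 * pi * v"
        by (simp_all add: algebra_simps)
      then show ?thesis by (simp only: cos_add cos_diff) simp
    qed
    have "D v * cos (2 * pi * of_int m * v) * cos (2 * pi * v) ^ Suc k =
        (D v * cos (2 * pi * of_int (m + 1) * v) * cos (2 * pi * v) ^ k +
          D v * cos (2 * pi * of_int (m - 1) * v) * cos (2 * pi * v) ^ k) / 2" for v
    proof -
      have "D v * cos (2 * pi * of_int m * v) * cos (2 * pi * v) ^ Suc k =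
          D v * (cos (2 * pi * of_int m * v) * cos (2 * pi * v)) * cos (2 * pi * v) ^ k"
        by simp
      also have "\<dots> = D v * ((cos (2 * pi * of_int (m + 1) * v) + cos (2 * pi * of_int (m - 1) * v)) / 2) * cos (2 * pi * v) ^ k"
        by (simp only: *)
      finally show ?thesis by (simp only: distrib_left distrib_right times_divide_eq_left times_divide_eq_right add_divide_distrib)
    qed
    then have "integral {0..1} (\<lambda>v. D v * cos (2 * pi * of_int m * v) * cos (2 * pi * v) ^ Suc k) =
        integral {0..1} (\<lambda>v. (D v * cos (2 * pi * of_int (m + 1) * v) * cos (2 * pi * v) ^ k +
          D v * cos (2 * pi * of_int (m - 1) * v) * cos (2 * pi * v) ^ k) / 2)"
      by (simp only:)
    also have "\<dots> =
        (integral {0..1} (\<lambda>v. D v * cos (2 * pi * of_int (m + 1) * v) * cos (2 * pi * v) ^ k) +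
         integral {0..1} (\<lambda>v. D v * cos (2 * pi * of_int (m - 1) * v) * cos (2 * pi * v) ^ k)) / 2"
      unfolding integral_divide
      by (subst Henstock_Kurzweil_Integration.integral_add)
         (auto intro!: integrable_continuous_real continuous_intros cont)
    finally show ?case by (simp only: Suc) simp
  qed
  have poly0: "integral {0..1} (\<lambda>v. D v * (\<Sum>i\<le>n. a i * cos (2 * pi * v) ^ i)) = 0" for a :: "nat \<Rightarrow> real" and n
  proof -
    have "integral {0..1} (\<lambda>v. D v * (\<Sum>i\<le>n. a i * cos (2 * pi * v) ^ i)) =
        integral {0..1} (\<lambda>v. \<Sum>i\<le>n. a i * (D v * cos (2 * pi * v) ^ i))"
      by (simp add: sum_distrib_left mult.left_commute)
    also have "\<dots> = (\<Sum>i\<le>n. integral {0..1} (\<lambda>v. a i * (D v * cos (2 * pi * v) ^ i)))"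
      by (intro integral_sum) (auto intro!: integrable_continuous_real continuous_intros cont)
    also have "\<dots> = 0" using pow[of 0] by simp
    finally show ?thesis .
  qed
  \<comment> \<open>\<open>D\<close> as a function of x = cos (2 pi v): \<open>arccos\<close>
    recovers v on [0, 1/2], and the symmetry covers the other half.\<close>
  define \<psi> where "\<psi> x = D (arccos x / (2 * pi))" for x
  have contpsi: "continuous_on {-1..1} \<psi>" unfolding \<psi>_def
  proof (rule continuous_on_compose2[OF cont])
    show "continuous_on {-1..1} (\<lambda>x. arccos x / (2 * pi))"
      by (rule continuous_on_divide[OF continuous_on_arccos' continuous_on_const]) auto
    show "(\<lambda>x. arccos x / (2 * pi)) ` {-1..1} \<subseteq> {0..1}"
    proof (rule image_subsetI)
      fix x :: real assume "x \<in> {-1..1}"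
      then have "0 \<le> arccos x" "arccos x \<le> pi" by (auto intro: arccos_lbound arccos_ubound)
      then show "arccos x / (2 * pi) \<in> {0..1}" by (simp add: field_simps)
    qed
  qed
  have Dpsi: "D v = \<psi> (cos (2 * pi * v))" if v: "v \<in> {0..1}" for v
  proof (cases "v \<le> 1/2")
    case True
    then have "arccos (cos (2 * pi * v)) = 2 * pi * v" using v by (intro arccos_cos) auto
    then show ?thesis by (simp add: \<psi>_def)
  next
    case False
    have "cos (2 * pi * v) = cos (2 * pi * (1 - v))" by (simp add: algebra_simps cos_diff)
    moreover have "arccos (cos (2 * pi * (1 - v))) = 2 * pi * (1 - v)"
      using v False by (intro arccos_cos) auto
    ultimately show ?thesis using sym[OF v] by (simp add: \<psi>_def)
  qed
  define I where "I = integral {0..1} (\<lambda>v. D v * D v)"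
  define J where "J = integral {0..1} (\<lambda>v. \<bar>D v\<bar>)"
  have J0: "J \<ge> 0" unfolding J_def by (intro integral_nonneg integrable_continuous_real continuous_intros cont) auto
  have "I \<le> e * J" if e: "e > 0" for e
  proof -
    obtain p where p: "real_polynomial_function p" "\<And>x. x \<in> {-1..1} \<Longrightarrow> \<bar>\<psi> x - p x\<bar> < e"
      by (rule Stone_Weierstrass_real_polynomial_function[OF compact_Icc contpsi e]) blast
    then obtain a n where pa: "p = (\<lambda>x. \<Sum>i\<le>n. a i * x ^ i)"
      using real_polynomial_function_iff_sum by blast
    have "I = integral {0..1} (\<lambda>v. D v * D v) - integral {0..1} (\<lambda>v. D v * p (cos (2 * pi * v)))"
      unfolding pa poly0 I_def by simp
    also have "\<dots> = integral {0..1} (\<lambda>v. D v * D v - D v * p (cos (2 * pi * v)))"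
      unfolding pa by (intro Henstock_Kurzweil_Integration.integral_diff[symmetric] integrable_continuous_real continuous_intros cont)
    also have "\<dots> \<le> integral {0..1} (\<lambda>v. e * \<bar>D v\<bar>)"
    proof (rule integral_le)
      fix v :: real assume v: "v \<in> {0..1}"
      have "D v * D v - D v * p (cos (2 * pi * v)) = D v * (\<psi> (cos (2 * pi * v)) - p (cos (2 * pi * v)))"
        using Dpsi[OF v] by (simp add: algebra_simps)
      also have "\<dots> \<le> \<bar>D v * (\<psi> (cos (2 * pi * v)) - p (cos (2 * pi * v)))\<bar>" by simp
      also have "\<dots> \<le> \<bar>D v\<bar> * e"
        unfolding abs_mult using p(2)[of "cos (2 * pi * v)"] by (intro mult_left_mono) auto
      finally show "D v * D v - D v * p (cos (2 * pi * v)) \<le> e * \<bar>D v\<bar>" by (simp add: mult.commute)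
    next
      show "(\<lambda>v. D v * D v - D v * p (cos (2 * pi * v))) integrable_on {0..1}"
        unfolding pa by (intro integrable_continuous_real continuous_intros cont)
      show "(\<lambda>v. e * \<bar>D v\<bar>) integrable_on {0..1}"
        by (intro integrable_continuous_real continuous_intros cont)
    qed
    finally show ?thesis by (simp add: J_def)
  qed
  note I_le = this
  have "I \<le> 0"
  proof (rule field_le_epsilon)
    fix e :: real assume e: "e > 0"
    have "I \<le> e / (J + 1) * J" using e J0 by (intro I_le) auto
    also have "\<dots> \<le> e" using e J0 by (simp add: field_simps)
    finally show "I \<le> 0 + e" by simp
  qed
  moreover have "I \<ge> 0" unfolding I_def by (intro integral_nonneg integrable_continuous_real continuous_intros cont) auto
  ultimately have "I = 0" by simp
  then have "\<forall>v\<in>{0..1}. D v * D v = 0"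
    unfolding I_def by (subst (asm) integral_eq_0_iff) (auto intro!: continuous_intros cont)
  then show ?thesis using assms(4) by auto
qed

text \<open>The constant term is \<open>b 0\<close>, so no factor \<open>1/2\<close> occurs there.\<close>

lemma cosine_inversion:
  fixes \<phi> :: "real \<Rightarrow> real" and b :: "nat \<Rightarrow> real"
  assumes cont: "continuous_on {0..1} \<phi>"
    and sym: "\<And>v. v \<in> {0..1} \<Longrightarrow> \<phi> (1 - v) = \<phi> v"
    and coeff: "\<And>m::nat. integral {0..1} (\<lambda>v. \<phi> v * cos (2 * pi * m * v)) = (if m = 0 then b 0 else b m / 2)"
    and summ: "summable (\<lambda>n. \<bar>b n\<bar>)"
  shows "b sums \<phi> 0"
proof -
  define H where "H v = (\<Sum>n. b n * cos (2 * pi * n * v))" for v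
  have unif: "uniform_limit {0..1} (\<lambda>N v. \<Sum>n<N. b n * cos (2 * pi * n * v)) H sequentially"
    unfolding H_def[abs_def] by (rule Weierstrass_m_test[OF _ summ]) (simp add: abs_mult mult_left_le)
  have contH: "continuous_on {0..1} H"
    by (rule uniform_limit_theorem[OF _ unif]) (auto intro!: continuous_intros always_eventually)
  have cos_int: "integral {0..1} (\<lambda>v. cos (2 * pi * n * v) * cos (2 * pi * m * v)) =
      (if n = m then if m = 0 then 1 else 1/2 else 0)" for n m :: nat
  proof -
    have 1: "((\<lambda>v. cos (2 * pi * of_int k * v)) has_integral (if k = 0 then 1 else 0)) {0..1}" for k :: int
    proof (cases "k = 0")
      case True
      then show ?thesis using has_integral_const_real[of "1::real" 0 1] by simp
    next
      case False
      have "((\<lambda>v. cos (2 * pi * of_int k * v)) has_integral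
          (sin (2 * pi * of_int k * 1) / (2 * pi * of_int k) - sin (2 * pi * of_int k * 0) / (2 * pi * of_int k))) {0..1}"
        using False by (intro fundamental_theorem_of_calculus)
          (auto intro!: derivative_eq_intros simp flip: has_real_derivative_iff_has_vector_derivative)
      moreover have "sin (2 * pi * of_int k) = 0"
        using sin_integer_2pi[of "of_int k"] by (simp add: mult.commute mult.left_commute)
      ultimately show ?thesis using False by simp
    qed
    have "cos (2 * pi * n * v) * cos (2 * pi * m * v) =
       (cos (2 * pi * of_int (int n + int m) * v) + cos (2 * pi * of_int (int n - int m) * v)) / 2" for v
    proof -
      have "2 * pi * of_int (int n + int m) * v = 2 * pi * n * v + 2 * pi * m * v"
           "2 * pi * of_int (int n - int m) * v = 2 * pi * n * v - 2 * pi * m * v"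
        by (simp_all add: algebra_simps)
      then show ?thesis by (simp only: cos_add cos_diff) simp
    qed
    then have "((\<lambda>v. cos (2 * pi * n * v) * cos (2 * pi * m * v)) has_integral
        ((if int n + int m = 0 then 1 else 0) + (if int n - int m = 0 then 1 else 0)) / 2) {0..1}"
      using has_integral_divide[OF has_integral_add[OF 1[of "int n + int m"] 1[of "int n - int m"]], of 2] by (simp only:)
    moreover have "((if int n + int m = 0 then 1 else 0) + (if int n - int m = 0 then 1 else 0)) / 2 =
       (if n = m then if m = 0 then 1 else 1/2 else (0::real))"
      by auto
    ultimately show ?thesis by (simp only: integral_unique)
  qed
  have coeffH: "integral {0..1} (\<lambda>v. H v * cos (2 * pi * m * v)) = (if m = 0 then b 0 else b m / 2)" for m :: nat
  proof -
    have u: "uniform_limit {0..1} (\<lambda>N v. (\<Sum>n<N. b n * cos (2 * pi * n * v)) * cos (2 * pi * m * v))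
      (\<lambda>v. H v * cos (2 * pi * m * v)) sequentially"
    proof (rule uniform_lim_mult[OF unif uniform_limit_const])
      show "bounded (H ` {0..1})"
        using compact_continuous_image[OF contH] compact_imp_bounded by auto
      show "bounded ((\<lambda>v. cos (2 * pi * m * v)) ` {0..1})"
        by (rule boundedI[of _ 1]) auto
    qed
    obtain I J where IJ: "\<And>N. ((\<lambda>v. (\<Sum>n<N. b n * cos (2 * pi * n * v)) * cos (2 * pi * m * v)) has_integral I N) {0..1}"
      "((\<lambda>v. H v * cos (2 * pi * m * v)) has_integral J) {0..1}" "I \<longlonglongrightarrow> J"
      by (rule uniform_limit_integral[OF u]) (auto intro!: continuous_intros)
    have "I N = (\<Sum>n<N. b n * (if n = m then if m = 0 then 1 else 1/2 else 0))" for N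
    proof -
      have "I N = integral {0..1} (\<lambda>v. \<Sum>n<N. b n * (cos (2 * pi * n * v) * cos (2 * pi * m * v)))"
        using IJ(1)[of N] by (simp add: integral_unique sum_distrib_right mult.assoc)
      also have "\<dots> = (\<Sum>n<N. integral {0..1} (\<lambda>v. b n * (cos (2 * pi * n * v) * cos (2 * pi * m * v))))"
        by (intro integral_sum) (auto intro!: integrable_continuous_real continuous_intros)
      also have "\<dots> = (\<Sum>n<N. b n * (if n = m then if m = 0 then 1 else 1/2 else 0))"
        by (simp only: integral_mult_right cos_int)
      finally show ?thesis .
    qed
    then have "I N = (if m = 0 then b 0 else b m / 2)" if "N > m" for N
      using that by (simp add: sum.delta if_distrib cong: if_cong)
    then have "eventually (\<lambda>N. I N = (if m = 0 then b 0 else b m / 2)) sequentially"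
      by (intro eventually_mono[OF eventually_gt_at_top[of m]]) blast
    then have "J = (if m = 0 then b 0 else b m / 2)"
      using IJ(3) LIMSEQ_unique tendsto_eventually by blast
    then show ?thesis using IJ(2) by (simp add: integral_unique)
  qed
  \<comment> \<open>The cosine series \<open>H\<close> and the given function have the same
    coefficients, so uniqueness identifies them.\<close>
  have "\<phi> 0 - H 0 = 0"
  proof (rule cosine_uniqueness[where D = "\<lambda>v. \<phi> v - H v"])
    show "continuous_on {0..1} (\<lambda>v. \<phi> v - H v)" by (intro continuous_intros cont contH)
    have "cos (2 * pi * n * (1 - v)) = cos (2 * pi * n * v)" for n :: nat and v
    proof -
      have "cos (2 * pi * n) = 1" "sin (2 * pi * n) = 0"
        using cos_integer_2pi[of n] sin_integer_2pi[of n] by (simp_all add: mult.commute mult.left_commute)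
      moreover have "2 * pi * n * (1 - v) = 2 * pi * n - 2 * pi * n * v" by (simp add: algebra_simps)
      ultimately show ?thesis by (simp add: cos_diff)
    qed
    then show "\<phi> (1 - v) - H (1 - v) = \<phi> v - H v" if "v \<in> {0..1}" for v
      using sym[OF that] by (simp only: H_def)
    show "integral {0..1} (\<lambda>v. (\<phi> v - H v) * cos (2 * pi * m * v)) = 0" for m :: nat
      unfolding left_diff_distrib
      by (subst Henstock_Kurzweil_Integration.integral_diff)
         (auto intro!: integrable_continuous_real continuous_intros cont contH simp: coeff coeffH)
  qed simp
  moreover have "b sums H 0"
    unfolding H_def using summable_rabs_cancel[OF summ] by (simp add: summable_sums)
  ultimately show ?thesis by simp
qed

text \<open>The substitution x -> -c + x / sqrt (2 pi t) turns the Gaussian into the standard normal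
  density, whose characteristic function is known. The addition theorem for the cosine brings out
  the factor cos (2 pi m c); the sine part integrates to 0.\<close>

lemma gaussian_cos_integral:
  fixes m c t :: real
  assumes t: "t > 0"
  shows "has_bochner_integral lborel (\<lambda>x. exp (- pi * t * (x + c)\<^sup>2) * cos (2 * pi * m * x))
    (cos (2 * pi * m * c) * exp (- pi * m\<^sup>2 / t) / sqrt t)"
proof -
  define s where "s = 1 / sqrt (2 * pi * t)"
  have s: "s > 0" using t by (simp add: s_def)
  have s2: "2 * pi * t * s\<^sup>2 = 1" using t by (simp add: s_def power_divide)
  define \<theta> where "\<theta> = 2 * pi * m * s"
  have ic: "integrable lborel (\<lambda>x. std_normal_density x *\<^sub>R iexp (\<theta> * x))"
  proof (rule Bochner_Integration.integrable_bound[OF integrable_normal_density[of 1 0]])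
    show "AE x in lborel. norm (std_normal_density x *\<^sub>R iexp (\<theta> * x)) \<le> norm (std_normal_density x)"
      by (rule always_eventually) (simp only: norm_scaleR norm_exp_i_times mult_1_right real_norm_def order.refl simp_thms)
  qed simp_all
  have "char std_normal_distribution \<theta> = (CLBINT x. std_normal_density x *\<^sub>R iexp (\<theta> * x))"
    unfolding char_def by (subst integral_density) (auto simp: normal_density_nonneg)
  then have hb: "has_bochner_integral lborel (\<lambda>x. std_normal_density x *\<^sub>R iexp (\<theta> * x)) (of_real (exp (- \<theta>\<^sup>2 / 2)))"
    using ic by (simp add: has_bochner_integral_iff char_std_normal_distribution)
  have re: "has_bochner_integral lborel (\<lambda>x. std_normal_density x * cos (\<theta> * x)) (exp (- \<theta>\<^sup>2 / 2))"
    using has_bochner_integral_bounded_linear[OF bounded_linear_Re hb] by (simp only: scaleR_complex.sel cis_conv_exp[symmetric] cis.sel Re_complex_of_real)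
  have im: "has_bochner_integral lborel (\<lambda>x. std_normal_density x * sin (\<theta> * x)) 0"
    using has_bochner_integral_bounded_linear[OF bounded_linear_Im hb] by (simp only: scaleR_complex.sel cis_conv_exp[symmetric] cis.sel Im_complex_of_real)
  have "has_bochner_integral lborel (\<lambda>x. cos (2 * pi * m * c) * (std_normal_density x * cos (\<theta> * x))
      + sin (2 * pi * m * c) * (std_normal_density x * sin (\<theta> * x)))
      (cos (2 * pi * m * c) * exp (- \<theta>\<^sup>2 / 2) + sin (2 * pi * m * c) * 0)"
    by (rule has_bochner_integral_add[OF has_bochner_integral_mult_right[OF re] has_bochner_integral_mult_right[OF im]])
  moreover have "cos (2 * pi * m * c) * (std_normal_density x * cos (\<theta> * x))
      + sin (2 * pi * m * c) * (std_normal_density x * sin (\<theta> * x))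
      = (1 / sqrt (2 * pi)) * (exp (- pi * t * (-c + s * x + c)\<^sup>2) * cos (2 * pi * m * (-c + s * x)))" for x
  proof -
    have "- pi * t * (-c + s * x + c)\<^sup>2 = - (2 * pi * t * s\<^sup>2) * x\<^sup>2 / 2" by (simp add: power_mult_distrib)
    then have 1: "exp (- pi * t * (-c + s * x + c)\<^sup>2) = exp (- x\<^sup>2 / 2)" by (simp only: s2) simp
    have 2: "2 * pi * m * (-c + s * x) = \<theta> * x - 2 * pi * m * c" by (simp add: \<theta>_def algebra_simps)
    show ?thesis unfolding 1 2 normal_density_def by (simp add: cos_diff algebra_simps)
  qed
  ultimately have hb2: "has_bochner_integral lborel
     (\<lambda>x. (1 / sqrt (2 * pi)) * (exp (- pi * t * (-c + s * x + c)\<^sup>2) * cos (2 * pi * m * (-c + s * x))))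
     (cos (2 * pi * m * c) * exp (- \<theta>\<^sup>2 / 2))" by simp
  have hb3: "has_bochner_integral lborel
     (\<lambda>x. exp (- pi * t * (-c + s * x + c)\<^sup>2) * cos (2 * pi * m * (-c + s * x)))
     (sqrt (2 * pi) * (cos (2 * pi * m * c) * exp (- \<theta>\<^sup>2 / 2)))"
    using has_bochner_integral_mult_right[OF hb2, of "sqrt (2 * pi)"] by simp
  have hb4: "has_bochner_integral lborel (\<lambda>x. exp (- pi * t * (x + c)\<^sup>2) * cos (2 * pi * m * x))
     (s * (sqrt (2 * pi) * (cos (2 * pi * m * c) * exp (- \<theta>\<^sup>2 / 2))))"
    using hb3 s by (subst lborel_has_bochner_integral_real_affine_iff[of s _ _ "-c"]) (simp_all flip: mult.assoc)
  have "s * sqrt (2 * pi) = 1 / sqrt t" by (simp add: s_def real_sqrt_mult)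
  moreover have "- \<theta>\<^sup>2 / 2 = - pi * m\<^sup>2 / t"
  proof -
    have "\<theta>\<^sup>2 = 4 * pi\<^sup>2 * m\<^sup>2 * s\<^sup>2" by (simp add: \<theta>_def power_mult_distrib)
    also have "s\<^sup>2 = 1 / (2 * pi * t)" using t by (simp add: s_def power_divide)
    finally have "\<theta>\<^sup>2 = 2 * (pi * m\<^sup>2 / t)" by (simp add: power2_eq_square)
    then show ?thesis by simp
  qed
  moreover have "s * (sqrt (2 * pi) * (cos (2 * pi * m * c) * exp (- \<theta>\<^sup>2 / 2))) =
      (s * sqrt (2 * pi)) * (cos (2 * pi * m * c) * exp (- \<theta>\<^sup>2 / 2))"
    by (simp only: mult.assoc)
  ultimately have "s * (sqrt (2 * pi) * (cos (2 * pi * m * c) * exp (- \<theta>\<^sup>2 / 2))) =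
      cos (2 * pi * m * c) * exp (- pi * m\<^sup>2 / t) / sqrt t" by (simp only:) simp
  then show ?thesis using hb4 by (simp only:)
qed

lemma has_sum_int:
  fixes f :: "int \<Rightarrow> 'a::banach"
  assumes "summable (\<lambda>n. norm (f (int n)))" "summable (\<lambda>n. norm (f (- int n - 1)))"
  shows "(f has_sum ((\<Sum>n. f (int n)) + (\<Sum>n. f (- int n - 1)))) UNIV"
proof -
  have U: "(UNIV :: int set) = range int \<union> range (\<lambda>n. - int n - 1)"
  proof (intro set_eqI iffI UNIV_I)
    fix x :: int
    show "x \<in> range int \<union> range (\<lambda>n. - int n - 1)"
    proof (cases "x \<ge> 0")
      case True
      then have "x = int (nat x)" by simp
      then show ?thesis by blast
    next
      case False
      then have "x = - int (nat (- x - 1)) - 1" by simp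
      then show ?thesis by blast
    qed
  qed
  have inj: "inj int" "inj (\<lambda>n. - int n - 1)" by (auto simp: inj_on_def)
  have disj: "range int \<inter> range (\<lambda>n. - int n - 1) = {}" by auto
  have "((\<lambda>n. f (int n)) has_sum (\<Sum>n. f (int n))) UNIV"
    by (rule norm_summable_imp_has_sum[OF assms(1) summable_sums[OF summable_norm_cancel[OF assms(1)]]])
  then have 1: "(f has_sum (\<Sum>n. f (int n))) (range int)"
    unfolding has_sum_reindex[OF inj(1)] by (simp add: o_def)
  have "((\<lambda>n. f (- int n - 1)) has_sum (\<Sum>n. f (- int n - 1))) UNIV"
    by (rule norm_summable_imp_has_sum[OF assms(2) summable_sums[OF summable_norm_cancel[OF assms(2)]]])
  then have 2: "(f has_sum (\<Sum>n. f (- int n - 1))) (range (\<lambda>n. - int n - 1))"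
    unfolding has_sum_reindex[OF inj(2)] by (simp add: o_def)
  show ?thesis unfolding U by (rule has_sum_Un_disjoint[OF 1 2 disj])
qed

lemma sums_neg_int:
  fixes f :: "int \<Rightarrow> 'a::real_normed_vector"
  assumes "(\<lambda>n. f (- int n - 1)) sums S"
  shows "(\<lambda>n. f (- int n)) sums (S + f 0)"
proof -
  have "(\<lambda>n. f (- int (Suc n))) = (\<lambda>n. f (- int n - 1))"
    by (rule ext, rule arg_cong[of _ _ f]) simp
  then have "(\<lambda>n. f (- int (Suc n))) sums S" using assms by (simp only:)
  then show ?thesis by (subst (asm) sums_Suc_iff) simp
qed

lemma exp_neg_square_le:
  fixes a x :: real
  assumes "a \<ge> 0"
  shows "exp (- a * x\<^sup>2) \<le> exp a * exp (- 2 * a * \<bar>x\<bar>)"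
proof -
  have "0 \<le> (\<bar>x\<bar> - 1)\<^sup>2" by simp
  then have "2 * \<bar>x\<bar> \<le> x\<^sup>2 + 1" by (simp add: power2_diff)
  from mult_left_mono[OF this assms] show ?thesis
    unfolding exp_add[symmetric] by (simp add: algebra_simps)
qed

lemma summable_exp_linear:
  fixes a b :: real assumes "a > 0"
  shows "summable (\<lambda>n. b * exp (- a * real n))"
proof -
  have "summable (\<lambda>n. exp (- a) ^ n)" using assms by (intro summable_geometric) simp
  then have "summable (\<lambda>n. exp (- a * real n))" unfolding exp_of_nat2_mult .
  then show ?thesis by (rule summable_mult)
qed

text \<open>The Gaussian is made even by adding its mirror image, so that its periodization has a
  pure cosine series; the sums are then counted twice. Convergence is stated as
  \<open>has_sum\<close>, independent of the order, so that products over coordinates can be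
  multiplied out later.\<close>

theorem poisson_gaussian_1d:
  fixes t c :: real
  assumes t: "t > 0"
  obtains S where
    "((\<lambda>k::int. exp (- pi * t * (of_int k + c)\<^sup>2)) has_sum S) UNIV"
    "((\<lambda>m::int. of_real (exp (- pi * (of_int m)\<^sup>2 / t)) * cis (2 * pi * of_int m * c)) has_sum of_real (sqrt t * S)) UNIV"
proof -
  define G where "G x = exp (- pi * t * (x + c)\<^sup>2) + exp (- pi * t * (x - c)\<^sup>2)" for x
  have G_sym: "G (- x) = G x" for x
    by (simp add: G_def power2_eq_square algebra_simps)
  have G_cont: "continuous_on A G" for A unfolding G_def by (intro continuous_intros)
  define K where "K = exp (pi * t) * exp (2 * pi * t * (1 + \<bar>c\<bar>))"
  have g_le: "exp (- pi * t * (x + d)\<^sup>2) \<le> K * exp (- (2 * pi * t) * real k)"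
    if "\<bar>x\<bar> \<ge> real k - 1" "\<bar>d\<bar> = \<bar>c\<bar>" for x d k
  proof -
    have "exp (- (pi * t) * (x + d)\<^sup>2) \<le> exp (pi * t) * exp (- 2 * (pi * t) * \<bar>x + d\<bar>)"
      using t by (intro exp_neg_square_le) auto
    also have "exp (- 2 * (pi * t) * \<bar>x + d\<bar>) \<le> exp (2 * pi * t * (1 + \<bar>c\<bar>) - (2 * pi * t) * real k)"
    proof -
      have "real k - 1 - \<bar>c\<bar> \<le> \<bar>x + d\<bar>" using that by linarith
      from mult_left_mono[OF this, of "2 * pi * t"] show ?thesis using t by (simp add: algebra_simps)
    qed
    also have "\<dots> = exp (2 * pi * t * (1 + \<bar>c\<bar>)) * exp (- (2 * pi * t) * real k)"
      by (simp flip: exp_add)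
    finally show ?thesis by (simp add: K_def mult.assoc)
  qed
  have G_le: "\<bar>G x\<bar> \<le> 2 * K * exp (- (2 * pi * t) * real k)" if "\<bar>x\<bar> \<ge> real k - 1" for x k
    using g_le[OF that, of c] g_le[OF that, of "-c"] by (simp add: G_def)
  \<comment> \<open>Pairing the shifts by k and by -k-1 makes the partial sum over k < N cover
    exactly the interval from -N to N.\<close>
  define T where "T k v = G (v + real k) + G (v - real k - 1)" for k v
  have T_le: "norm (T k v) \<le> 4 * K * exp (- (2 * pi * t) * real k)" if "v \<in> {0..1}" for k v
    using G_le[of k "v + real k"] G_le[of k "v - real k - 1"] that unfolding T_def by auto
  have summ: "summable (\<lambda>k. 4 * K * exp (- (2 * pi * t) * real k))" for K
    using t by (intro summable_exp_linear) auto
  define \<phi> where "\<phi> v = (\<Sum>k. T k v)" for v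
  have unif: "uniform_limit {0..1} (\<lambda>N v. \<Sum>k<N. T k v) \<phi> sequentially"
    unfolding \<phi>_def[abs_def] by (rule Weierstrass_m_test[OF T_le summ])
  have T_cont: "continuous_on {0..1} (T k)" for k
    unfolding T_def G_def by (intro continuous_intros)
  have \<phi>_cont: "continuous_on {0..1} \<phi>"
    by (rule uniform_limit_theorem[OF _ unif]) (auto intro!: continuous_intros always_eventually T_cont)
  have \<phi>_sym: "\<phi> (1 - v) = \<phi> v" for v
  proof -
    have "T k (1 - v) = T k v" for k
      using G_sym[of "v - real k - 1"] G_sym[of "v + real k"] by (simp add: T_def algebra_simps)
    then show ?thesis by (simp add: \<phi>_def)
  qed
  define J where "J m = 2 * cos (2 * pi * real m * c) * exp (- pi * (real m)\<^sup>2 / t) / sqrt t" for m :: nat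
  have GJ: "has_bochner_integral lborel (\<lambda>x. G x * cos (2 * pi * real m * x)) (J m)" for m
  proof -
    have "has_bochner_integral lborel (\<lambda>x. exp (- pi * t * (x + c)\<^sup>2) * cos (2 * pi * m * x) + exp (- pi * t * (x + -c)\<^sup>2) * cos (2 * pi * m * x))
       (cos (2 * pi * m * c) * exp (- pi * (real m)\<^sup>2 / t) / sqrt t + cos (2 * pi * m * -c) * exp (- pi * (real m)\<^sup>2 / t) / sqrt t)"
      by (intro has_bochner_integral_add gaussian_cos_integral t)
    then show ?thesis by (simp add: G_def J_def distrib_right mult.assoc)
  qed
  have \<phi>J: "integral {0..1} (\<lambda>v. \<phi> v * cos (2 * pi * m * v)) = J m" for m :: nat
  proof -
    define F where "F x = G x * cos (2 * pi * m * x)" for x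
    have F_cont: "continuous_on A F" for A unfolding F_def by (intro continuous_intros G_cont)
    have u: "uniform_limit {0..1} (\<lambda>N v. (\<Sum>k<N. T k v) * cos (2 * pi * m * v))
      (\<lambda>v. \<phi> v * cos (2 * pi * m * v)) sequentially"
    proof (rule uniform_lim_mult[OF unif uniform_limit_const])
      show "bounded (\<phi> ` {0..1})"
        using compact_continuous_image[OF \<phi>_cont] compact_imp_bounded by auto
      show "bounded ((\<lambda>v. cos (2 * pi * m * v)) ` {0..1})"
        by (rule boundedI[of _ 1]) auto
    qed
    obtain I L where IL: "\<And>N. ((\<lambda>v. (\<Sum>k<N. T k v) * cos (2 * pi * m * v)) has_integral I N) {0..1}"
      "((\<lambda>v. \<phi> v * cos (2 * pi * m * v)) has_integral L) {0..1}" "I \<longlonglongrightarrow> L"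
      by (rule uniform_limit_integral[OF u]) (auto intro!: continuous_intros T_cont)
    have shift: "integral {0..1} (\<lambda>v. F (v + of_int k)) = integral {of_int k..of_int k + 1} F" for k :: int
      using integral_shift[of 0 "of_int k" 1 F] F_cont by (simp add: o_def add.commute)
    have per: "cos (2 * pi * m * (v + of_int k)) = cos (2 * pi * m * v)" for k :: int and v
    proof -
      have "cos (2 * pi * of_int (int m * k)) = 1" "sin (2 * pi * of_int (int m * k)) = 0"
        using cos_int_2pin[of "int m * k"] sin_int_2pin[of "int m * k"] by simp_all
      moreover have "2 * pi * m * (v + of_int k) = 2 * pi * m * v + 2 * pi * of_int (int m * k)"
        by (simp add: algebra_simps)
      ultimately show ?thesis by (simp add: cos_add)
    qed
    \<comment> \<open>Unfolding: the cosine has period 1, so the integral of the N-th partial sum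
      over one period is an integral over [-N, N].\<close>
    have I: "I N = integral {- real N..real N} F" for N
    proof (induction N)
      case 0
      then show ?case using IL(1)[of 0] by (simp add: has_integral_unique[OF _ has_integral_0])
    next
      case (Suc N)
      have "I (Suc N) = integral {0..1} (\<lambda>v. (\<Sum>k<N. T k v) * cos (2 * pi * m * v) + (F (v + of_int (int N)) + F (v + of_int (- int N - 1))))"
        using IL(1)[of "Suc N"] unfolding F_def per by (simp add: integral_unique T_def algebra_simps)
      also have "\<dots> = I N + (integral {0..1} (\<lambda>v. F (v + of_int (int N))) + integral {0..1} (\<lambda>v. F (v + of_int (- int N - 1))))"
      proof -
        have i1: "(\<lambda>v. (\<Sum>k<N. T k v) * cos (2 * pi * m * v)) integrable_on {0..1}"
          using IL(1)[of N] by blast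
        have i2: "(\<lambda>v. F (v + of_int k)) integrable_on {0..1}" for k :: int
          by (intro integrable_continuous_real continuous_on_compose2[OF F_cont[of UNIV]] continuous_intros) auto
        have "I N = integral {0..1} (\<lambda>v. (\<Sum>k<N. T k v) * cos (2 * pi * m * v))"
          using IL(1)[of N] by (simp only: integral_unique)
        then show ?thesis
          by (simp only: Henstock_Kurzweil_Integration.integral_add[OF i1 integrable_add[OF i2 i2]]
                Henstock_Kurzweil_Integration.integral_add[OF i2 i2])
      qed
      also have "\<dots> = integral {- real N - 1..- real N} F + integral {- real N..real N} F + integral {real N..real N + 1} F"
        unfolding shift Suc by simp
      also have "\<dots> = integral {- real N - 1..real N + 1} F"
      proof -
        have Fi: "F integrable_on {a..b}" for a b by (intro integrable_continuous_real F_cont)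
        have "integral {- real N - 1..- real N} F + integral {- real N..real N} F = integral {- real N - 1..real N} F"
          by (rule Henstock_Kurzweil_Integration.integral_combine[OF _ _ Fi]) auto
        moreover have "integral {- real N - 1..real N} F + integral {real N..real N + 1} F = integral {- real N - 1..real N + 1} F"
          by (rule Henstock_Kurzweil_Integration.integral_combine[OF _ _ Fi]) auto
        ultimately show ?thesis by (simp only:)
      qed
      finally have "I (Suc N) = integral {- real N - 1..real N + 1} F" .
      moreover have "- real (Suc N) = - real N - 1" "real (Suc N) = real N + 1" by simp_all
      ultimately show ?case by (simp only:)
    qed
    have Fint: "integrable lborel F" "integral\<^sup>L lborel F = J m"
      using GJ[of m] by (auto simp: has_bochner_integral_iff F_def[abs_def])
    have "(\<lambda>N. \<integral>x. indicator {- real N..real N} x *\<^sub>R F x \<partial>lborel) \<longlonglongrightarrow> integral\<^sup>L lborel F"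
    proof (rule integral_dominated_convergence[where w = "\<lambda>x. norm (F x)"])
      show "AE x in lborel. (\<lambda>N. indicator {- real N..real N} x *\<^sub>R F x) \<longlonglongrightarrow> F x"
      proof (rule AE_I2)
        fix x
        obtain n :: nat where n: "\<bar>x\<bar> \<le> real n" using real_arch_simple by blast
        have "indicator {- real N..real N} x *\<^sub>R F x = F x" if "N \<ge> n" for N
        proof -
          have "real n \<le> real N" using that by simp
          then have "x \<in> {- real N..real N}" using n by auto
          then show ?thesis by simp
        qed
        then show "(\<lambda>N. indicator {- real N..real N} x *\<^sub>R F x) \<longlonglongrightarrow> F x"
          by (intro tendsto_eventually eventually_sequentiallyI)
      qed
      show "AE x in lborel. norm (indicator {- real N..real N} x *\<^sub>R F x) \<le> norm (F x)" for N
        by (rule AE_I2) (simp add: indicator_def)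
    qed (use Fint in auto)
    moreover have "(\<integral>x. indicator {- real N..real N} x *\<^sub>R F x \<partial>lborel) = I N" for N
    proof -
      have "set_integrable lborel {- real N..real N} F"
        unfolding set_integrable_def using Fint by (intro integrable_mult_indicator) auto
      from set_borel_integral_eq_integral(2)[OF this] show ?thesis
        by (simp add: I set_lebesgue_integral_def)
    qed
    ultimately have "I \<longlonglongrightarrow> J m" using Fint(2) by simp
    then have "L = J m" using IL(3) LIMSEQ_unique by blast
    then show ?thesis using IL(2) by (simp add: integral_unique)
  qed
  define b where "b m = (if m = 0 then J m else 2 * J m)" for m
  have J_le: "\<bar>J m\<bar> \<le> 2 / sqrt t * (exp (pi / t) * exp (- (2 * pi / t) * real m))" for m
  proof -
    have "\<bar>J m\<bar> = 2 / sqrt t * (\<bar>cos (2 * pi * real m * c)\<bar> * exp (- (pi / t) * (real m)\<^sup>2))"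
      using t by (simp add: J_def abs_mult)
    also have "\<dots> \<le> 2 / sqrt t * (1 * (exp (pi / t) * exp (- 2 * (pi / t) * \<bar>real m\<bar>)))"
      using t by (intro mult_left_mono mult_mono exp_neg_square_le) auto
    finally show ?thesis by simp
  qed
  have bsum: "summable (\<lambda>m. \<bar>b m\<bar>)"
  proof (rule summable_comparison_test')
    show "norm \<bar>b m\<bar> \<le> 4 / sqrt t * exp (pi / t) * exp (- (2 * pi / t) * real m)" for m
    proof -
      have "norm \<bar>b m\<bar> \<le> 2 * \<bar>J m\<bar>" by (simp add: b_def abs_mult)
      also have "\<dots> \<le> 2 * (2 / sqrt t * (exp (pi / t) * exp (- (2 * pi / t) * real m)))"
        by (intro mult_left_mono J_le) simp
      finally show ?thesis by simp
    qed
    show "summable (\<lambda>m. 4 / sqrt t * exp (pi / t) * exp (- (2 * pi / t) * real m))"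
      using t by (intro summable_exp_linear) auto
  qed
  have "b sums \<phi> 0"
    by (rule cosine_inversion[OF \<phi>_cont \<phi>_sym _ bsum]) (simp add: \<phi>J b_def)

  define f where "f k = exp (- pi * t * (of_int k + c)\<^sup>2)" for k :: int
  have f_summ: "summable (\<lambda>n. norm (f (int n)))" "summable (\<lambda>n. norm (f (- int n - 1)))"
  proof -
    have s: "summable (\<lambda>n. K * exp (- (2 * pi * t) * real n))"
      using t by (intro summable_exp_linear) auto
    have "norm (f (int n)) \<le> K * exp (- (2 * pi * t) * real n)" for n
      using g_le[where x = "real n" and k = n and d = c] by (simp add: f_def)
    then show "summable (\<lambda>n. norm (f (int n)))"
      by (intro summable_comparison_test'[OF s, of 0]) simp
    have "norm (f (- int n - 1)) \<le> K * exp (- (2 * pi * t) * real n)" for n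
      using g_le[where x = "- real n - 1" and k = n and d = c] by (simp add: f_def)
    then show "summable (\<lambda>n. norm (f (- int n - 1)))"
      by (intro summable_comparison_test'[OF s, of 0]) simp
  qed
  define S1 where "S1 = (\<Sum>n. f (int n))"
  define S2 where "S2 = (\<Sum>n. f (- int n - 1))"
  have S: "(f has_sum (S1 + S2)) UNIV" unfolding S1_def S2_def by (rule has_sum_int[OF f_summ])
  have s1: "(\<lambda>n. f (int n)) sums S1" and s2: "(\<lambda>n. f (- int n - 1)) sums S2"
    unfolding S1_def S2_def using f_summ[THEN summable_norm_cancel] by (simp_all only: summable_sums)
  have s1': "(\<lambda>n. f (int n + 1)) sums (S1 - f 0)"
    using s1 sums_Suc_iff[of "\<lambda>n. f (int n)" "S1 - f 0"] by (simp add: add.commute)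
  have s2': "(\<lambda>n. f (- int n)) sums (S2 + f 0)"
    by (rule sums_neg_int[OF s2])
  \<comment> \<open>At v = 0 every integer shift of the Gaussian is met twice, once from each mirror
    image.\<close>
  have "T n 0 = f (int n) + f (- int n) + (f (- int n - 1) + f (int n + 1))" for n
  proof -
    have sq: "(real n - c)\<^sup>2 = (of_int (- int n) + c)\<^sup>2" "(- real n - 1 - c)\<^sup>2 = (of_int (int n + 1) + c)\<^sup>2"
      "(- real n - 1 + c)\<^sup>2 = (of_int (- int n - 1) + c)\<^sup>2"
      by (simp_all add: power2_eq_square algebra_simps)
    have "T n 0 = exp (- pi * t * (real n + c)\<^sup>2) + exp (- pi * t * (real n - c)\<^sup>2) +
        (exp (- pi * t * (- real n - 1 + c)\<^sup>2) + exp (- pi * t * (- real n - 1 - c)\<^sup>2))"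
      by (simp only: T_def G_def add_0 diff_0)
    then show ?thesis unfolding sq f_def by (simp only: of_int_of_nat_eq)
  qed
  then have "(\<lambda>n. T n 0) sums (S1 + (S2 + f 0) + (S2 + (S1 - f 0)))"
    using sums_add[OF sums_add[OF s1 s2'] sums_add[OF s2 s1']] by (simp only:)
  then have \<phi>0: "\<phi> 0 = 2 * (S1 + S2)" by (simp add: \<phi>_def sums_iff)
  define h where "h m = of_real (exp (- pi * (of_int m)\<^sup>2 / t)) * cis (2 * pi * of_int m * c)" for m :: int
  have norm_h: "norm (h m) \<le> exp (pi / t) * exp (- (2 * pi / t) * \<bar>of_int m\<bar>)" for m
    using exp_neg_square_le[of "pi / t" "of_int m"] t by (simp add: h_def norm_mult)
  have h_summ: "summable (\<lambda>n. norm (h (int n)))" "summable (\<lambda>n. norm (h (- int n - 1)))"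
  proof -
    have s: "summable (\<lambda>n. exp (pi / t) * exp (- (2 * pi / t) * real n))"
      using t by (intro summable_exp_linear) auto
    show "summable (\<lambda>n. norm (h (int n)))"
      by (rule summable_comparison_test'[OF s, of 0]) (use norm_h[of "int n" for n] in simp)
    have "exp (- (2 * pi / t) * \<bar>of_int (- int n - 1)\<bar>) \<le> exp (- (2 * pi / t) * real n)" for n
      using t by simp (simp add: divide_right_mono mult_left_mono)
    then have "norm (h (- int n - 1)) \<le> exp (pi / t) * exp (- (2 * pi / t) * real n)" for n
      using norm_h[of "- int n - 1"] by (meson exp_ge_zero mult_left_mono order_trans)
    then show "summable (\<lambda>n. norm (h (- int n - 1)))"
      by (intro summable_comparison_test'[OF s, of 0]) simp
  qed
  define H1 where "H1 = (\<Sum>n. h (int n))"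
  define H2 where "H2 = (\<Sum>n. h (- int n - 1))"
  have H: "(h has_sum (H1 + H2)) UNIV" unfolding H1_def H2_def by (rule has_sum_int[OF h_summ])
  have h1: "(\<lambda>n. h (int n)) sums H1" and h2: "(\<lambda>n. h (- int n - 1)) sums H2"
    unfolding H1_def H2_def using h_summ[THEN summable_norm_cancel] by (simp_all only: summable_sums)
  have h2': "(\<lambda>n. h (- int n)) sums (H2 + h 0)"
    by (rule sums_neg_int[OF h2])
  \<comment> \<open>The term at 0 lies in both halves and is subtracted once.\<close>
  have "(\<lambda>n. h (int n) + h (- int n) - (if n = 0 then h 0 else 0)) sums (H1 + (H2 + h 0) - h 0)"
    using sums_single[of 0 "\<lambda>_. h 0"] by (intro sums_diff sums_add h1 h2') auto
  moreover have "h (int n) + h (- int n) - (if n = 0 then h 0 else 0) = of_real (sqrt t / 2 * b n)" for n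
    using t by (auto simp: h_def b_def J_def complex_eq_iff)
  ultimately have "(\<lambda>n. of_real (sqrt t / 2 * b n)) sums (H1 + H2)" by simp
  moreover have "(\<lambda>n. of_real (sqrt t / 2 * b n)) sums (of_real (sqrt t / 2 * \<phi> 0) :: complex)"
    by (intro sums_of_real sums_mult \<open>b sums \<phi> 0\<close>)
  ultimately have "H1 + H2 = of_real (sqrt t * (S1 + S2))"
    unfolding \<phi>0 using sums_unique2 by fastforce
  then show ?thesis
    using that[of "S1 + S2"] S H unfolding f_def[abs_def] h_def[abs_def] by simp
qed

section \<open>Poisson summation for even unimodular lattices\<close>

lemma has_sum_prod_int:
  fixes h :: "'n::finite \<Rightarrow> int \<Rightarrow> 'c::{real_normed_field,banach,second_countable_topology}"
  assumes h: "\<And>i. (\<lambda>k. norm (h i k)) summable_on UNIV" and S: "\<And>i. (h i has_sum S i) UNIV"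
  shows "((\<lambda>k. \<Prod>i\<in>UNIV. h i (k i)) has_sum (\<Prod>i\<in>UNIV. S i)) UNIV"
proof -
  have P: "PiE (UNIV :: 'n set) (\<lambda>_. UNIV :: int set) = UNIV" by (simp add: PiE_UNIV_domain)
  have "Infinite_Set_Sum.abs_summable_on (\<lambda>k. \<Prod>i\<in>UNIV. h i (k i)) (PiE UNIV (\<lambda>_. UNIV))"
    by (rule abs_summable_on_prod_PiE) (auto simp: h abs_summable_equivalent[symmetric])
  then have "(\<lambda>k. norm (\<Prod>i\<in>UNIV. h i (k i))) summable_on UNIV"
    unfolding P abs_summable_equivalent[symmetric] .
  then have "(\<lambda>k. \<Prod>i\<in>UNIV. h i (k i)) summable_on UNIV"
    by (rule abs_summable_summable)
  then have "((\<lambda>k. \<Prod>i\<in>UNIV. h i (k i)) has_sum (\<Sum>\<^sub>\<infinity>k. \<Prod>i\<in>UNIV. h i (k i))) UNIV"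
    by (rule has_sum_infsum)
  also have "(\<Sum>\<^sub>\<infinity>k. \<Prod>i\<in>UNIV. h i (k i)) = (\<Prod>i\<in>UNIV. infsum (h i) UNIV)"
    using infsum_prod_PiE_abs[of UNIV h "\<lambda>_. UNIV"] h by (simp add: P)
  also have "\<dots> = (\<Prod>i\<in>UNIV. S i)" by (simp add: infsumI[OF S])
  finally show ?thesis .
qed

lemma has_sum_sum:
  fixes f :: "'i \<Rightarrow> 'a \<Rightarrow> 'b::topological_comm_monoid_add"
  assumes "finite I" "\<And>i. (f i has_sum S i) A"
  shows "((\<lambda>x. \<Sum>i\<in>I. f i x) has_sum (\<Sum>i\<in>I. S i)) A"
  using assms(1) by (induction I rule: finite_induct) (auto intro: has_sum_add assms(2))

text \<open>Self-duality replaces any mention of a basis or a determinant; the covolume is recovered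
  later from the Poisson identity itself.\<close>

locale selfdual_lattice =
  fixes L :: "(real^'n) set"
  assumes zero_mem: "0 \<in> L"
    and diff_mem: "x \<in> L \<Longrightarrow> y \<in> L \<Longrightarrow> x - y \<in> L"
    and inner_Ints: "x \<in> L \<Longrightarrow> y \<in> L \<Longrightarrow> x \<bullet> y \<in> \<int>"
    and selfdual: "(\<And>x. x \<in> L \<Longrightarrow> x \<bullet> v \<in> \<int>) \<Longrightarrow> v \<in> L"
    and span_eq: "span L = UNIV"
begin

lemma uminus_mem: "x \<in> L \<Longrightarrow> - x \<in> L"
  using diff_mem[OF zero_mem, of x] by simp

lemma add_mem: "x \<in> L \<Longrightarrow> y \<in> L \<Longrightarrow> x + y \<in> L"
  using diff_mem[OF _ uminus_mem, of x y] by simp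

lemma scale_mem: "c \<in> \<int> \<Longrightarrow> x \<in> L \<Longrightarrow> c *\<^sub>R x \<in> L"
  by (rule selfdual) (auto intro!: Ints_mult inner_Ints)

lemma sum_mem: "(\<And>i. i \<in> A \<Longrightarrow> f i \<in> L) \<Longrightarrow> sum f A \<in> L"
  by (induction A rule: infinite_finite_induct) (auto intro: zero_mem add_mem)

section \<open>Poisson summation along an orthogonal frame of lattice vectors\<close>

text \<open>Gram-Schmidt with denominators cleared: multiplying by \<open>D\<close>, the product of
  the squared lengths found so far, keeps the new vector in \<open>L\<close>. Along such a frame a
  Gaussian factors into one-dimensional ones, although \<open>L\<close> itself need not have an
  orthogonal basis.\<close>

lemma ex_orthogonal_family:
  "\<exists>f :: 'n \<Rightarrow> real^'n. \<forall>i. f i \<in> L \<and> f i \<noteq> 0 \<and> (\<forall>j. j \<noteq> i \<longrightarrow> f i \<bullet> f j = 0)"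
proof -
  have "\<exists>f :: 'n \<Rightarrow> real^'n. \<forall>i\<in>A. f i \<in> L \<and> f i \<noteq> 0 \<and> (\<forall>j\<in>A. j \<noteq> i \<longrightarrow> f i \<bullet> f j = 0)" if "finite A" for A :: "'n set"
    using that
  proof (induction A rule: finite_induct)
    case empty
    then show ?case by auto
  next
    case (insert k A)
    then obtain f :: "'n \<Rightarrow> real^'n" where f: "\<And>i. i \<in> A \<Longrightarrow> f i \<in> L" "\<And>i. i \<in> A \<Longrightarrow> f i \<noteq> 0"
      "\<And>i j. i \<in> A \<Longrightarrow> j \<in> A \<Longrightarrow> j \<noteq> i \<Longrightarrow> f i \<bullet> f j = 0" by blast
    have "dim (span (f ` A)) < DIM(real^'n)"
    proof -
      have "dim (span (f ` A)) \<le> card (f ` A)" using insert.hyps by (simp add: dim_le_card')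
      also have "\<dots> \<le> card A" using insert.hyps by (intro card_image_le)
      also have "\<dots> < card (insert k A)" using insert.hyps by simp
      also have "\<dots> \<le> CARD('n)" by (intro card_mono) auto
      finally show ?thesis by simp
    qed
    then have "span (f ` A) \<noteq> UNIV" by (metis dim_UNIV less_irrefl)
    then have "\<not> L \<subseteq> span (f ` A)" using span_mono[of L "span (f ` A)"] span_eq by (auto simp: span_span)
    then obtain x where x: "x \<in> L" "x \<notin> span (f ` A)" by blast
    define D where "D = (\<Prod>i\<in>A. f i \<bullet> f i)"
    have D: "D \<noteq> 0" "D \<in> \<int>" using f insert.hyps by (auto simp: D_def intro!: Ints_prod inner_Ints)
    define p where "p = (\<Sum>i\<in>A. (D * (x \<bullet> f i) / (f i \<bullet> f i)) *\<^sub>R f i)"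
    define y where "y = D *\<^sub>R x - p"
    have "D * (x \<bullet> f i) / (f i \<bullet> f i) \<in> \<int>" if i: "i \<in> A" for i
    proof -
      have "D = (f i \<bullet> f i) * (\<Prod>j\<in>A - {i}. f j \<bullet> f j)"
        unfolding D_def using i insert.hyps by (simp add: prod.remove)
      then have "D * (x \<bullet> f i) / (f i \<bullet> f i) = (\<Prod>j\<in>A - {i}. f j \<bullet> f j) * (x \<bullet> f i)"
        using f(2)[OF i] by simp
      also have "\<dots> \<in> \<int>" using f x i by (auto intro!: Ints_mult Ints_prod inner_Ints)
      finally show ?thesis .
    qed
    then have y: "y \<in> L" unfolding y_def p_def using f x D by (intro diff_mem scale_mem sum_mem) auto
    have "p \<in> span (f ` A)" unfolding p_def by (intro span_sum span_scale span_base) auto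
    have y0: "y \<noteq> 0"
    proof
      assume "y = 0"
      then have "p = D *\<^sub>R x" by (simp add: y_def)
      then have "x = (1/D) *\<^sub>R p" using D by simp
      then show False using x(2) span_scale[OF \<open>p \<in> _\<close>] by metis
    qed
    have orth: "y \<bullet> f j = 0" if j: "j \<in> A" for j
    proof -
      have "p \<bullet> f j = (\<Sum>i\<in>A. if i = j then D * (x \<bullet> f j) else 0)"
        unfolding p_def inner_sum_left
        by (rule sum.cong) (use f j in \<open>auto simp: f(2,3)\<close>)
      also have "\<dots> = D * (x \<bullet> f j)" using j insert.hyps by simp
      finally show ?thesis by (simp add: y_def inner_diff_left)
    qed
    show ?case
      by (rule exI[of _ "f(k := y)"]) (use f y y0 orth insert.hyps in \<open>auto simp: inner_commute\<close>)
  qed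
  from this[of UNIV] show ?thesis by simp
qed

definition fr :: "'n \<Rightarrow> real^'n" where
  "fr = (SOME f. \<forall>i. f i \<in> L \<and> f i \<noteq> 0 \<and> (\<forall>j. j \<noteq> i \<longrightarrow> f i \<bullet> f j = 0))"

lemma fr: "fr i \<in> L" "fr i \<noteq> 0" "j \<noteq> i \<Longrightarrow> fr i \<bullet> fr j = 0"
  using someI_ex[OF ex_orthogonal_family] unfolding fr_def[symmetric] by auto

definition fn :: "'n \<Rightarrow> real" where "fn i = fr i \<bullet> fr i"

lemma fn_pos: "fn i > 0" using fr(2) by (simp add: fn_def)

definition co :: "real^'n \<Rightarrow> 'n \<Rightarrow> real" where "co v i = (v \<bullet> fr i) / fn i"

definition comb :: "('n \<Rightarrow> real) \<Rightarrow> real^'n" where "comb c = (\<Sum>i\<in>UNIV. c i *\<^sub>R fr i)"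

lemma comb_inner_fr: "comb c \<bullet> fr j = c j * fn j"
proof -
  have "comb c \<bullet> fr j = (\<Sum>i\<in>UNIV. if i = j then c j * fn j else 0)"
    unfolding comb_def inner_sum_left by (rule sum.cong) (auto simp: fr(3) fn_def)
  then show ?thesis by simp
qed

lemma co_comb: "co (comb c) = c"
  using fn_pos by (auto simp: co_def comb_inner_fr less_imp_neq[symmetric])

lemma comb_co: "comb (co v) = v"
proof -
  have "inj fr"
  proof (rule injI)
    fix i j assume "fr i = fr j"
    then show "i = j" using fr(2)[of i] fr(3)[of j i] by (metis inner_eq_zero_iff)
  qed
  have "independent (range fr)"
  proof (rule pairwise_orthogonal_independent)
    show "pairwise orthogonal (range fr)" unfolding pairwise_def orthogonal_def by (metis fr(3) imageE)
    show "0 \<notin> range fr" using fr(2) by (metis imageE)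
  qed
  then have "span (range fr) = UNIV"
    using card_image[OF \<open>inj fr\<close>] by (intro card_ge_dim_independent[of _ UNIV, THEN subset_antisym[OF subset_UNIV]]) auto
  have "orthogonal (v - comb (co v)) y" for y
  proof (rule orthogonal_to_span[of y "range fr"])
    show "y \<in> span (range fr)" using \<open>span (range fr) = UNIV\<close> by simp
    show "orthogonal (v - comb (co v)) z" if "z \<in> range fr" for z
      using that fn_pos by (auto simp: orthogonal_def inner_diff_left comb_inner_fr co_def less_imp_neq[symmetric])
  qed
  then have "orthogonal (v - comb (co v)) (v - comb (co v))" .
  then show ?thesis by (simp add: orthogonal_self)
qed

lemma co_add: "co (x + y) i = co x i + co y i"
  by (simp add: co_def inner_add_left add_divide_distrib)

lemma inner_eq_co: "x \<bullet> y = (\<Sum>i\<in>UNIV. fn i * co x i * co y i)"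
proof -
  have "x \<bullet> y = comb (co x) \<bullet> y" by (simp add: comb_co)
  also have "\<dots> = (\<Sum>i\<in>UNIV. co x i * (y \<bullet> fr i))"
    by (simp add: comb_def inner_sum_left) (simp add: inner_commute)
  also have "\<dots> = (\<Sum>i\<in>UNIV. fn i * co x i * co y i)"
    using fn_pos by (intro sum.cong) (auto simp: co_def less_imp_neq[symmetric])
  finally show ?thesis .
qed

text \<open>\<open>kap\<close> runs through the sublattice spanned by the frame, and
  \<open>eta\<close> through the dual of that sublattice, which contains \<open>L\<close>.\<close>

definition kap :: "('n \<Rightarrow> int) \<Rightarrow> real^'n" where "kap k = comb (\<lambda>i. of_int (k i))"

definition eta :: "('n \<Rightarrow> int) \<Rightarrow> real^'n" where "eta m = comb (\<lambda>i. of_int (m i) / fn i)"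

lemma co_kap: "co (kap k) i = of_int (k i)" by (simp add: kap_def co_comb)

lemma co_eta: "co (eta m) i = of_int (m i) / fn i" by (simp add: eta_def co_comb)

lemma prod_exp_cis:
  "(\<Prod>i\<in>A. complex_of_real (exp (a i)) * cis (b i)) = of_real (exp (\<Sum>i\<in>A. a i)) * cis (\<Sum>i\<in>A. b i)" if "finite A"
  using that by (induction A rule: finite_induct) (simp_all add: exp_add cis_mult[symmetric])

text \<open>In frame coordinates both summands are products over the coordinates, so this is the
  product of the one-dimensional identities with parameters \<open>t * fn i\<close>.\<close>

lemma poisson_frame:
  assumes t: "t > 0"
  shows "\<exists>S. ((\<lambda>k. exp (- pi * t * (norm (kap k + v))\<^sup>2)) has_sum S) UNIV \<and>
    ((\<lambda>m. complex_of_real (exp (- pi * (norm (eta m))\<^sup>2 / t)) * cis (2 * pi * (eta m \<bullet> v))) has_sum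
      of_real ((\<Prod>i\<in>UNIV. sqrt (t * fn i)) * S)) UNIV"
proof -
  have tf: "t * fn i > 0" for i using t fn_pos by simp
  have "\<forall>i. \<exists>S. ((\<lambda>k::int. exp (- pi * (t * fn i) * (of_int k + co v i)\<^sup>2)) has_sum S) UNIV \<and>
    ((\<lambda>m::int. complex_of_real (exp (- pi * (of_int m)\<^sup>2 / (t * fn i))) * cis (2 * pi * of_int m * co v i)) has_sum of_real (sqrt (t * fn i) * S)) UNIV"
  proof
    fix i
    show "\<exists>S. ((\<lambda>k::int. exp (- pi * (t * fn i) * (of_int k + co v i)\<^sup>2)) has_sum S) UNIV \<and>
      ((\<lambda>m::int. complex_of_real (exp (- pi * (of_int m)\<^sup>2 / (t * fn i))) * cis (2 * pi * of_int m * co v i)) has_sum of_real (sqrt (t * fn i) * S)) UNIV"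
      by (rule poisson_gaussian_1d[OF tf, of i "co v i"]) blast
  qed
  from choice[OF this] obtain S where S:
    "\<forall>i. ((\<lambda>k::int. exp (- pi * (t * fn i) * (of_int k + co v i)\<^sup>2)) has_sum S i) UNIV \<and>
    ((\<lambda>m::int. complex_of_real (exp (- pi * (of_int m)\<^sup>2 / (t * fn i))) * cis (2 * pi * of_int m * co v i)) has_sum of_real (sqrt (t * fn i) * S i)) UNIV" ..
  note S1 = S[THEN spec, THEN conjunct1] and S2 = S[THEN spec, THEN conjunct2]
  have a1: "(\<lambda>k::int. norm (exp (- pi * (t * fn i) * (of_int k + co v i)\<^sup>2))) summable_on UNIV" for i
    using S1[of i] by (auto simp: summable_on_def)
  have a2: "(\<lambda>m::int. norm (complex_of_real (exp (- pi * (of_int m)\<^sup>2 / (t * fn i))) * cis (2 * pi * of_int m * co v i))) summable_on UNIV" for i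
  proof -
    have "1 / (t * fn i) > 0" using tf by simp
    from poisson_gaussian_1d[OF this, of 0] obtain S0
      where "((\<lambda>k::int. exp (- pi * (1 / (t * fn i)) * (of_int k + 0)\<^sup>2)) has_sum S0) UNIV" by blast
    then show ?thesis by (auto simp: summable_on_def norm_mult)
  qed
  have "exp (- pi * t * (norm (kap k + v))\<^sup>2) = (\<Prod>i\<in>UNIV. exp (- pi * (t * fn i) * (of_int (k i) + co v i)\<^sup>2))" for k
    unfolding power2_norm_eq_inner inner_eq_co co_add co_kap
    by (simp flip: exp_sum add: sum_distrib_left power2_eq_square algebra_simps)
  then have 1: "((\<lambda>k. exp (- pi * t * (norm (kap k + v))\<^sup>2)) has_sum (\<Prod>i\<in>UNIV. S i)) UNIV"
    using has_sum_prod_int[OF a1 S1] by (simp only:)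
  have "complex_of_real (exp (- pi * (norm (eta m))\<^sup>2 / t)) * cis (2 * pi * (eta m \<bullet> v)) =
      (\<Prod>i\<in>UNIV. complex_of_real (exp (- pi * (of_int (m i))\<^sup>2 / (t * fn i))) * cis (2 * pi * of_int (m i) * co v i))" for m
  proof -
    have "(norm (eta m))\<^sup>2 = (\<Sum>i\<in>UNIV. (of_int (m i))\<^sup>2 / fn i)"
      unfolding power2_norm_eq_inner inner_eq_co co_eta
      using fn_pos by (intro sum.cong refl) (simp add: power2_eq_square less_imp_neq[symmetric])
    then have "- pi * (norm (eta m))\<^sup>2 / t = (\<Sum>i\<in>UNIV. - pi * (of_int (m i))\<^sup>2 / (t * fn i))"
      by (simp add: sum_distrib_left sum_divide_distrib sum_negf mult.commute)
    moreover have "eta m \<bullet> v = (\<Sum>i\<in>UNIV. of_int (m i) * co v i)"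
      unfolding inner_eq_co co_eta
      using fn_pos by (intro sum.cong refl) (simp add: less_imp_neq[symmetric])
    then have "2 * pi * (eta m \<bullet> v) = (\<Sum>i\<in>UNIV. 2 * pi * of_int (m i) * co v i)"
      by (simp add: sum_distrib_left mult.assoc)
    ultimately show ?thesis by (simp only: prod_exp_cis[OF finite])
  qed
  then have 2: "((\<lambda>m. complex_of_real (exp (- pi * (norm (eta m))\<^sup>2 / t)) * cis (2 * pi * (eta m \<bullet> v))) has_sum
      (\<Prod>i\<in>UNIV. of_real (sqrt (t * fn i) * S i))) UNIV"
    using has_sum_prod_int[OF a2 S2] by (simp only:)
  show ?thesis
    using 1 2 by (intro exI[of _ "\<Prod>i\<in>UNIV. S i"]) (simp flip: of_real_prod add: prod.distrib)
qed

section \<open>From the frame sublattice to the whole lattice\<close>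

text \<open>Representatives of the cosets of the frame sublattice, taken from the half-open box of
  the frame.\<close>

definition R :: "(real^'n) set" where
  "R = {r \<in> L. \<forall>i. 0 \<le> co r i \<and> co r i < 1}"

definition red :: "real^'n \<Rightarrow> real^'n" where
  "red x = x - kap (\<lambda>i. \<lfloor>co x i\<rfloor>)"

lemma kap_mem: "kap k \<in> L"
  unfolding kap_def comb_def by (intro sum_mem scale_mem fr) auto

lemma co_diff: "co (x - y) i = co x i - co y i"
  by (simp add: co_def inner_diff_left diff_divide_distrib)

lemma co_inject: "(\<And>i. co x i = co y i) \<Longrightarrow> x = y"
  using comb_co[of x] comb_co[of y] by (metis ext)

lemma red_mem: "x \<in> L \<Longrightarrow> red x \<in> R"
proof -
  assume x: "x \<in> L"
  have "co (red x) i = frac (co x i)" for i by (simp add: red_def co_diff co_kap frac_def)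
  then show ?thesis using x kap_mem by (auto simp: R_def frac_lt_1 red_def intro: diff_mem)
qed

lemma R_add_kap_inject:
  assumes "r \<in> R" "r' \<in> R" "r + kap k = r' + kap k'"
  shows "r = r'" "k = k'"
proof -
  have e: "co r i + of_int (k i) = co r' i + of_int (k' i)" for i
    using arg_cong[OF assms(3), of "\<lambda>x. co x i"] by (simp add: co_add co_kap)
  have "k i = k' i" for i
  proof -
    have "0 \<le> co r i" "co r i < 1" "0 \<le> co r' i" "co r' i < 1" using assms by (auto simp: R_def)
    then have "\<bar>of_int (k i) - of_int (k' i)\<bar> < (1::real)" using e[of i] by linarith
    then show ?thesis by linarith
  qed
  then show "k = k'" by (rule ext)
  then show "r = r'" using assms(3) by simp
qed

text \<open>A point of \<open>R\<close> is determined by its inner products with the frame, which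
  are integers between 0 and \<open>fn i\<close>.\<close>

lemma finite_R: "finite R"
proof -
  have "(\<lambda>r. (\<lambda>i. \<lfloor>r \<bullet> fr i\<rfloor>)) ` R \<subseteq> PiE UNIV (\<lambda>i. {0..\<lfloor>fn i\<rfloor>})"
  proof (clarsimp simp: PiE_UNIV_domain R_def)
    fix r i assume r: "\<forall>i. 0 \<le> co r i \<and> co r i < 1"
    then have "0 \<le> co r i" "co r i < 1" by auto
    then have "0 \<le> r \<bullet> fr i" "r \<bullet> fr i < fn i" using fn_pos[of i] by (auto simp: co_def field_simps)
    then show "0 \<le> r \<bullet> fr i \<and> \<lfloor>r \<bullet> fr i\<rfloor> \<le> \<lfloor>fn i\<rfloor>" by (auto intro: floor_mono)
  qed
  then have "finite ((\<lambda>r. (\<lambda>i. \<lfloor>r \<bullet> fr i\<rfloor>)) ` R)"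
    by (rule finite_subset) (intro finite_PiE; simp)
  moreover have "inj_on (\<lambda>r. (\<lambda>i. \<lfloor>r \<bullet> fr i\<rfloor>)) R"
  proof (rule inj_onI)
    fix r r' assume r: "r \<in> R" "r' \<in> R" and "(\<lambda>i. \<lfloor>r \<bullet> fr i\<rfloor>) = (\<lambda>i. \<lfloor>r' \<bullet> fr i\<rfloor>)"
    then have e: "\<lfloor>r \<bullet> fr i\<rfloor> = \<lfloor>r' \<bullet> fr i\<rfloor>" for i by metis
    have "r \<bullet> fr i = r' \<bullet> fr i" for i
    proof -
      have "r \<bullet> fr i \<in> \<int>" "r' \<bullet> fr i \<in> \<int>" using r fr by (auto simp: R_def intro: inner_Ints)
      then show ?thesis using e[of i] by (auto elim!: Ints_cases)
    qed
    then show "r = r'" by (intro co_inject) (simp add: co_def)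
  qed
  ultimately show ?thesis by (rule finite_imageD)
qed

lemma bij_R_kap: "bij_betw (\<lambda>(r, k). r + kap k) (R \<times> UNIV) L"
proof (rule bij_betwI')
  fix p q assume "p \<in> R \<times> (UNIV :: ('n \<Rightarrow> int) set)" "q \<in> R \<times> (UNIV :: ('n \<Rightarrow> int) set)"
  then show "((case p of (r, k) \<Rightarrow> r + kap k) = (case q of (r, k) \<Rightarrow> r + kap k)) = (p = q)"
    using R_add_kap_inject by (cases p; cases q) auto
next
  fix p assume "p \<in> R \<times> (UNIV :: ('n \<Rightarrow> int) set)"
  then show "(case p of (r, k) \<Rightarrow> r + kap k) \<in> L" using kap_mem by (auto simp: R_def intro: add_mem)
next
  fix x assume "x \<in> L"
  then show "\<exists>p\<in>R \<times> UNIV. x = (case p of (r, k) \<Rightarrow> r + kap k)"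
    by (intro bexI[of _ "(red x, \<lambda>i. \<lfloor>co x i\<rfloor>)"]) (auto simp: red_mem, simp add: red_def)
qed

lemma cis_two_pi_Ints: "x \<in> \<int> \<Longrightarrow> cis (2 * pi * x) = 1"
  by (elim Ints_cases) (simp add: cis_multiple_2pi)

lemma eta_inner_kap: "eta m \<bullet> kap k \<in> \<int>"
proof -
  have "eta m \<bullet> kap k = (\<Sum>i\<in>UNIV. of_int (m i * k i))"
    unfolding inner_eq_co co_eta co_kap using fn_pos by (intro sum.cong refl) (simp add: less_imp_neq[symmetric])
  also have "\<dots> = of_int (\<Sum>i\<in>UNIV. m i * k i)" by (rule of_int_sum[symmetric])
  finally show ?thesis by (simp only: Ints_of_int)
qed

text \<open>Orthogonality of the characters of \<open>L\<close> modulo the frame sublattice: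
  translation by x in \<open>L\<close> permutes the cosets and multiplies the sum by cis of 2 pi
  times \<open>eta m \<bullet> x\<close>. If this factor is 1 for all x, then \<open>eta m\<close>
  is integral on \<open>L\<close> and lies in \<open>L\<close> by self-duality.\<close>

lemma character_sum:
  "(\<Sum>r\<in>R. cis (2 * pi * (eta m \<bullet> r))) = (if eta m \<in> L then of_nat (card R) else 0)"
proof (cases "eta m \<in> L")
  case True
  then have "cis (2 * pi * (eta m \<bullet> r)) = 1" if "r \<in> R" for r
    using that by (intro cis_two_pi_Ints inner_Ints) (auto simp: R_def)
  then show ?thesis using True by simp
next
  case False
  then obtain x where x: "x \<in> L" "x \<bullet> eta m \<notin> \<int>" using selfdual by blast
  define \<sigma> where "\<sigma> r = red (r + x)" for r
  have "\<sigma> r \<in> R" if "r \<in> R" for r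
    unfolding \<sigma>_def by (intro red_mem add_mem) (use that x in \<open>auto simp: R_def\<close>)
  moreover have "inj_on \<sigma> R"
  proof (rule inj_onI)
    fix r r' assume r: "r \<in> R" "r' \<in> R" and "\<sigma> r = \<sigma> r'"
    then have "r + kap (\<lambda>i. \<lfloor>co (r' + x) i\<rfloor>) = r' + kap (\<lambda>i. \<lfloor>co (r + x) i\<rfloor>)"
      by (simp add: \<sigma>_def red_def algebra_simps)
    then show "r = r'" by (rule R_add_kap_inject[OF r])
  qed
  moreover from calculation have "\<sigma> ` R = R"
    by (intro endo_inj_surj[OF finite_R]) auto
  ultimately have "bij_betw \<sigma> R R" by (simp add: bij_betw_def)
  note bij = this
  have shift: "cis (2 * pi * (eta m \<bullet> \<sigma> r)) = cis (2 * pi * (eta m \<bullet> x)) * cis (2 * pi * (eta m \<bullet> r))" for r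
  proof -
    define z where "z = eta m \<bullet> kap (\<lambda>i. \<lfloor>co (r + x) i\<rfloor>)"
    have "cis (2 * pi * (eta m \<bullet> \<sigma> r)) = cis (2 * pi * (eta m \<bullet> x) + 2 * pi * (eta m \<bullet> r) + 2 * pi * (- z))"
      by (simp add: \<sigma>_def red_def inner_add_right inner_diff_right algebra_simps z_def)
    also have "\<dots> = cis (2 * pi * (eta m \<bullet> x)) * cis (2 * pi * (eta m \<bullet> r)) * cis (2 * pi * (- z))"
      by (simp only: cis_mult)
    also have "cis (2 * pi * (- z)) = 1"
      unfolding z_def by (intro cis_two_pi_Ints Ints_minus eta_inner_kap)
    finally show ?thesis by simp
  qed
  have "(\<Sum>r\<in>R. cis (2 * pi * (eta m \<bullet> r))) = (\<Sum>r\<in>R. cis (2 * pi * (eta m \<bullet> \<sigma> r)))"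
    by (rule sum.reindex_bij_betw[OF bij, symmetric])
  then have "(\<Sum>r\<in>R. cis (2 * pi * (eta m \<bullet> r))) = cis (2 * pi * (eta m \<bullet> x)) * (\<Sum>r\<in>R. cis (2 * pi * (eta m \<bullet> r)))"
    unfolding sum_distrib_left by (simp only: shift)
  moreover have "cis (2 * pi * (eta m \<bullet> x)) \<noteq> 1"
  proof
    assume "cis (2 * pi * (eta m \<bullet> x)) = 1"
    then have "cos (2 * pi * (eta m \<bullet> x)) = 1" by (simp add: complex_eq_iff)
    then obtain n :: int where "2 * pi * (eta m \<bullet> x) = n * 2 * pi" by (auto simp: cos_one_2pi_int)
    then have "eta m \<bullet> x = of_int n" by simp
    then show False using x(2) by (simp add: inner_commute)
  qed
  ultimately show ?thesis using False by simp
qed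

lemma bij_eta: "bij_betw eta {m. eta m \<in> L} L"
proof (rule bij_betwI')
  fix m m' show "(eta m = eta m') = (m = m')"
  proof
    assume "eta m = eta m'"
    then have "co (eta m) i = co (eta m') i" for i by simp
    then show "m = m'" using fn_pos by (auto simp: co_eta less_imp_neq[symmetric])
  qed simp
next
  fix x assume x: "x \<in> L"
  have fl: "of_int \<lfloor>x \<bullet> fr i\<rfloor> = x \<bullet> fr i" for i using inner_Ints[OF x fr(1)] by (auto elim!: Ints_cases)
  have "x = eta (\<lambda>i. \<lfloor>x \<bullet> fr i\<rfloor>)" by (rule co_inject) (simp only: co_eta fl, simp only: co_def)
  then show "\<exists>m\<in>{m. eta m \<in> L}. x = eta m" using x by (metis mem_Collect_eq)
qed simp

text \<open>The frame identity is summed over the cosets. On one side the cosets fill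
  \<open>L\<close>; on the other the character sum keeps exactly those vectors of the dual frame
  lattice that lie in \<open>L\<close>.\<close>

lemma poisson_up_to_const:
  assumes t: "t > 0"
  shows "\<exists>S. ((\<lambda>x. exp (- pi * t * (norm (x + v))\<^sup>2)) has_sum S) L \<and>
    ((\<lambda>x. complex_of_real (exp (- pi * (norm x)\<^sup>2 / t)) * cis (2 * pi * (x \<bullet> v))) has_sum
      of_real ((\<Prod>i\<in>UNIV. sqrt (t * fn i)) / card R * S)) L"
proof -
  define P where "P = (\<Prod>i\<in>UNIV. sqrt (t * fn i))"
  have "\<forall>r. \<exists>S. ((\<lambda>k. exp (- pi * t * (norm (kap k + (v + r)))\<^sup>2)) has_sum S) UNIV \<and>
    ((\<lambda>m. complex_of_real (exp (- pi * (norm (eta m))\<^sup>2 / t)) * cis (2 * pi * (eta m \<bullet> (v + r)))) has_sum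
      of_real (P * S)) UNIV"
    unfolding P_def using poisson_frame[OF t] by blast
  from choice[OF this] obtain S where S: "\<forall>r. ((\<lambda>k. exp (- pi * t * (norm (kap k + (v + r)))\<^sup>2)) has_sum S r) UNIV \<and>
    ((\<lambda>m. complex_of_real (exp (- pi * (norm (eta m))\<^sup>2 / t)) * cis (2 * pi * (eta m \<bullet> (v + r)))) has_sum
      of_real (P * S r)) UNIV" ..
  note S1 = S[THEN spec, THEN conjunct1] and S2 = S[THEN spec, THEN conjunct2]
  have f: "((\<lambda>k. (\<lambda>(r, k). exp (- pi * t * (norm (r + kap k + v))\<^sup>2)) (r, k)) has_sum S r) UNIV" for r
    using S1[of r] by (simp add: algebra_simps)
  have "((\<lambda>(r, k). exp (- pi * t * (norm (r + kap k + v))\<^sup>2)) has_sum (sum S R)) (R \<times> UNIV)"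
  proof (rule has_sum_SigmaI[OF f])
    show "(S has_sum sum S R) R" using finite_R by (rule has_sum_finite)
    show "(\<lambda>(r, k). exp (- pi * t * (norm (r + kap k + v))\<^sup>2)) summable_on R \<times> UNIV"
      by (rule summable_on_SigmaI[OF f]) (use finite_R in auto)
  qed
  then have "((\<lambda>p. exp (- pi * t * (norm ((case p of (r, k) \<Rightarrow> r + kap k) + v))\<^sup>2)) has_sum (sum S R)) (R \<times> UNIV)"
    by (simp add: case_prod_unfold)
  then have 1: "((\<lambda>x. exp (- pi * t * (norm (x + v))\<^sup>2)) has_sum (sum S R)) L"
    by (rule iffD1[OF has_sum_reindex_bij_betw[OF bij_R_kap, where f = "\<lambda>x. exp (- pi * t * (norm (x + v))\<^sup>2)"]])
  define E where "E x = complex_of_real (exp (- pi * (norm x)\<^sup>2 / t)) * cis (2 * pi * (x \<bullet> v))" for x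
  have "((\<lambda>m. \<Sum>r\<in>R. complex_of_real (exp (- pi * (norm (eta m))\<^sup>2 / t)) * cis (2 * pi * (eta m \<bullet> (v + r)))) has_sum
      (\<Sum>r\<in>R. of_real (P * S r))) UNIV"
    by (rule has_sum_sum[OF finite_R S2])
  moreover have "(\<Sum>r\<in>R. complex_of_real (exp (- pi * (norm (eta m))\<^sup>2 / t)) * cis (2 * pi * (eta m \<bullet> (v + r)))) =
      (if eta m \<in> L then E (eta m) * of_nat (card R) else 0)" for m
  proof -
    have "(\<Sum>r\<in>R. complex_of_real (exp (- pi * (norm (eta m))\<^sup>2 / t)) * cis (2 * pi * (eta m \<bullet> (v + r)))) =
        E (eta m) * (\<Sum>r\<in>R. cis (2 * pi * (eta m \<bullet> r)))"
      unfolding sum_distrib_left E_def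
      by (intro sum.cong refl) (simp add: inner_add_right distrib_left flip: cis_mult)
    then show ?thesis by (simp add: character_sum)
  qed
  ultimately have "((\<lambda>m. if eta m \<in> L then E (eta m) * of_nat (card R) else 0) has_sum (\<Sum>r\<in>R. of_real (P * S r))) UNIV"
    by (simp only:)
  then have "((\<lambda>m. E (eta m) * of_nat (card R)) has_sum (\<Sum>r\<in>R. of_real (P * S r))) {m. eta m \<in> L}"
    by (subst (asm) has_sum_cong_neutral[where T = "{m. eta m \<in> L}" and g = "\<lambda>m. E (eta m) * of_nat (card R)"]) auto
  then have "((\<lambda>x. E x * of_nat (card R)) has_sum (\<Sum>r\<in>R. of_real (P * S r))) L"
    by (rule iffD1[OF has_sum_reindex_bij_betw[OF bij_eta, where f = "\<lambda>x. E x * of_nat (card R)"]])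
  from has_sum_cmult_left[OF this, of "1 / of_nat (card R)"]
  have "((\<lambda>x. E x * of_nat (card R) * (1 / of_nat (card R))) has_sum (\<Sum>r\<in>R. of_real (P * S r)) * (1 / of_nat (card R))) L" .
  moreover have "card R \<noteq> 0"
    using finite_R red_mem[OF zero_mem] by auto
  ultimately have 2: "(E has_sum (\<Sum>r\<in>R. of_real (P * S r)) * (1 / of_nat (card R))) L" by simp
  have "(\<Sum>r\<in>R. complex_of_real (P * S r)) * (1 / of_nat (card R)) = of_real (P / card R * sum S R)"
    by (simp add: sum_distrib_left sum_divide_distrib)
  with 2 have "((\<lambda>x. complex_of_real (exp (- pi * (norm x)\<^sup>2 / t)) * cis (2 * pi * (x \<bullet> v))) has_sum
      of_real (P / card R * sum S R)) L" unfolding E_def[abs_def] by (simp only:)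
  with 1 show ?thesis unfolding P_def by blast
qed

text \<open>At t = 1 and v = 0 the two sides of \<open>poisson_up_to_const\<close> are the same
  series. Its sum is positive because of the term at 0, so the constant between the sides must be
  1.\<close>

lemma covolume: "(\<Prod>i\<in>UNIV. sqrt (fn i)) = card R"
proof -
  obtain S where S: "((\<lambda>x. exp (- pi * 1 * (norm (x + 0))\<^sup>2)) has_sum S) L"
    "((\<lambda>x. complex_of_real (exp (- pi * (norm x)\<^sup>2 / 1)) * cis (2 * pi * (x \<bullet> 0))) has_sum
      of_real ((\<Prod>i\<in>UNIV. sqrt (1 * fn i)) / card R * S)) L"
    using poisson_up_to_const[OF zero_less_one, of 0] by blast
  have "((\<lambda>x. complex_of_real (exp (- pi * 1 * (norm (x + 0))\<^sup>2))) has_sum of_real S) L"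
    using S(1) by (rule has_sum_of_real)
  then have "complex_of_real S = of_real ((\<Prod>i\<in>UNIV. sqrt (1 * fn i)) / card R * S)"
    using S(2) by (intro has_sum_unique[OF _ S(2)]) simp
  then have e: "S = (\<Prod>i\<in>UNIV. sqrt (fn i)) / card R * S" by (simp only: of_real_eq_iff mult_1)
  have "(\<Sum>x\<in>{0}. exp (- pi * 1 * (norm (x + 0 :: real^'n))\<^sup>2)) \<le> S"
    by (rule has_sum_mono2[OF has_sum_finite S(1)]) (auto simp: zero_mem)
  then have "S > 0" by simp
  moreover have "card R \<noteq> 0" using finite_R red_mem[OF zero_mem] by auto
  ultimately show ?thesis using e by (simp add: field_simps)
qed

theorem poisson_gaussian:
  assumes t: "t > 0"
  shows "\<exists>S. ((\<lambda>x. exp (- pi * t * (norm (x + v))\<^sup>2)) has_sum S) L \<and>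
    ((\<lambda>x. complex_of_real (exp (- pi * (norm x)\<^sup>2 / t)) * cis (2 * pi * (x \<bullet> v))) has_sum
      of_real (sqrt t ^ CARD('n) * S)) L"
proof -
  have "card R \<noteq> 0" using finite_R red_mem[OF zero_mem] by auto
  then have "(\<Prod>i\<in>(UNIV::'n set). sqrt (t * fn i)) / card R = sqrt t ^ CARD('n)"
    by (simp add: real_sqrt_mult prod.distrib covolume)
  then show ?thesis using poisson_up_to_const[OF t, of v] by simp
qed

end

section \<open>Vanishing of weight at most 22 cusp forms with a double zero at infinity\<close>

text \<open>Compares sin (pi/6) = 1/2 with the Taylor polynomial of the sine at 3.14/6. The bound is
  sharp enough to make 4 pi * 0.86 exceed 10.8 below.\<close>

lemma pi_gt_314: "pi > 3.14"
proof (rule ccontr)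
  assume "\<not> ?thesis"
  then have le: "pi / 6 \<le> 3.14 / 6" by simp
  have "\<bar>sin (3.14/6) - (\<Sum>m<7. sin_coeff m * (3.14/6) ^ m)\<bar> \<le> inverse (fact 7) * \<bar>3.14/6::real\<bar> ^ 7"
    by (rule Maclaurin_sin_bound)
  then have "sin (3.14/6 :: real) \<le> (\<Sum>m<7. sin_coeff m * (3.14/6) ^ m) + inverse (fact 7) * \<bar>3.14/6::real\<bar> ^ 7"
    by linarith
  also have "\<dots> < 1/2"
    by (simp add: sin_coeff_def lessThan_nat_numeral fact_numeral power_divide)
  finally have "sin (3.14/6 :: real) < 1/2" .
  moreover have "sin (pi/6) \<le> sin (3.14/6)"
    using le pi_gt_zero pi_ge_two by (intro sin_monotone_2pi_le) auto
  ultimately show False by (simp add: sin_30)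
qed

text \<open>The bound agrees with ln to second order at 1. In weight 22 the first-order bound x - 1
  gives nothing, because there the rates 11 and 10.8 compete.\<close>

lemma ln_le_half_diff_inverse:
  fixes x :: real
  assumes "x \<ge> 1"
  shows "ln x \<le> (x - 1/x) / 2"
proof -
  have "(\<lambda>x. (x - 1/x)/2 - ln x) 1 \<le> (\<lambda>x. (x - 1/x)/2 - ln x) x"
  proof (rule DERIV_nonneg_imp_nondecreasing[OF assms])
    fix y :: real assume y: "1 \<le> y"
    have "((\<lambda>x. (x - 1/x)/2 - ln x) has_real_derivative (1 - 1/y)\<^sup>2 / 2) (at y)"
      using y by (auto intro!: derivative_eq_intros simp: field_simps power2_eq_square)
    then show "\<exists>d. ((\<lambda>x. (x - 1/x)/2 - ln x) has_real_derivative d) (at y) \<and> 0 \<le> d"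
      by (intro exI[of _ "(1 - 1/y)\<^sup>2 / 2"]) simp
  qed
  then show ?thesis by simp
qed

lemma Im_neg_inverse: "Im (-1/z) = Im z / (norm z)\<^sup>2"
  unfolding cmod_power2 Im_divide by (simp only: uminus_complex.sel one_complex.sel) simp

lemma norm_nome: "norm (exp (2 * of_real pi * \<i> * z)) = exp (- 2 * pi * Im z)"
  by simp

lemma nome_less_1: "Im z > 0 \<Longrightarrow> norm (exp (2 * of_real pi * \<i> * z)) < 1"
  by simp

text \<open>The q-expansion of a form of weight 2m; invariance under z -> z + 1 is built into the
  series. The bound on \<open>m\<close> is sharp: the square of the discriminant form has weight 24
  and begins with q^2.\<close>

locale cusp_form_series =
  fixes a :: "nat \<Rightarrow> complex" and m :: nat
  assumes summable: "\<And>z. norm z < 1 \<Longrightarrow> summable (\<lambda>n. a n * z ^ n)"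
    and a0: "a 0 = 0" and a1: "a 1 = 0"
    and m_le: "m \<le> 11"
    and modular: "\<And>z. Im z > 0 \<Longrightarrow>
      (\<Sum>n. a n * exp (2 * of_real pi * \<i> * (-1/z)) ^ n) =
      z ^ (2*m) * (\<Sum>n. a n * exp (2 * of_real pi * \<i> * z) ^ n)"
begin

text \<open>The series divided by q^2, still holomorphic at q = 0 because two coefficients vanish;
  \<open>g\<close> is the same function on the upper half-plane.\<close>

definition B :: "complex \<Rightarrow> complex" where
  "B q = (\<Sum>n. a (n + 2) * q ^ n)"

definition g :: "complex \<Rightarrow> complex" where
  "g z = B (exp (2 * of_real pi * \<i> * z))"

lemma summable_B: "norm q < 1 \<Longrightarrow> summable (\<lambda>n. a (n + 2) * q ^ n)"
  using summable_powser_ignore_initial_segment[of a 2 q] summable[of q] by simp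

lemma sums_B: "norm q < 1 \<Longrightarrow> (\<lambda>n. a (n + 2) * q ^ n) sums B q"
  unfolding B_def using summable_B by (simp add: summable_sums)

lemma B_holomorphic: "B holomorphic_on ball 0 1"
  by (rule power_series_holomorphic[where a = "\<lambda>n. a (n + 2)"]) (use sums_B in auto)

lemma series_eq_g:
  assumes "Im z > 0"
  shows "(\<Sum>n. a n * exp (2 * of_real pi * \<i> * z) ^ n) = exp (2 * of_real pi * \<i> * z) ^ 2 * g z"
proof -
  define q where "q = exp (2 * of_real pi * \<i> * z)"
  have q: "norm q < 1" using nome_less_1[OF assms] by (simp only: q_def)
  have "(\<Sum>n. a n * q ^ n) = (\<Sum>n. a (n+2) * q ^ (n+2)) + (\<Sum>n<2. a n * q ^ n)"
    by (rule suminf_split_initial_segment[OF summable[OF q]])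
  also have "(\<Sum>n<2. a n * q ^ n) = 0"
    using a0 a1 by (simp add: lessThan_nat_numeral)
  also have "(\<lambda>n. a (n+2) * q ^ (n+2)) = (\<lambda>n. q\<^sup>2 * (a (n+2) * q ^ n))"
    by (auto simp: power_add power2_eq_square)
  also have "suminf \<dots> = q\<^sup>2 * B q"
    unfolding B_def by (rule suminf_mult[OF summable_B[OF q]])
  finally show ?thesis by (simp add: g_def q_def)
qed

text \<open>\<open>\<tau>\<close> compares heights: Im (-1/z) is \<open>\<tau>\<close> times Im z.
  The automorphy factor z^(2m) contributes the power of \<open>\<tau>\<close>, and the division by
  q^2 contributes the exponential competing with it.\<close>

lemma g_transform:
  assumes y: "Im z > 0"
  defines "\<tau> \<equiv> 1 / (norm z)\<^sup>2"
  shows "norm (g z) = exp (m * ln \<tau> - 4 * pi * Im z * (\<tau> - 1)) * norm (g (-1/z))"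
proof -
  have z: "norm z > 0" using y by auto
  have y': "Im (-1/z) > 0" using y z unfolding Im_neg_inverse by simp
  have t: "Im (-1/z) = \<tau> * Im z" unfolding Im_neg_inverse by (simp add: \<tau>_def)
  have sq: "norm (exp (2 * of_real pi * \<i> * w) ^ 2) = exp (- 4 * pi * Im w)" for w
    by (simp add: norm_power norm_nome exp_of_nat_mult[symmetric])
  have "exp (2 * of_real pi * \<i> * (-1/z)) ^ 2 * g (-1/z) = z ^ (2*m) * (exp (2 * of_real pi * \<i> * z) ^ 2 * g z)"
    using modular[OF y] unfolding series_eq_g[OF y] series_eq_g[OF y'] .
  from arg_cong[OF this, of norm]
  have 1: "exp (- 4 * pi * (\<tau> * Im z)) * norm (g (-1/z)) = norm z ^ (2*m) * (exp (- 4 * pi * Im z) * norm (g z))"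
    by (simp only: norm_mult sq norm_power[of z] t)
  have tau: "\<tau> > 0" using z by (simp add: \<tau>_def)
  have "\<tau> ^ m * norm z ^ (2*m) = 1"
    using z by (simp add: \<tau>_def power_mult power_divide)
  then have "exp (m * ln \<tau>) * norm z ^ (2*m) = 1"
    using tau by (simp add: exp_of_nat_mult)
  then have "norm (g z) = exp (m * ln \<tau>) * exp (4 * pi * Im z) *
      (norm z ^ (2*m) * (exp (- 4 * pi * Im z) * norm (g z)))"
    by (simp add: exp_minus field_simps)
  also have "\<dots> = exp (m * ln \<tau>) * exp (4 * pi * Im z) * (exp (- 4 * pi * (\<tau> * Im z)) * norm (g (-1/z)))"
    by (simp only: 1)
  also have "\<dots> = exp (m * ln \<tau> + 4 * pi * Im z + - 4 * pi * (\<tau> * Im z)) * norm (g (-1/z))"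
    by (simp only: exp_add mult.assoc)
  finally show ?thesis by (simp add: algebra_simps)
qed

lemma g_holomorphic: "g holomorphic_on {z. Im z > 0}"
proof -
  have "(B \<circ> (\<lambda>z. exp (2 * of_real pi * \<i> * z))) holomorphic_on {z. Im z > 0}"
  proof (rule holomorphic_on_compose_gen[OF _ B_holomorphic])
    show "(\<lambda>z. exp (2 * of_real pi * \<i> * z)) ` {z. 0 < Im z} \<subseteq> ball 0 1"
      using nome_less_1 by auto
  qed (intro holomorphic_intros)
  then show ?thesis by (simp add: g_def[abs_def] o_def)
qed

lemma g_periodic: "g (z + 1) = g z" "g (z - 1) = g z"
proof -
  have "exp (2 * of_real pi * \<i> * (z + 1)) = exp (2 * of_real pi * \<i> * z)" for z
    by (simp add: algebra_simps exp_add)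
  then show 1: "g (z + 1) = g z" for z by (simp add: g_def)
  show "g (z - 1) = g z" using 1[of "z - 1"] by simp
qed

text \<open>The primitive sixth root of unity r satisfies -1/r = r - 1, so inversion leads back to r
  up to a translation. Hence the form at r equals r^22 = -r times itself, and -r is not 1.\<close>

lemma g_corner:
  assumes "m = 11" "\<rho> = Complex (1/2) (sqrt 3 / 2) \<or> \<rho> = Complex (-1/2) (sqrt 3 / 2)"
  shows "g \<rho> = 0"
proof -
  define r where "r = Complex (1/2) (sqrt 3 / 2)"
  have r2: "r\<^sup>2 = r - 1"
    by (simp add: r_def complex_eq_iff power2_eq_square)
  have r0: "r \<noteq> 0" by (auto simp: r_def complex_eq_iff)
  have inv: "-1/r = r - 1"
    using r2 r0 by (simp add: field_simps power2_eq_square)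
  have "r ^ 3 = r * r\<^sup>2" by (simp add: power3_eq_cube power2_eq_square)
  also have "\<dots> = r\<^sup>2 - r" by (simp add: r2 algebra_simps power2_eq_square[symmetric])
  finally have r3: "r ^ 3 = -1" using r2 by simp
  have "r ^ 22 = (r ^ 3) ^ 7 * r" by (simp flip: power_mult power_Suc2)
  then have r22: "r ^ 22 = - r" by (simp add: r3)
  have Im: "Im r > 0" by (simp add: r_def)
  have e: "exp (2 * of_real pi * \<i> * (r - 1)) = exp (2 * of_real pi * \<i> * r)"
    by (simp add: algebra_simps exp_diff)
  have "exp (2 * of_real pi * \<i> * (-1/r)) = exp (2 * of_real pi * \<i> * r)"
    unfolding inv by (rule e)
  then have "(\<Sum>n. a n * exp (2 * of_real pi * \<i> * r) ^ n) = z0 * (\<Sum>n. a n * exp (2 * of_real pi * \<i> * r) ^ n)"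
    if "z0 = r ^ (2*m)" for z0 using modular[OF Im] that by (simp only:)
  from this[of "- r"] have "(\<Sum>n. a n * exp (2 * of_real pi * \<i> * r) ^ n) = - (r * (\<Sum>n. a n * exp (2 * of_real pi * \<i> * r) ^ n))"
    using \<open>m = 11\<close> r22 by simp
  then have "(1 + r) * (\<Sum>n. a n * exp (2 * of_real pi * \<i> * r) ^ n) = 0"
    unfolding eq_neg_iff_add_eq_0 by (simp add: distrib_right)
  moreover have "1 + r \<noteq> 0" by (auto simp: r_def complex_eq_iff)
  ultimately have "(\<Sum>n. a n * exp (2 * of_real pi * \<i> * r) ^ n) = 0" by simp
  then have g: "g r = 0" by (simp add: series_eq_g[OF Im])
  moreover have "Complex (-1/2) (sqrt 3 / 2) = r - 1" by (simp add: r_def complex_eq_iff)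
  ultimately show ?thesis using assms(2) g_periodic(2)[of r] by (auto simp: r_def)
qed

lemma ex_nome:
  assumes "norm q = exp (- 2 * pi * y)"
  obtains x where "\<bar>x\<bar> \<le> 1/2" "exp (2 * of_real pi * \<i> * Complex x y) = q"
proof
  have q: "q \<noteq> 0" using assms by auto
  define x where "x = Im (Ln q) / (2 * pi)"
  show "\<bar>x\<bar> \<le> 1/2"
    using Im_Ln_le_pi[OF q] mpi_less_Im_Ln[OF q] by (auto simp: x_def abs_le_iff field_simps)
  have "2 * of_real pi * \<i> * Complex x y = Ln q"
    using q assms by (simp add: complex_eq_iff x_def)
  then show "exp (2 * of_real pi * \<i> * Complex x y) = q" using q by simp
qed

lemma reduce_strip: obtains z' where "\<bar>Re z'\<bar> \<le> 1/2" "Im z' = Im z" "g z' = g z"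
proof -
  have "norm (exp (2 * of_real pi * \<i> * z)) = exp (- 2 * pi * Im z)" by (rule norm_nome)
  from ex_nome[OF this] obtain x where "\<bar>x\<bar> \<le> 1/2"
    "exp (2 * of_real pi * \<i> * Complex x (Im z)) = exp (2 * of_real pi * \<i> * z)" .
  then show ?thesis by (intro that[of "Complex x (Im z)"]) (auto simp: g_def)
qed

text \<open>After translation into the strip, one inversion lifts a point just below height 0.86
  above it, at the cost of a factor at most e <= 3. The height 0.766 is a lower bound for sqrt 3 / 2
  - 1/10, so the disc of radius 1/10 around a corner is covered.\<close>

lemma g_bound_below:
  assumes G: "\<And>z. Im z \<ge> 0.86 \<Longrightarrow> norm (g z) \<le> G"
    and y: "Im z \<ge> 0.766" and "G \<ge> 0"
  shows "norm (g z) \<le> 3 * G"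
proof (cases "Im z \<ge> 0.86")
  case True
  then show ?thesis using G[of z] \<open>G \<ge> 0\<close> by linarith
next
  case False
  obtain z' where z': "\<bar>Re z'\<bar> \<le> 1/2" "Im z' = Im z" "g z' = g z" by (rule reduce_strip)
  define \<tau> where "\<tau> = 1 / (norm z')\<^sup>2"
  have n: "(norm z')\<^sup>2 = (Re z')\<^sup>2 + (Im z)\<^sup>2" using z' by (simp add: cmod_power2)
  have R: "(Re z')\<^sup>2 \<le> 1/4" using z'(1) abs_le_square_iff[of "Re z'" "1/2"] by (simp add: power_divide)
  have I: "(Im z)\<^sup>2 \<ge> 0.766\<^sup>2" using y by (intro power_mono) auto
  \<comment> \<open>A convex function lies below its chord; on [0.766, 0.86] this bounds the square
    linearly.\<close>
  have "(Im z - 0.766) * (Im z - 0.86) \<le> 0" using y False by (intro mult_nonneg_nonpos) auto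
  then have I': "(Im z)\<^sup>2 \<le> 1.626 * Im z - 0.658" by (simp add: field_simps power2_eq_square)
  have "(Im z)\<^sup>2 \<le> 0.86\<^sup>2" using y False by (intro power_mono) auto
  then have n1: "(norm z')\<^sup>2 \<le> 1" using R n by (simp add: power2_eq_square)
  have n0: "(norm z')\<^sup>2 \<ge> 586/1000"
  proof -
    have "586/1000 \<le> (0.766::real)\<^sup>2" by (simp add: power2_eq_square)
    then show ?thesis using I n zero_le_power2[of "Re z'"] by linarith
  qed
  have npos: "(norm z')\<^sup>2 > 0" using n0 by linarith
  have "0.86 * (norm z')\<^sup>2 \<le> 0.86 * (1/4 + (1.626 * Im z - 0.658))" using R I' n by simp
  also have "\<dots> \<le> Im z" using False by simp
  finally have "Im (-1/z') \<ge> 0.86" using npos z' unfolding Im_neg_inverse by (simp add: pos_le_divide_eq)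
  then have g': "norm (g (-1/z')) \<le> G" by (rule G)
  have t1: "\<tau> \<ge> 1" using n1 npos unfolding \<tau>_def by (simp only: pos_le_divide_eq)
  have t2: "\<tau> \<le> 1707/1000" using n0 npos unfolding \<tau>_def by (simp only: pos_divide_le_eq)
  have "ln \<tau> \<le> \<tau> - 1" using t1 by (intro ln_le_minus_one) auto
  then have "m * ln \<tau> \<le> 11 * (\<tau> - 1)" using m_le t1 by (intro mult_mono) auto
  moreover have "(3.14 * 0.766) * (\<tau> - 1) \<le> (pi * Im z) * (\<tau> - 1)"
    using pi_gt_314 y t1 by (intro mult_right_mono mult_mono) auto
  ultimately have "m * ln \<tau> - 4 * pi * Im z * (\<tau> - 1) \<le> (11 - 4 * (3.14 * 0.766)) * (\<tau> - 1)"
    unfolding left_diff_distrib by linarith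
  also have "\<dots> \<le> 1.38 * 0.707" using t1 t2 by (intro mult_mono) auto
  also have "\<dots> \<le> 1" by simp
  finally have "exp (m * ln \<tau> - 4 * pi * Im z * (\<tau> - 1)) \<le> exp 1" by simp
  also have "exp 1 \<le> (3::real)" by (rule exp_le)
  finally have e: "exp (m * ln \<tau> - 4 * pi * Im z * (\<tau> - 1)) \<le> 3" .
  have "norm (g z') = exp (m * ln \<tau> - 4 * pi * Im z * (\<tau> - 1)) * norm (g (-1/z'))"
    using g_transform[of z'] z' y by (simp add: \<tau>_def)
  also have "\<dots> \<le> 3 * G" using e g' by (intro mult_mono) auto
  finally show ?thesis using z' by simp
qed

text \<open>For m <= 10 the rate m of the logarithm is below 4 pi * 0.86 > 10.8, so the inequality
  fails. For m = 11 the second-order bound on ln leaves room only if 1/\<open>\<tau>\<close>, the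
  squared modulus of the point x + 0.86 i, is close to 1, which pushes x towards 1/2 or
  -1/2.\<close>

lemma nearly_on_unit_circle:
  assumes x: "\<bar>x\<bar> \<le> 1/2"
  defines "\<tau> \<equiv> 1 / (x\<^sup>2 + 0.86\<^sup>2)"
  assumes le: "4 * pi * 0.86 * (\<tau> - 1) \<le> m * ln \<tau>"
  shows "m = 11" "x\<^sup>2 \<ge> 0.224"
proof -
  have x2: "x\<^sup>2 \<le> 1/4" using x abs_le_square_iff[of x "1/2"] by (simp add: power_divide)
  have pos: "x\<^sup>2 + 0.86\<^sup>2 > 0" by (intro add_nonneg_pos) auto
  have t1: "\<tau> > 1" using x2 pos unfolding \<tau>_def by (simp add: power2_eq_square)
  have pi: "4 * pi * 0.86 * (\<tau> - 1) \<ge> 10.8 * (\<tau> - 1)"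
    using pi_gt_314 t1 by (intro mult_right_mono) auto
  have lnle: "ln \<tau> \<le> \<tau> - 1" "ln \<tau> \<ge> 0" using t1 by (auto intro: ln_le_minus_one)
  show "m = 11"
  proof (rule ccontr)
    assume "m \<noteq> 11"
    then have "m \<le> 10" using m_le by linarith
    then have "m * ln \<tau> \<le> 10 * (\<tau> - 1)" using lnle by (intro mult_mono) auto
    from order_trans[OF pi order_trans[OF le this]] show False using t1 by simp
  qed
  then have "10.8 * (\<tau> - 1) \<le> 11 * ln \<tau>" using le pi by simp
  also have "\<dots> \<le> 11 * ((\<tau> - 1/\<tau>) / 2)" using ln_le_half_diff_inverse[of \<tau>] t1 by simp
  also have "(\<tau> - 1/\<tau>) = (\<tau> - 1) * (1 + 1/\<tau>)" using t1 by (simp add: field_simps)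
  finally have "(\<tau> - 1) * 10.8 \<le> (\<tau> - 1) * (11 * (1 + 1/\<tau>) / 2)" by (simp add: algebra_simps)
  then have "10.8 \<le> 11 * (1 + 1/\<tau>) / 2" using t1 by (simp only: mult_le_cancel_left_pos)
  moreover have "1/\<tau> = x\<^sup>2 + 0.86\<^sup>2" by (simp add: \<tau>_def)
  ultimately show "x\<^sup>2 \<ge> 0.224" by (simp add: power2_eq_square)
qed

text \<open>The maximum \<open>G\<close> of the modulus of \<open>B\<close> on the disc is attained
  at the nome of a point \<open>z1\<close> of height 0.86. This height is just below sqrt 3 / 2, so
  in the strip such points lie inside the unit circle and inversion raises them. If \<open>G\<close>
  were positive, the transformation factor at \<open>z1\<close> would be at least 1, which puts
  \<open>z1\<close> near a corner, where \<open>g\<close> vanishes; by the Schwarz lemma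
  \<open>g\<close> is then smaller than \<open>G\<close> at \<open>z1\<close>.\<close>

lemma B_eq_0_on_disc: "\<exists>R>0. \<forall>q. norm q \<le> R \<longrightarrow> B q = 0"
proof -
  define R where "R = exp (- 2 * pi * 0.86)"
  have R: "R > 0" "R < 1" by (auto simp: R_def)
  have cont: "continuous_on (ball 0 1) B" using B_holomorphic by (rule holomorphic_on_imp_continuous_on)
  have "continuous_on (sphere 0 R) (\<lambda>q. norm (B q))"
    using R by (intro continuous_on_norm continuous_on_subset[OF cont]) auto
  then obtain q1 where q1: "q1 \<in> sphere 0 R" "\<And>q. q \<in> sphere 0 R \<Longrightarrow> norm (B q) \<le> norm (B q1)"
    using continuous_attains_sup[of "sphere (0::complex) R" "\<lambda>q. norm (B q)"] R by auto
  define G where "G = norm (B q1)"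
  have max: "norm (B q) \<le> G" if "norm q \<le> R" for q
  proof (rule maximum_modulus_frontier[of B "cball 0 R"])
    show "B holomorphic_on interior (cball 0 R)"
      using R by (intro holomorphic_on_subset[OF B_holomorphic]) auto
    show "continuous_on (closure (cball 0 R)) B"
      using R by (intro continuous_on_subset[OF cont]) auto
    show "q \<in> cball 0 R" using that by simp
  qed (use q1 in \<open>auto simp: G_def\<close>)
  have G: "norm (g z) \<le> G" if "Im z \<ge> 0.86" for z
    unfolding g_def using that by (intro max) (simp add: R_def)
  have "norm q1 = exp (- 2 * pi * 0.86)" using q1(1) by (simp add: R_def)
  from ex_nome[OF this] obtain x where x: "\<bar>x\<bar> \<le> 1/2" "exp (2 * of_real pi * \<i> * Complex x 0.86) = q1" .
  define z1 where "z1 = Complex x 0.86"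
  have gz1: "norm (g z1) = G" using x by (simp add: g_def G_def z1_def)
  define \<tau> where "\<tau> = 1 / (norm z1)\<^sup>2"
  have nz1: "(norm z1)\<^sup>2 = x\<^sup>2 + 0.86\<^sup>2" unfolding cmod_power2 z1_def by simp
  have x2: "x\<^sup>2 \<le> 1/4" using x abs_le_square_iff[of x "1/2"] by (simp add: power_divide)
  have pos: "(norm z1)\<^sup>2 > 0" unfolding nz1 by (intro add_nonneg_pos) auto
  have le1: "(norm z1)\<^sup>2 \<le> 1" unfolding nz1 using x2 by (simp add: power2_eq_square)
  have "Im (-1/z1) \<ge> 0.86"
    unfolding Im_neg_inverse using pos le1 by (simp add: pos_le_divide_eq z1_def)
  then have g2: "norm (g (-1/z1)) \<le> G" by (rule G)
  have "G = 0"
  proof (rule ccontr)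
    assume "G \<noteq> 0"
    then have Gpos: "G > 0" by (simp add: G_def)
    define E where "E = m * ln \<tau> - 4 * pi * 0.86 * (\<tau> - 1)"
    have "G = exp E * norm (g (-1/z1))"
      using g_transform[of z1] gz1 unfolding E_def \<tau>_def by (simp add: z1_def)
    also have "\<dots> \<le> exp E * G" using g2 by (intro mult_left_mono) auto
    finally have "1 * G \<le> exp E * G" by simp
    then have "1 \<le> exp E" using Gpos by (simp only: mult_le_cancel_right_pos)
    then have "4 * pi * 0.86 * (\<tau> - 1) \<le> m * ln \<tau>" by (simp add: E_def)
    from nearly_on_unit_circle[OF x(1)] this
    have m: "m = 11" and xge: "x\<^sup>2 \<ge> 0.224" by (auto simp: \<tau>_def nz1)
    have absx: "\<bar>x\<bar> \<ge> 0.473" using xge abs_le_square_iff[of "0.473" x] by (simp add: power2_eq_square)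
    define \<rho> where "\<rho> = Complex (if x > 0 then 1/2 else -1/2) (sqrt 3 / 2)"
    have g\<rho>: "g \<rho> = 0" by (rule g_corner[OF m]) (simp add: \<rho>_def)
    have s3: "sqrt 3 \<ge> 1.732" "sqrt 3 \<le> 1.7321"
      by (rule real_le_rsqrt, simp add: power2_eq_square) (rule real_le_lsqrt, simp_all add: power2_eq_square)
    have "norm (z1 - \<rho>) \<le> \<bar>Re (z1 - \<rho>)\<bar> + \<bar>Im (z1 - \<rho>)\<bar>" by (rule cmod_le)
    also have "\<bar>Re (z1 - \<rho>)\<bar> \<le> 0.027" using x absx by (auto simp: z1_def \<rho>_def)
    also have "\<bar>Im (z1 - \<rho>)\<bar> \<le> 0.00605" using s3 by (simp add: z1_def \<rho>_def)
    finally have d: "norm (z1 - \<rho>) \<le> 0.03305" by simp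
    \<comment> \<open>The disc of radius 1/10 around the corner, rescaled. There the modulus of
      \<open>g\<close> is at most 3 G < 3.01 G, and \<open>z1\<close> is within 0.03305 of the
      centre; since 0.3305 * 3.01 < 1, this contradicts the modulus \<open>G\<close> at
      \<open>z1\<close>.\<close>
    define F where "F w = g (\<rho> + of_real (1/10) * w) / of_real (3.01 * G)" for w
    define w1 where "w1 = 10 * (z1 - \<rho>)"
    have Im: "Im (\<rho> + of_real (1/10) * w) \<ge> 0.766" if "norm w < 1" for w
      using abs_Im_le_cmod[of w] that s3 by (simp add: \<rho>_def)
    have Fhol: "F holomorphic_on ball 0 1"
    proof -
      have "(g \<circ> (\<lambda>w. \<rho> + of_real (1/10) * w)) holomorphic_on ball 0 1"
      proof (rule holomorphic_on_compose_gen[OF _ g_holomorphic])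
        show "(\<lambda>w. \<rho> + complex_of_real (1/10) * w) ` ball 0 1 \<subseteq> {z. Im z > 0}"
          using Im by (force simp del: of_real_divide)
      qed (intro holomorphic_intros)
      then show ?thesis using Gpos unfolding F_def o_def by (intro holomorphic_intros) auto
    qed
    have Flt: "norm (F w) < 1" if "norm w < 1" for w
    proof -
      have "norm (g (\<rho> + of_real (1/10) * w)) \<le> 3 * G"
        using g_bound_below[of G, OF G Im[OF that]] Gpos by simp
      also have "\<dots> < 3.01 * G" using Gpos by simp
      finally show ?thesis unfolding F_def norm_divide using Gpos by simp
    qed
    have w1: "norm w1 \<le> 0.3305" using d unfolding w1_def norm_mult by simp
    then have "norm (F w1) \<le> norm w1"
      by (intro Schwarz_Lemma(1)[OF Fhol _ Flt]) (auto simp: F_def g\<rho>)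
    also have "F w1 = g z1 / of_real (3.01 * G)"
    proof -
      have "\<rho> + of_real (1/10) * w1 = z1" by (simp add: w1_def field_simps)
      then show ?thesis unfolding F_def by (simp only:)
    qed
    also have "norm \<dots> = 1 / 3.01" unfolding norm_divide norm_of_real gz1 using Gpos by simp
    finally show False using w1 by simp
  qed
  then have "B q = 0" if "norm q \<le> R" for q using max[OF that] by simp
  then show ?thesis using R by blast
qed

theorem coeff_eq_0: "a n = 0"
proof -
  from B_eq_0_on_disc obtain R where R: "R > 0" "\<And>q. norm q \<le> R \<Longrightarrow> B q = 0" by blast
  have *: "a (k + 2) = 0" for k
  proof (induction k rule: less_induct)
    case (less k)
    have "(\<lambda>n. a (n + k + 2) * q ^ n) sums 0" if q: "q \<noteq> 0" "norm q < min R 1" for q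
    proof -
      have "(\<lambda>n. a (n + 2) * q ^ n) sums 0" using sums_B[of q] R q by simp
      then have "(\<lambda>n. a (n + k + 2) * q ^ (n + k)) sums (0 - (\<Sum>n<k. a (n+2) * q ^ n))"
        by (subst sums_iff_shift) simp
      also have "(\<Sum>n<k. a (n+2) * q ^ n) = 0" using less by simp
      finally have "(\<lambda>n. inverse (q ^ k) * (a (n + k + 2) * q ^ (n + k))) sums 0"
        using sums_mult by fastforce
      also have "(\<lambda>n. inverse (q ^ k) * (a (n + k + 2) * q ^ (n + k))) = (\<lambda>n. a (n + k + 2) * q ^ n)"
        using q by (auto simp: power_add field_simps)
      finally show ?thesis .
    qed
    then have "((\<lambda>_. 0) \<longlongrightarrow> a (0 + k + 2)) (at (0::complex))"
      using R by (intro powser_limit_0_strong[of "min R 1" "\<lambda>n. a (n + k + 2)"]) auto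
    then show ?case by (simp add: tendsto_const_iff)
  qed
  show ?thesis
  proof (cases "n < 2")
    case True
    then show ?thesis using a0 a1 by (auto simp: less_2_cases_iff)
  next
    case False
    then have "n - 2 + 2 = n" by simp
    then show ?thesis using *[of "n - 2"] by (simp only:)
  qed
qed

end

section \<open>Theta series of differences of powers of linear forms\<close>

text \<open>\<open>w\<close> will be a Gaussian weight and \<open>y\<close> the inner product with a
  fixed direction. The exponential moments dominate the double series, so the sums over x and over
  the power j may be exchanged; the result is a generating function of the moments.\<close>

lemma exp_moment_series:
  fixes w y :: "'a \<Rightarrow> real" and \<kappa> :: complex
  assumes w: "\<And>x. x \<in> A \<Longrightarrow> w x \<ge> 0"
    and summ: "\<And>c. (\<lambda>x. w x * exp (c * \<bar>y x\<bar>)) summable_on A"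
  shows "((\<lambda>j. \<kappa> ^ j / fact j * of_real (\<Sum>\<^sub>\<infinity>x\<in>A. w x * y x ^ j)) has_sum
      (\<Sum>\<^sub>\<infinity>x\<in>A. of_real (w x) * exp (\<kappa> * of_real (y x)))) UNIV" (is ?A)
    and "(\<lambda>x. of_real (w x) * exp (\<kappa> * of_real (y x))) summable_on A" (is ?B)
    and "(\<lambda>x. w x * y x ^ j) summable_on A" (is ?C)
proof -
  have C: "(\<lambda>x. w x * y x ^ j) summable_on A" for j
  proof (rule abs_summable_summable, rule Infinite_Sum.abs_summable_on_comparison_test'[where g = "\<lambda>x. fact j * (w x * exp (1 * \<bar>y x\<bar>))"])
    show "(\<lambda>x. fact j * (w x * exp (1 * \<bar>y x\<bar>))) summable_on A"
      by (rule summable_on_cmult_right[OF summ])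
    fix x assume x: "x \<in> A"
    have "\<bar>y x\<bar> ^ j / fact j \<le> exp \<bar>y x\<bar>"
      using sum_le_suminf[OF summable_exp_generic[of "\<bar>y x\<bar>"], of "{j}"]
      by (auto simp: exp_def divide_inverse mult.commute)
    then have "\<bar>y x\<bar> ^ j \<le> fact j * exp \<bar>y x\<bar>" by (simp add: field_simps)
    from mult_left_mono[OF this w[OF x]]
    show "norm (w x * y x ^ j) \<le> fact j * (w x * exp (1 * \<bar>y x\<bar>))"
      using w[OF x] by (simp add: abs_mult power_abs algebra_simps)
  qed
  show ?C by (rule C)
  define f where "f = (\<lambda>(x, j). complex_of_real (w x) * ((\<kappa> * of_real (y x)) ^ j / fact j))"
  have row: "((\<lambda>j. f (x, j)) has_sum of_real (w x) * exp (\<kappa> * of_real (y x))) UNIV" for x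
  proof -
    have "(\<lambda>j. (\<kappa> * of_real (y x)) ^ j / fact j) sums exp (\<kappa> * of_real (y x))"
      using exp_converges[of "\<kappa> * of_real (y x)"] by (simp add: scaleR_conv_of_real divide_inverse mult.commute)
    moreover have "summable (\<lambda>j. norm ((\<kappa> * of_real (y x)) ^ j / fact j))"
      using summable_norm_exp[of "\<kappa> * of_real (y x)"] by (simp add: norm_divide divide_inverse norm_mult norm_inverse mult.commute)
    ultimately have "((\<lambda>j. (\<kappa> * of_real (y x)) ^ j / fact j) has_sum exp (\<kappa> * of_real (y x))) UNIV"
      by (rule norm_summable_imp_has_sum[rotated])
    from has_sum_cmult_right[OF this, of "complex_of_real (w x)"] show ?thesis
      unfolding f_def by simp
  qed
  have nrow: "((\<lambda>j. norm (f (x, j))) has_sum w x * exp (norm \<kappa> * \<bar>y x\<bar>)) UNIV" if x: "x \<in> A" for x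
  proof -
    have "(\<lambda>j. (norm \<kappa> * \<bar>y x\<bar>) ^ j / fact j) sums exp (norm \<kappa> * \<bar>y x\<bar>)"
      using exp_converges[of "norm \<kappa> * \<bar>y x\<bar>"] by (simp add: divide_inverse mult.commute)
    then have "((\<lambda>j. (norm \<kappa> * \<bar>y x\<bar>) ^ j / fact j) has_sum exp (norm \<kappa> * \<bar>y x\<bar>)) UNIV"
      by (intro norm_summable_imp_has_sum) (auto simp: sums_iff)
    from has_sum_cmult_right[OF this, of "w x"] show ?thesis
      unfolding f_def using w[OF x] by (simp add: norm_mult norm_divide norm_power)
  qed
  have ns: "(\<lambda>p. norm (f p)) summable_on A \<times> UNIV"
    by (rule summable_on_SigmaI[OF nrow summ]) auto
  then have s: "f summable_on A \<times> UNIV" by (rule abs_summable_summable)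
  then have tot: "(f has_sum infsum f (A \<times> UNIV)) (A \<times> UNIV)" by (rule has_sum_infsum)
  have r: "((\<lambda>x. of_real (w x) * exp (\<kappa> * of_real (y x))) has_sum infsum f (A \<times> UNIV)) A"
    by (rule has_sum_Sigma'[OF tot row])
  then show ?B by (auto simp: summable_on_def)
  have eq: "infsum f (A \<times> UNIV) = (\<Sum>\<^sub>\<infinity>x\<in>A. of_real (w x) * exp (\<kappa> * of_real (y x)))"
    using r by (simp add: infsumI)
  have tot': "((\<lambda>(j, x). f (x, j)) has_sum infsum f (A \<times> UNIV)) (UNIV \<times> A)"
    using tot by (subst (asm) has_sum_swap)
  have col: "((\<lambda>x. (\<lambda>(j, x). f (x, j)) (j, x)) has_sum \<kappa> ^ j / fact j * of_real (\<Sum>\<^sub>\<infinity>x\<in>A. w x * y x ^ j)) A" for j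
  proof -
    have "((\<lambda>x. complex_of_real (w x * y x ^ j)) has_sum of_real (\<Sum>\<^sub>\<infinity>x\<in>A. w x * y x ^ j)) A"
      by (intro has_sum_of_real has_sum_infsum C)
    from has_sum_cmult_right[OF this, of "\<kappa> ^ j / fact j"] show ?thesis
      by (simp add: f_def power_mult_distrib algebra_simps)
  qed
  show ?A unfolding eq[symmetric] by (rule has_sum_Sigma'[OF tot' col])
qed

text \<open>Divide by s^j and let the real s tend to 0. The factor \<open>g\<close> enters only
  through its limit, so it is not expanded.\<close>

lemma powser_leading_coeff:
  fixes a b :: "nat \<Rightarrow> complex"
  assumes a: "\<And>z. (\<lambda>n. a n * z ^ n) sums A z" and b: "\<And>z. (\<lambda>n. b n * z ^ n) sums B z"
    and eq: "\<And>s::real. A (of_real s) = g s * B (of_real s)" and g: "(g \<longlongrightarrow> g0) (at 0)"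
    and low: "\<And>i. i < j \<Longrightarrow> a i = 0" "\<And>i. i < j \<Longrightarrow> b i = 0"
  shows "a j = g0 * b j"
proof -
  have lim: "((\<lambda>s::real. C (of_real s) / of_real s ^ j) \<longlongrightarrow> c j) (at 0)"
    if c: "\<And>z. (\<lambda>n. c n * z ^ n) sums C z" and low: "\<And>i. i < j \<Longrightarrow> c i = 0" for c :: "nat \<Rightarrow> complex" and C
  proof -
    have "(\<lambda>n. c (n + j) * z ^ n) sums (C z / z ^ j)" if z: "z \<noteq> 0" for z
    proof -
      have "(\<Sum>n<j. c n * z ^ n) = 0" using low by simp
      then have "(\<lambda>n. c (n + j) * z ^ (n + j)) sums C z"
        using c[of z] sums_iff_shift[of "\<lambda>n. c n * z ^ n" j "C z"] by simp
      from sums_divide[OF this, of "z ^ j"]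
      have "(\<lambda>n. c (n + j) * z ^ (n + j) / z ^ j) sums (C z / z ^ j)" .
      then show ?thesis using z by (simp add: power_add)
    qed
    then have "((\<lambda>z. C z / z ^ j) \<longlongrightarrow> c (0 + j)) (at 0)"
      by (intro powser_limit_0_strong[of 1 "\<lambda>n. c (n + j)"]) auto
    moreover have "filterlim (of_real :: real \<Rightarrow> complex) (at 0) (at 0)"
      by (auto simp: filterlim_at eventually_at_filter intro!: tendsto_eq_intros)
    ultimately show ?thesis using filterlim_compose[of "\<lambda>z. C z / z ^ j" "nhds (c (0 + j))" "at 0" of_real "at 0"] by (simp only: add_0)
  qed
  have 1: "((\<lambda>s. g s * (B (of_real s) / of_real s ^ j)) \<longlongrightarrow> g0 * b j) (at 0)"
    by (intro tendsto_mult g lim b low)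
  have "((\<lambda>s. A (of_real s) / of_real s ^ j) \<longlongrightarrow> a j) (at (0::real))"
    by (intro lim a low)
  then have "((\<lambda>s. g s * (B (of_real s) / of_real s ^ j)) \<longlongrightarrow> a j) (at 0)"
    by (simp add: eq)
  then show ?thesis by (rule tendsto_unique[OF trivial_limit_at]) (rule 1)
qed

locale rootless_leech = selfdual_lattice L for L :: "(real^24) set" +
  assumes even_norm: "x \<in> L \<Longrightarrow> \<exists>k::int. (norm x)\<^sup>2 = 2 * of_int k"
    and no_roots: "x \<in> L \<Longrightarrow> (norm x)\<^sup>2 \<noteq> 2"
begin

lemma summable_gaussian: "t > 0 \<Longrightarrow> (\<lambda>x. exp (- pi * t * (norm x)\<^sup>2)) summable_on L"
  using poisson_gaussian[of t 0] by (auto simp: summable_on_def)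

lemma summable_gaussian_exp:
  assumes t: "t > 0"
  shows "(\<lambda>x. exp (- pi * t * (norm x)\<^sup>2) * exp (c * \<bar>x \<bullet> u\<bar>)) summable_on L"
proof (rule abs_summable_summable, rule Infinite_Sum.abs_summable_on_comparison_test')
  define b where "b = \<bar>c\<bar> * norm u"
  define K where "K = exp (b\<^sup>2 / (2 * pi * t))"
  show "(\<lambda>x. K * exp (- pi * (t/2) * (norm x)\<^sup>2)) summable_on L"
    using t by (intro summable_on_cmult_right summable_gaussian) simp
  fix x assume "x \<in> L"
  have "c * \<bar>x \<bullet> u\<bar> \<le> \<bar>c\<bar> * (norm x * norm u)"
    using Cauchy_Schwarz_ineq2[of x u] by (intro mult_mono) auto
  also have "\<dots> = b * norm x" by (simp add: b_def)
  also have "\<dots> \<le> b\<^sup>2 / (2 * pi * t) + pi * (t/2) * (norm x)\<^sup>2"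
  proof -
    have "0 \<le> (b - pi * t * norm x)\<^sup>2 / (2 * pi * t)" using t by simp
    also have "\<dots> = b\<^sup>2 / (2 * pi * t) + pi * (t/2) * (norm x)\<^sup>2 - b * norm x"
      using t by (simp add: power2_diff power_mult_distrib field_simps power2_eq_square)
    finally show ?thesis by simp
  qed
  finally have "- pi * t * (norm x)\<^sup>2 + c * \<bar>x \<bullet> u\<bar> \<le> b\<^sup>2 / (2 * pi * t) + - pi * (t/2) * (norm x)\<^sup>2"
    by (simp add: field_simps)
  then have "exp (- pi * t * (norm x)\<^sup>2 + c * \<bar>x \<bullet> u\<bar>) \<le> exp (b\<^sup>2 / (2 * pi * t) + - pi * (t/2) * (norm x)\<^sup>2)"
    by simp
  then show "norm (exp (- pi * t * (norm x)\<^sup>2) * exp (c * \<bar>x \<bullet> u\<bar>)) \<le> K * exp (- pi * (t/2) * (norm x)\<^sup>2)"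
    unfolding exp_add K_def by simp
qed

text \<open>The theta series weighted by the j-th power of \<open>x \<bullet> u\<close>, at the
  point z = i t of the imaginary axis. \<open>\<Phi>\<close> is its exponential generating function
  in j.\<close>

definition M :: "real^24 \<Rightarrow> nat \<Rightarrow> real \<Rightarrow> real" where
  "M u j t = (\<Sum>\<^sub>\<infinity>x\<in>L. exp (- pi * t * (norm x)\<^sup>2) * (x \<bullet> u) ^ j)"

definition \<Phi> :: "real^24 \<Rightarrow> real \<Rightarrow> complex \<Rightarrow> complex" where
  "\<Phi> u t \<kappa> = (\<Sum>\<^sub>\<infinity>x\<in>L. of_real (exp (- pi * t * (norm x)\<^sup>2)) * exp (\<kappa> * of_real (x \<bullet> u)))"

lemma \<Phi>_series:
  assumes t: "t > 0"
  shows "(\<lambda>j. \<kappa> ^ j / fact j * of_real (M u j t)) sums \<Phi> u t \<kappa>"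
  unfolding M_def \<Phi>_def
  by (intro has_sum_imp_sums exp_moment_series(1) summable_gaussian_exp t) simp

lemma summable_moment: "t > 0 \<Longrightarrow> (\<lambda>x. exp (- pi * t * (norm x)\<^sup>2) * (x \<bullet> u) ^ j) summable_on L"
  by (intro exp_moment_series(3) summable_gaussian_exp) simp

text \<open>Poisson summation for the translate by s u. Expanding the square turns the translation
  into an exponential linear in \<open>x \<bullet> u\<close>, and the phases on the dual side are
  imaginary exponentials of the same form. The power t^12 is sqrt t to the dimension 24.\<close>

lemma \<Phi>_transform:
  fixes s :: real
  assumes t: "t > 0" and u: "norm u = 1"
  shows "\<Phi> u (1/t) (2 * of_real pi * \<i> * of_real s) =
    of_real (t ^ 12 * exp (- pi * t * s\<^sup>2)) * \<Phi> u t (- 2 * of_real pi * of_real t * of_real s)"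
proof -
  obtain S where S: "((\<lambda>x. exp (- pi * t * (norm (x + s *\<^sub>R u))\<^sup>2)) has_sum S) L"
    "((\<lambda>x. complex_of_real (exp (- pi * (norm x)\<^sup>2 / t)) * cis (2 * pi * (x \<bullet> (s *\<^sub>R u)))) has_sum
      of_real (sqrt t ^ CARD(24) * S)) L"
    using poisson_gaussian[OF t, of "s *\<^sub>R u"] by blast
  have "sqrt t ^ CARD(24) = (sqrt t ^ 2) ^ 12" by (simp flip: power_mult)
  then have st: "sqrt t ^ CARD(24) = t ^ 12" using t by simp
  have "cis (2 * pi * (x \<bullet> (s *\<^sub>R u))) = exp (2 * of_real pi * \<i> * of_real s * of_real (x \<bullet> u))" for x
    by (simp add: cis_conv_exp algebra_simps)
  then have 1: "\<Phi> u (1/t) (2 * of_real pi * \<i> * of_real s) = of_real (t ^ 12 * S)"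
    unfolding \<Phi>_def using S(2)[unfolded st] by (simp add: infsumI)
  have "complex_of_real (exp (- pi * t * (norm (x + s *\<^sub>R u))\<^sup>2)) = of_real (exp (- pi * t * s\<^sup>2)) *
      (of_real (exp (- pi * t * (norm x)\<^sup>2)) * exp (- 2 * of_real pi * of_real t * of_real s * of_real (x \<bullet> u)))" for x
  proof -
    have "(norm (x + s *\<^sub>R u))\<^sup>2 = (norm x)\<^sup>2 + 2 * s * (x \<bullet> u) + s\<^sup>2"
    proof -
      have "u \<bullet> u = 1" using u by (simp add: norm_eq_1)
      then show ?thesis
        unfolding power2_norm_eq_inner by (simp add: inner_add_left inner_add_right inner_commute power2_eq_square)
    qed
    then have "- pi * t * (norm (x + s *\<^sub>R u))\<^sup>2 = - pi * t * s\<^sup>2 + - pi * t * (norm x)\<^sup>2 + - 2 * pi * t * s * (x \<bullet> u)"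
      by (simp add: algebra_simps)
    then have "exp (- pi * t * (norm (x + s *\<^sub>R u))\<^sup>2) = exp (- pi * t * s\<^sup>2) * exp (- pi * t * (norm x)\<^sup>2) * exp (- 2 * pi * t * s * (x \<bullet> u))"
      by (simp only: exp_add)
    moreover have "complex_of_real (exp (- 2 * pi * t * s * (x \<bullet> u))) = exp (- 2 * of_real pi * of_real t * of_real s * of_real (x \<bullet> u))"
      by (simp flip: exp_of_real)
    ultimately show ?thesis by (simp only: of_real_mult mult.assoc)
  qed
  moreover have "((\<lambda>x. complex_of_real (exp (- pi * t * (norm (x + s *\<^sub>R u))\<^sup>2))) has_sum of_real S) L"
    by (rule has_sum_of_real[OF S(1)])
  moreover have "((\<lambda>x. of_real (exp (- pi * t * s\<^sup>2)) *
      (of_real (exp (- pi * t * (norm x)\<^sup>2)) * exp (- 2 * of_real pi * of_real t * of_real s * of_real (x \<bullet> u))))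
      has_sum (of_real (exp (- pi * t * s\<^sup>2)) * \<Phi> u t (- 2 * of_real pi * of_real t * of_real s))) L"
    unfolding \<Phi>_def
    by (intro has_sum_cmult_right has_sum_infsum exp_moment_series(2) summable_gaussian_exp t) simp
  ultimately have "complex_of_real S = of_real (exp (- pi * t * s\<^sup>2)) * \<Phi> u t (- 2 * of_real pi * of_real t * of_real s)"
    by (simp only: has_sum_unique)
  then show ?thesis unfolding 1 by simp
qed

text \<open>The factor exp (-pi t s^2) in \<open>\<Phi>_transform\<close> mixes moments of different
  orders. In the difference for u and v the orders below j cancel, so at order s^j only its value 1
  at s = 0 counts. The powers of i and of -1 stem from the arguments 2 pi i s and -2 pi t s.\<close>

lemma M_transform:
  assumes t: "t > 0" and u: "norm u = 1" "norm v = 1"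
    and low: "\<And>i t. i < j \<Longrightarrow> t > 0 \<Longrightarrow> M u i t = M v i t"
  shows "\<i> ^ j * of_real (M u j (1/t) - M v j (1/t)) = of_real (t ^ (12 + j) * (-1) ^ j * (M u j t - M v j t))"
proof -
  have t': "1/t > 0" using t by simp
  have "(2 * of_real pi * \<i>) ^ j / fact j * of_real (M u j (1/t) - M v j (1/t)) =
      of_real (t ^ 12) * ((- 2 * of_real pi * of_real t) ^ j / fact j * of_real (M u j t - M v j t))"
  proof (rule powser_leading_coeff[where g = "\<lambda>s. of_real (t ^ 12 * exp (- pi * t * s\<^sup>2))"
      and a = "\<lambda>j. (2 * of_real pi * \<i>) ^ j / fact j * of_real (M u j (1/t) - M v j (1/t))"
      and b = "\<lambda>j. (- 2 * of_real pi * of_real t) ^ j / fact j * of_real (M u j t - M v j t)"])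
    have *: "(\<lambda>n. c ^ n / fact n * of_real (M u n r - M v n r) * z ^ n) sums (\<Phi> u r (c * z) - \<Phi> v r (c * z))"
      if "r > 0" for r c z
      using sums_diff[OF \<Phi>_series[OF that, of "c * z" u] \<Phi>_series[OF that, of "c * z" v]]
      by (simp add: power_mult_distrib algebra_simps diff_divide_distrib)
    show "(\<lambda>n. (2 * of_real pi * \<i>) ^ n / fact n * of_real (M u n (1/t) - M v n (1/t)) * z ^ n) sums
      (\<Phi> u (1/t) (2 * of_real pi * \<i> * z) - \<Phi> v (1/t) (2 * of_real pi * \<i> * z))" for z
      by (rule *[OF t'])
    show "(\<lambda>n. (- 2 * of_real pi * of_real t) ^ n / fact n * of_real (M u n t - M v n t) * z ^ n) sums
      (\<Phi> u t (- 2 * of_real pi * of_real t * z) - \<Phi> v t (- 2 * of_real pi * of_real t * z))" for z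
      by (rule *[OF t])
    show "\<Phi> u (1/t) (2 * of_real pi * \<i> * of_real s) - \<Phi> v (1/t) (2 * of_real pi * \<i> * of_real s) =
      of_real (t ^ 12 * exp (- pi * t * s\<^sup>2)) *
      (\<Phi> u t (- 2 * of_real pi * of_real t * of_real s) - \<Phi> v t (- 2 * of_real pi * of_real t * of_real s))" for s
      unfolding \<Phi>_transform[OF t u(1)] \<Phi>_transform[OF t u(2)] by (rule right_diff_distrib[symmetric])
    have "((\<lambda>s. complex_of_real (t ^ 12 * exp (- pi * t * s\<^sup>2))) \<longlongrightarrow> of_real (t ^ 12 * exp (- pi * t * 0\<^sup>2))) (at 0)"
      by (intro tendsto_intros)
    then show "((\<lambda>s. complex_of_real (t ^ 12 * exp (- pi * t * s\<^sup>2))) \<longlongrightarrow> of_real (t ^ 12)) (at 0)" by simp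
  qed (use low t t' in auto)
  then have "(2 * of_real pi) ^ j * (\<i> ^ j * of_real (M u j (1/t) - M v j (1/t))) =
      (2 * of_real pi) ^ j * of_real (t ^ (12 + j) * (-1) ^ j * (M u j t - M v j t))"
  proof -
    have "(- 2 * complex_of_real pi * of_real t) ^ j = (-1) ^ j * (2 * of_real pi) ^ j * of_real t ^ j"
    proof -
      have "- 2 * complex_of_real pi * of_real t = (-1) * (2 * of_real pi) * of_real t" by simp
      then show ?thesis by (simp only: power_mult_distrib)
    qed
    moreover assume "(2 * of_real pi * \<i>) ^ j / fact j * complex_of_real (M u j (1/t) - M v j (1/t)) =
      of_real (t ^ 12) * ((- 2 * of_real pi * of_real t) ^ j / fact j * of_real (M u j t - M v j t))"
    ultimately show ?thesis
      by (simp add: power_mult_distrib[of _ \<i>] power_add divide_simps mult_ac del: of_real_diff)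
  qed
  then show ?thesis by (simp only: mult_cancel_left) simp
qed

end

section \<open>Power sums over the shells and their independence of the direction\<close>

context rootless_leech
begin

definition p :: "real^24 \<Rightarrow> nat \<Rightarrow> nat \<Rightarrow> real" where
  "p u j n = (\<Sum>x\<in>shell L n. (x \<bullet> u) ^ j)"

text \<open>All points of a shell carry the same positive Gaussian weight, and the weights have a
  finite sum.\<close>

lemma finite_shell: "finite (shell L n)"
proof (rule ccontr)
  assume inf: "infinite (shell L n)"
  define e where "e = exp (- pi * 1 * (2 * real n))"
  define S where "S = (\<Sum>\<^sub>\<infinity>x\<in>L. exp (- pi * 1 * (norm x)\<^sup>2))"
  have hs: "((\<lambda>x. exp (- pi * 1 * (norm x)\<^sup>2)) has_sum S) L"
    unfolding S_def by (intro has_sum_infsum summable_gaussian) simp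
  obtain k :: nat where k: "S / e < k" using reals_Archimedean2 by blast
  obtain F where F: "F \<subseteq> shell L n" "finite F" "card F = k"
    using infinite_arbitrarily_large[OF inf] by blast
  have "(\<Sum>x\<in>F. exp (- pi * 1 * (norm x)\<^sup>2)) \<le> S"
    by (rule has_sum_mono2[OF has_sum_finite[OF F(2)] hs]) (use F in \<open>auto simp: shell_def\<close>)
  also have "(\<Sum>x\<in>F. exp (- pi * 1 * (norm x)\<^sup>2)) = (\<Sum>x\<in>F. e)"
    by (rule sum.cong) (use F in \<open>auto simp: shell_def e_def\<close>)
  finally have "k * e \<le> S" using F by simp
  moreover have "S < k * e" using k by (simp add: e_def field_simps)
  ultimately show False by simp
qed

lemma uminus_shell: "x \<in> shell L n \<Longrightarrow> - x \<in> shell L n"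
  by (auto simp: shell_def uminus_mem)

lemma ex_shell: "x \<in> L \<Longrightarrow> \<exists>n. x \<in> shell L n"
proof -
  assume x: "x \<in> L"
  then obtain k :: int where k: "(norm x)\<^sup>2 = 2 * of_int k" using even_norm by blast
  then have "k \<ge> 0" by (smt (verit) of_int_0_le_iff zero_le_power2)
  then have "(norm x)\<^sup>2 = 2 * real (nat k)" using k by simp
  then show ?thesis using x by (auto simp: shell_def)
qed

lemma M_sums:
  assumes t: "t > 0"
  shows "(\<lambda>n. p u j n * exp (- 2 * pi * t) ^ n) sums M u j t"
proof -
  define F where "F x = exp (- pi * t * (norm x)\<^sup>2) * (x \<bullet> u) ^ j" for x
  have "(F has_sum M u j t) L"
    unfolding F_def M_def by (intro has_sum_infsum summable_moment t)
  moreover have "bij_betw snd (SIGMA n:UNIV. shell L n) L"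
  proof (rule bij_betwI')
    fix a b assume "a \<in> (SIGMA n:UNIV. shell L n)" "b \<in> (SIGMA n:UNIV. shell L n)"
    then show "(snd a = snd b) = (a = b)" by (cases a; cases b) (auto simp: shell_def)
  next
    fix a assume "a \<in> (SIGMA n:UNIV. shell L n)"
    then show "snd a \<in> L" by (auto simp: shell_def)
  next
    fix x assume "x \<in> L"
    then obtain n where "x \<in> shell L n" using ex_shell by blast
    then show "\<exists>a\<in>(SIGMA n:UNIV. shell L n). x = snd a" by force
  qed
  ultimately have "((\<lambda>a. F (snd a)) has_sum M u j t) (SIGMA n:UNIV. shell L n)"
    using has_sum_reindex_bij_betw[where f = F] by blast
  moreover have "((\<lambda>x. F (snd (n, x))) has_sum (p u j n * exp (- 2 * pi * t) ^ n)) (shell L n)" for n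
  proof -
    have "(\<Sum>x\<in>shell L n. F x) = p u j n * exp (- 2 * pi * t) ^ n"
      unfolding p_def sum_distrib_right
    proof (rule sum.cong)
      fix x assume "x \<in> shell L n"
      then have "- pi * t * (norm x)\<^sup>2 = real n * (- 2 * pi * t)" by (simp add: shell_def)
      then have "exp (- pi * t * (norm x)\<^sup>2) = exp (- 2 * pi * t) ^ n" by (simp only: exp_of_nat_mult)
      then show "F x = (x \<bullet> u) ^ j * exp (- 2 * pi * t) ^ n" by (simp only: F_def mult.commute)
    qed simp
    then show ?thesis using has_sum_finite[OF finite_shell, of F n] by simp
  qed
  ultimately have "((\<lambda>n. p u j n * exp (- 2 * pi * t) ^ n) has_sum M u j t) UNIV"
    by (rule has_sum_Sigma')
  then show ?thesis by (rule has_sum_imp_sums)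
qed

lemma p_odd: "odd j \<Longrightarrow> p u j n = 0"
proof -
  assume j: "odd j"
  have "x \<in> uminus ` shell L n" if "x \<in> shell L n" for x
    using uminus_shell[OF that] by (intro image_eqI[of x uminus "- x"]) auto
  then have "uminus ` shell L n = shell L n" using uminus_shell by auto
  then have "p u j n = (\<Sum>x\<in>uminus ` shell L n. (x \<bullet> u) ^ j)"
    unfolding p_def by (simp only:)
  also have "\<dots> = - p u j n"
    unfolding p_def by (subst sum.reindex) (auto simp: j sum_negf inj_on_def)
  finally show ?thesis by simp
qed

lemma p_summable:
  fixes z :: complex
  assumes "norm z < 1"
  shows "summable (\<lambda>n. of_real (p u j n) * z ^ n)"
proof -
  obtain q where q: "norm z < q" "q < 1" using assms dense by blast
  define t where "t = - ln q / (2 * pi)"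
  have q0: "q > 0" using q norm_ge_zero[of z] by linarith
  then have t: "t > 0" using q by (simp add: t_def divide_neg_pos)
  have "exp (- 2 * pi * t) = q" using q0 by (simp add: t_def)
  then have "(\<lambda>n. p u j n * q ^ n) sums M u j t" using M_sums[OF t, of u j] by (simp only:)
  from sums_of_real[OF this] have "summable (\<lambda>n. complex_of_real (p u j n) * of_real q ^ n)"
    by (auto simp: sums_iff)
  then show ?thesis by (rule powser_inside) (use q q0 in auto)
qed

lemma p_0: "p u j 0 = 0 ^ j"
proof -
  have "shell L 0 = {0}" by (auto simp: shell_def zero_mem)
  then show ?thesis by (simp add: p_def)
qed

lemma p_1: "p u j 1 = 0"
proof -
  have "shell L 1 = {}" using no_roots by (auto simp: shell_def)
  then show ?thesis by (simp add: p_def)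
qed

text \<open>Strong induction supplies the agreement of lower orders that \<open>M_transform\<close>
  asks for. The coefficient at n = 0 vanishes because that shell is {0}, the one at n = 1 because
  there are no roots. Odd j follow from antipodality, which leaves even weights 12 + j.\<close>

lemma p_invariant:
  assumes u: "norm u = 1" "norm v = 1" and "j \<le> 10"
  shows "p u j n = p v j n"
  using \<open>j \<le> 10\<close>
proof (induction j arbitrary: n rule: less_induct)
  case (less j)
  show ?case
  proof (cases "odd j")
    case True
    then show ?thesis by (simp add: p_odd)
  next
    case False
    define a where "a n = complex_of_real (p u j n - p v j n)" for n
    have asum: "summable (\<lambda>n. a n * z ^ n)" if "norm z < 1" for z
      using summable_diff[OF p_summable[OF that, of u j] p_summable[OF that, of v j]]
      by (simp add: a_def algebra_simps)
    define F where "F z = (\<Sum>n. a n * z ^ n)" for z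
    have F_hol: "F holomorphic_on ball 0 1"
      by (rule power_series_holomorphic[where a = a]) (use asum in \<open>auto simp: F_def summable_sums\<close>)
    have F_real: "F (of_real (exp (- 2 * pi * t))) = of_real (M u j t - M v j t)" if "t > 0" for t
    proof -
      have "(\<lambda>n. complex_of_real (p u j n * exp (- 2 * pi * t) ^ n - p v j n * exp (- 2 * pi * t) ^ n)) sums of_real (M u j t - M v j t)"
        by (intro sums_of_real sums_diff M_sums that)
      then have "(\<lambda>n. a n * complex_of_real (exp (- 2 * pi * t)) ^ n) sums of_real (M u j t - M v j t)"
        by (simp add: a_def left_diff_distrib)
      then show ?thesis by (simp add: F_def sums_iff)
    qed
    have low: "M u i t = M v i t" if "i < j" "t > 0" for i t
    proof -
      have "p u i n = p v i n" for n using less.IH[of i] less.prems that by auto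
      then show ?thesis using M_sums[OF that(2), of u i] M_sums[OF that(2), of v i] sums_unique2 by simp
    qed
    define m where "m = 6 + j div 2"
    have m: "2 * m = 12 + j" using False by (simp add: m_def)
    define H where "H = {z::complex. Im z > 0}"
    have modular: "F (exp (2 * of_real pi * \<i> * (-1/z))) = z ^ (2*m) * F (exp (2 * of_real pi * \<i> * z))"
      if z: "Im z > 0" for z
    proof -
      define D where "D z = F (exp (2 * of_real pi * \<i> * (-1/z))) - z ^ (2*m) * F (exp (2 * of_real pi * \<i> * z))" for z
      \<comment> \<open>\<open>M_transform\<close> gives the identity on the imaginary axis only;
        analytic continuation extends it to the upper half-plane.\<close>
      have "D z = 0"
      proof (rule analytic_continuation[of D H "{z. \<exists>t>0. z = \<i> * of_real t}" "\<i>"])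
        have im: "Im (-1/z) > 0" if "Im z > 0" for z
          unfolding Im_neg_inverse using that by (intro divide_pos_pos) (auto simp: zero_less_power2)
        have "(F \<circ> (\<lambda>z. exp (2 * of_real pi * \<i> * (-1/z)))) holomorphic_on H"
        proof (rule holomorphic_on_compose_gen[OF _ F_hol])
          show "(\<lambda>z. exp (2 * of_real pi * \<i> * (-1/z))) holomorphic_on H"
            by (intro holomorphic_intros) (auto simp: H_def)
          show "(\<lambda>z. exp (2 * of_real pi * \<i> * (-1/z))) ` H \<subseteq> ball 0 1"
          proof (rule image_subsetI)
            fix z assume "z \<in> H"
            then show "exp (2 * of_real pi * \<i> * (-1/z)) \<in> ball 0 1"
              unfolding mem_ball_0 H_def by (intro nome_less_1 im) simp
          qed
        qed
        moreover have "(F \<circ> (\<lambda>z. exp (2 * of_real pi * \<i> * z))) holomorphic_on H"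
        proof (rule holomorphic_on_compose_gen[OF _ F_hol])
          show "(\<lambda>z. exp (2 * of_real pi * \<i> * z)) holomorphic_on H"
            by (intro holomorphic_intros)
          show "(\<lambda>z. exp (2 * of_real pi * \<i> * z)) ` H \<subseteq> ball 0 1"
            by (auto simp: H_def)
        qed
        ultimately show "D holomorphic_on H"
          unfolding D_def o_def by (intro holomorphic_intros)
        show "open H" unfolding H_def by (rule open_halfspace_Im_gt)
        show "connected H" unfolding H_def by (intro convex_connected convex_halfspace_Im_gt)
        show "{z. \<exists>t>0. z = \<i> * complex_of_real t} \<subseteq> H" by (auto simp: H_def)
        show "\<i> \<in> H" "z \<in> H" using z by (auto simp: H_def)
        show "\<i> islimpt {z. \<exists>t>0. z = \<i> * complex_of_real t}"
          unfolding islimpt_approachable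
        proof (intro allI impI)
          fix e :: real assume "e > 0"
          then show "\<exists>z'\<in>{z. \<exists>t>0. z = \<i> * complex_of_real t}. z' \<noteq> \<i> \<and> dist z' \<i> < e"
            by (intro bexI[of _ "\<i> * of_real (1 + e/2)"])
               (auto simp: dist_norm algebra_simps norm_mult intro!: exI[of _ "1 + e/2"])
        qed
        fix w assume "w \<in> {z. \<exists>t>0. z = \<i> * complex_of_real t}"
        then obtain t where t: "t > 0" "w = \<i> * of_real t" by blast
        have e1: "exp (2 * of_real pi * \<i> * w) = of_real (exp (- 2 * pi * t))"
          using t by (simp add: exp_of_real algebra_simps flip: exp_of_real)
        have e2: "exp (2 * of_real pi * \<i> * (-1/w)) = of_real (exp (- 2 * pi * (1/t)))"
          using t by (simp add: field_simps flip: exp_of_real)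
        have "\<i> ^ j * of_real (M u j (1/t) - M v j (1/t)) = of_real (t ^ (12 + j) * (-1) ^ j * (M u j t - M v j t))"
          by (rule M_transform[OF t(1) u low])
        also have "(-1::real) ^ j = 1" using False by simp
        finally have "\<i> ^ j * (\<i> ^ j * of_real (M u j (1/t) - M v j (1/t))) = \<i> ^ j * of_real (t ^ (12 + j) * (M u j t - M v j t))"
          by simp
        \<comment> \<open>On the axis w = i t, so the automorphy factor is i^j t^(12 + j); for even
          j the power i^j is its own inverse.\<close>
        moreover have "\<i> ^ j * \<i> ^ j = 1" using False by (auto elim!: evenE simp flip: power_mult_distrib)
        moreover have "\<i> ^ (12 + j) = \<i> ^ j" by (simp add: power_add)
        ultimately have "of_real (M u j (1/t) - M v j (1/t)) = w ^ (12 + j) * of_real (M u j t - M v j t)"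
          unfolding t(2) power_mult_distrib by (simp add: mult.assoc[symmetric])
        then show "D w = 0" unfolding D_def e1 e2 F_real[OF t(1)] m
          using F_real[of "1/t"] t by simp
      qed
      then show ?thesis by (simp add: D_def)
    qed
    interpret cusp_form_series a m
    proof
      show "a 0 = 0" "a 1 = 0" by (simp_all add: a_def p_0 p_1 del: One_nat_def)
      show "m \<le> 11" using less.prems by (simp add: m_def)
      show "(\<Sum>n. a n * exp (2 * of_real pi * \<i> * (-1/z)) ^ n) = z ^ (2*m) * (\<Sum>n. a n * exp (2 * of_real pi * \<i> * z) ^ n)"
        if "Im z > 0" for z
        using modular[OF that] by (simp only: F_def)
    qed (rule asum)
    show ?thesis using coeff_eq_0[of n] by (simp add: a_def)
  qed
qed

end

section \<open>Moments of the shells\<close>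

text \<open>For v integral on the lattice, the coordinate vector of v solves a linear system with
  integral right-hand side, whose matrix \<open>A\<close> is the integral Gram matrix of determinant
  1; Cramer's rule makes it integral. Integrality of inner products is polarization of the even
  norm.\<close>

lemma lattice_of_selfdual:
  fixes M :: "real^'n^'n"
  assumes M: "\<bar>det M\<bar> = 1" and even: "even_lattice (lattice_of M)"
  shows "selfdual_lattice (lattice_of M)"
proof
  show zero: "0 \<in> lattice_of M"
    unfolding lattice_of_def by (rule CollectI, rule exI[of _ 0]) simp
  show diff: "x - y \<in> lattice_of M" if xy: "x \<in> lattice_of M" "y \<in> lattice_of M" for x y
  proof -
    obtain a b where "x = M *v a" "y = M *v b" "\<forall>i. a $ i \<in> \<int>" "\<forall>i. b $ i \<in> \<int>"
      using xy unfolding lattice_of_def by blast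
    then show ?thesis unfolding lattice_of_def
      by (intro CollectI exI[of _ "a - b"]) (auto simp: matrix_vector_mult_diff_distrib)
  qed
  show inner: "x \<bullet> y \<in> \<int>" if xy: "x \<in> lattice_of M" "y \<in> lattice_of M" for x y
  proof -
    have ev: "\<exists>k::int. (norm v)\<^sup>2 = 2 * of_int k" if "v \<in> lattice_of M" for v
      using even that unfolding even_lattice_def by blast
    obtain a b c :: int where "(norm x)\<^sup>2 = 2 * of_int a" "(norm y)\<^sup>2 = 2 * of_int b" "(norm (x - y))\<^sup>2 = 2 * of_int c"
      using ev[OF xy(1)] ev[OF xy(2)] ev[OF diff[OF xy]] by blast
    then have "x \<bullet> y = of_int (a + b - c)"
      by (simp add: power2_norm_eq_inner inner_diff_left inner_diff_right inner_commute)
    then show ?thesis by (simp only: Ints_of_int)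
  qed
  have col: "M *v axis i 1 \<in> lattice_of M" for i
    unfolding lattice_of_def by (intro CollectI exI[of _ "axis i 1"]) (auto simp: axis_def)
  have repr: "M *v z = (\<Sum>i\<in>UNIV. z $ i *\<^sub>R (M *v axis i 1))" for z :: "real^'n"
  proof -
    have "z = (\<Sum>i\<in>UNIV. z $ i *\<^sub>R axis i 1)" by (metis basis_expansion scalar_mult_eq_scaleR)
    then have "M *v z = M *v (\<Sum>i\<in>UNIV. z $ i *\<^sub>R axis i 1)" by simp
    also have "\<dots> = (\<Sum>i\<in>UNIV. z $ i *\<^sub>R (M *v axis i 1))"
      by (simp add: linear_sum[OF matrix_vector_mul_linear] linear_scale[OF matrix_vector_mul_linear])
    finally show ?thesis .
  qed
  have inv: "invertible M" using M by (auto simp: invertible_det_nz)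
  then obtain M' where "M ** M' = mat 1" unfolding invertible_def by blast
  then have surj: "M *v (M' *v v) = v" for v by (simp add: matrix_vector_mul_assoc)
  show "span (lattice_of M) = UNIV"
  proof (intro set_eqI iffI UNIV_I)
    fix v
    have "M *v (M' *v v) \<in> span (lattice_of M)"
      unfolding repr[of "M' *v v"] by (intro span_sum span_scale span_base col)
    then show "v \<in> span (lattice_of M)" by (simp only: surj)
  qed
  show "v \<in> lattice_of M" if v: "\<And>x. x \<in> lattice_of M \<Longrightarrow> x \<bullet> v \<in> \<int>" for v
  proof -
    define A where "A = transpose M ** M"
    define z where "z = M' *v v"
    have vz: "v = M *v z" unfolding z_def surj ..
    have ent: "(transpose M *v y) $ i = (M *v axis i 1) \<bullet> y" for y i
    proof -
      have "(transpose M *v y) $ i = (transpose M *v y) \<bullet> axis i 1"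
        by (simp only: inner_axis inner_real_def mult_1_right)
      also have "\<dots> = y \<bullet> (M *v axis i 1)"
        by (simp only: transpose_matrix_vector dot_lmul_matrix)
      finally show ?thesis by (simp only: inner_commute)
    qed
    have A: "A $ i $ j \<in> \<int>" for i j
    proof -
      have "A $ i $ j = (transpose M *v (M *v axis j 1)) $ i"
      proof -
        have "A $ i $ j = (A *v axis j 1) $ i" by (simp only: matrix_vector_mult_basis column_def vec_lambda_beta)
        also have "A *v axis j 1 = transpose M *v (M *v axis j 1)" by (simp only: A_def matrix_vector_mul_assoc)
        finally show ?thesis .
      qed
      then show ?thesis using inner[OF col col] by (simp only: ent)
    qed
    have detA: "det A = 1"
    proof -
      have "det A = \<bar>det M\<bar> * \<bar>det M\<bar>" by (simp add: A_def det_mul det_transpose)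
      then show ?thesis using M by simp
    qed
    have k: "(transpose M *v v) $ i \<in> \<int>" for i using v[OF col] by (simp only: ent)
    have "A *v z = transpose M *v v" by (simp add: vz A_def matrix_vector_mul_assoc)
    then have zk: "z = (\<chi> k. det (\<chi> i j. if j = k then (transpose M *v v) $ i else A $ i $ j) / det A)"
      by (subst (asm) cramer) (use detA in auto)
    have "z $ k \<in> \<int>" for k
    proof -
      have "det (\<chi> i j. if j = k then (transpose M *v v) $ i else A $ i $ j) \<in> \<int>"
        unfolding det_def by (intro Ints_sum Ints_mult Ints_prod) (use A k in auto)
      then show ?thesis by (subst zk) (simp add: detA)
    qed
    then show ?thesis unfolding vz lattice_of_def by blast
  qed
qed

lemma leech_lattice_imp_rootless:
  assumes "leech_lattice L"
  shows "rootless_leech L"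
proof -
  obtain M where M: "\<bar>det M\<bar> = 1" "L = lattice_of M"
    using assms unfolding leech_lattice_def unimodular_lattice_def by blast
  interpret selfdual_lattice L
    using lattice_of_selfdual[OF M(1)] M(2) assms unfolding leech_lattice_def by simp
  show ?thesis
    by unfold_locales (use assms in \<open>auto simp: leech_lattice_def even_lattice_def\<close>)
qed

context rootless_leech
begin

text \<open>The power sum of degree 2k over shell n for any unit vector: for k <= 5 the choice of
  coordinate vector is immaterial by \<open>p_invariant\<close>.\<close>

definition cc :: "nat \<Rightarrow> nat \<Rightarrow> real" where
  "cc n k = p (axis 1 1) (2 * k) n"

lemma p_scale: "p (r *\<^sub>R u) j n = r ^ j * p u j n"
  by (simp add: p_def sum_distrib_left power_mult_distrib)

lemma p_even:
  assumes "k \<le> 5"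
  shows "p u (2 * k) n = cc n k * (u \<bullet> u) ^ k"
proof (cases "u = 0")
  case True
  then show ?thesis by (cases "k = 0") (auto simp: p_def cc_def power_0_left)
next
  case False
  have "p u (2 * k) n = p (norm u *\<^sub>R (u /\<^sub>R norm u)) (2 * k) n" using False by simp
  also have "\<dots> = norm u ^ (2 * k) * p (u /\<^sub>R norm u) (2 * k) n" by (rule p_scale)
  also have "p (u /\<^sub>R norm u) (2 * k) n = cc n k"
    unfolding cc_def using False assms by (intro p_invariant) auto
  also have "norm u ^ (2 * k) = (u \<bullet> u) ^ k" by (simp add: power_mult power2_norm_eq_inner)
  finally show ?thesis by simp
qed

definition mu :: "real^24 \<Rightarrow> real^24 \<Rightarrow> nat \<Rightarrow> nat \<Rightarrow> nat \<Rightarrow> real" where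
  "mu w y n i j = (\<Sum>x\<in>shell L n. (x \<bullet> w) ^ i * (x \<bullet> y) ^ j)"

text \<open>The power sum in direction w + s y is, as a polynomial in s, a binomial sum of mixed
  moments. It is also a multiple of (|w|^2 + s^2 |y|^2)^k, because w and y are orthogonal. The claim
  compares coefficients.\<close>

lemma mu_choose:
  assumes "w \<bullet> y = 0" "k \<le> 5" "j \<le> 2 * k"
  shows "real (2 * k choose j) * mu w y n (2 * k - j) j =
    (if even j then cc n k * real (k choose (j div 2)) * (w \<bullet> w) ^ (k - j div 2) * (y \<bullet> y) ^ (j div 2) else 0)"
proof -
  define d where "d i = (if even i then cc n k * real (k choose (i div 2)) * (w \<bullet> w) ^ (k - i div 2) * (y \<bullet> y) ^ (i div 2) else 0)" for i
  have "(\<Sum>i\<le>2*k. real (2 * k choose i) * mu w y n (2 * k - i) i * s ^ i) = (\<Sum>i\<le>2*k. d i * s ^ i)" for s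
  proof -
    have "(\<Sum>i\<le>2*k. real (2 * k choose i) * mu w y n (2 * k - i) i * s ^ i) =
        (\<Sum>x\<in>shell L n. \<Sum>i\<le>2*k. real (2 * k choose i) * (s * (x \<bullet> y)) ^ i * (x \<bullet> w) ^ (2 * k - i))"
      by (subst sum.swap) (simp add: mu_def sum_distrib_left sum_distrib_right power_mult_distrib mult_ac)
    also have "\<dots> = (\<Sum>x\<in>shell L n. (s * (x \<bullet> y) + x \<bullet> w) ^ (2 * k))"
      by (simp add: binomial_ring)
    also have "\<dots> = p (s *\<^sub>R y + w) (2 * k) n" by (simp add: p_def inner_add_right)
    also have "\<dots> = cc n k * ((s *\<^sub>R y + w) \<bullet> (s *\<^sub>R y + w)) ^ k" by (rule p_even[OF assms(2)])
    also have "(s *\<^sub>R y + w) \<bullet> (s *\<^sub>R y + w) = s\<^sup>2 * (y \<bullet> y) + w \<bullet> w"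
      using assms(1) by (simp add: inner_add_left inner_add_right inner_commute power2_eq_square)
    also have "cc n k * (s\<^sup>2 * (y \<bullet> y) + w \<bullet> w) ^ k = (\<Sum>i\<le>k. d (2 * i) * s ^ (2 * i))"
      by (simp add: binomial_ring sum_distrib_left d_def power_mult_distrib mult_ac flip: power_mult)
    also have "\<dots> = (\<Sum>i\<in>(\<lambda>i. 2 * i) ` {..k}. d i * s ^ i)"
      by (subst sum.reindex) (auto simp: inj_on_def)
    also have "\<dots> = (\<Sum>i\<le>2*k. d i * s ^ i)"
      by (rule sum.mono_neutral_left) (auto simp: d_def image_iff elim!: evenE)
    finally show ?thesis .
  qed
  then have "\<forall>i\<le>2*k. real (2 * k choose i) * mu w y n (2 * k - i) i = d i"
    by (subst polyfun_eq_coeffs[symmetric]) blast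
  then show ?thesis using assms(3) by (simp add: d_def)
qed

lemma cc_0: "cc n 0 = card (shell L n)" by (simp add: cc_def p_def)

text \<open>The squared coordinates of x sum to 2n. Multiply by the 2k-th power of the first
  coordinate and sum over the shell: the first coordinate contributes \<open>cc n (Suc k)\<close>,
  and each of the other 23 contributes this divided by 2k + 1.\<close>

lemma cc_Suc:
  assumes "k < 5"
  shows "(2 * k + 24) * cc n (Suc k) = (2 * k + 1) * (2 * real n) * cc n k"
proof -
  define e :: "24 \<Rightarrow> real^24" where "e i = axis i 1" for i
  have ee: "e 1 \<bullet> e i = (if i = 1 then 1 else 0)" for i by (simp add: e_def inner_axis_axis)
  have e1: "e i \<bullet> e i = 1" for i by (simp add: e_def inner_axis_axis)
  have mu2: "(2 * k + 1) * mu (e 1) (e i) n (2 * k) 2 = cc n (Suc k)" if "i \<noteq> 1" for i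
  proof -
    have "real (2 * Suc k choose 2) * mu (e 1) (e i) n (2 * Suc k - 2) 2 =
      (if even (2::nat) then cc n (Suc k) * real (Suc k choose (2 div 2)) * (e 1 \<bullet> e 1) ^ (Suc k - 2 div 2) * (e i \<bullet> e i) ^ (2 div 2) else 0)"
      by (rule mu_choose) (use ee[of i] that assms in auto)
    also have "\<dots> = cc n (Suc k) * real (Suc k)" by (simp add: e1)
    also have "2 * Suc k - 2 = 2 * k" by simp
    also have "2 * Suc k choose 2 = Suc k * (2 * k + 1)"
    proof -
      have "2 * Suc k * (2 * Suc k - 1) = 2 * (Suc k * (2 * k + 1))" by simp
      then show ?thesis unfolding choose_two by simp
    qed
    finally have "real (Suc k) * ((2 * k + 1) * mu (e 1) (e i) n (2 * k) 2) = real (Suc k) * cc n (Suc k)"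
      by (simp only: of_nat_mult mult_ac)
    then show ?thesis by (simp only: mult_cancel_left) simp
  qed
  have mu1: "mu (e 1) (e 1) n (2 * k) 2 = cc n (Suc k)"
    by (simp add: mu_def cc_def p_def e_def flip: power_add)
  have "(\<Sum>i\<in>UNIV. mu (e 1) (e i) n (2 * k) 2) = (\<Sum>x\<in>shell L n. (x \<bullet> e 1) ^ (2 * k) * (\<Sum>i\<in>UNIV. (x \<bullet> e i)\<^sup>2))"
    unfolding mu_def by (subst sum.swap) (simp add: sum_distrib_left)
  also have "\<dots> = (\<Sum>x\<in>shell L n. (x \<bullet> e 1) ^ (2 * k) * (2 * real n))"
  proof (rule sum.cong)
    fix x assume "x \<in> shell L n"
    then have "(norm x)\<^sup>2 = 2 * real n" by (simp add: shell_def)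
    moreover have "(norm x)\<^sup>2 = (\<Sum>i\<in>UNIV. (x \<bullet> e i)\<^sup>2)"
    proof -
      have eq: "x \<bullet> e i = x $ i" for i by (simp add: e_def inner_axis)
      show ?thesis unfolding power2_norm_eq_inner eq by (simp add: inner_vec_def power2_eq_square)
    qed
    ultimately show "(x \<bullet> e 1) ^ (2 * k) * (\<Sum>i\<in>UNIV. (x \<bullet> e i)\<^sup>2) = (x \<bullet> e 1) ^ (2 * k) * (2 * real n)" by simp
  qed simp
  also have "\<dots> = 2 * real n * cc n k"
    unfolding cc_def p_def e_def sum_distrib_right[symmetric] by (simp only: mult.commute)
  finally have 1: "(2 * k + 1) * (\<Sum>i\<in>UNIV. mu (e 1) (e i) n (2 * k) 2) = (2 * k + 1) * (2 * real n * cc n k)" by simp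
  have 2: "(\<Sum>i\<in>UNIV. mu (e 1) (e i) n (2 * k) 2) = mu (e 1) (e 1) n (2 * k) 2 + (\<Sum>i\<in>UNIV - {1}. mu (e 1) (e i) n (2 * k) 2)"
    by (rule sum.remove) auto
  have "(2 * k + 1) * (\<Sum>i\<in>UNIV - {1}. mu (e 1) (e i) n (2 * k) 2) = (\<Sum>i\<in>UNIV - {1::24}. cc n (Suc k))"
    unfolding sum_distrib_left by (rule sum.cong) (use mu2 in auto)
  also have "\<dots> = 23 * cc n (Suc k)" by (simp add: card_Diff_singleton)
  finally have 3: "(2 * k + 1) * (\<Sum>i\<in>UNIV - {1}. mu (e 1) (e i) n (2 * k) 2) = 23 * cc n (Suc k)" .
  from 1 have "(2 * k + 1) * cc n (Suc k) + 23 * cc n (Suc k) = (2 * k + 1) * (2 * real n * cc n k)"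
    unfolding 2 mu1 distrib_left 3 .
  then show ?thesis by (simp add: algebra_simps)
qed

end

section \<open>The slices of the minimal shell\<close>

lemma norm2_diff: "(norm (x - y))\<^sup>2 = (norm x)\<^sup>2 + (norm y)\<^sup>2 - 2 * (x \<bullet> y)"
  for x y :: "'a::real_inner"
  by (simp add: power2_norm_eq_inner inner_diff_left inner_diff_right inner_commute)

lemma norm2_add: "(norm (x + y))\<^sup>2 = (norm x)\<^sup>2 + (norm y)\<^sup>2 + 2 * (x \<bullet> y)"
  for x y :: "'a::real_inner"
  by (simp add: power2_norm_eq_inner inner_add_left inner_add_right inner_commute)

lemma Ints_abs_le_cases:
  assumes "t \<in> \<int>" "\<bar>t\<bar> < (4::real)"
  shows "t \<in> {-3, -2, -1, 0, 1, 2, 3}"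
proof -
  obtain k :: int where k: "t = of_int k" using assms(1) by (elim Ints_cases)
  then have "-4 < k" "k < 4" using assms(2) by auto
  then have "k \<in> {-3, -2, -1, 0, 1, 2, 3}" by auto
  then show ?thesis using k by auto
qed

lemma sum_two_points:
  assumes "finite A" "a \<in> A" "b \<in> A" "a \<noteq> b" "\<And>x. x \<in> A \<Longrightarrow> x \<noteq> a \<Longrightarrow> x \<noteq> b \<Longrightarrow> f x = 0"
  shows "sum f A = f a + f b"
proof -
  have "sum f A = sum f {a, b}" by (rule sum.mono_neutral_right) (use assms in auto)
  then show ?thesis using assms(4) by simp
qed

context rootless_leech
begin

lemma norm2_ge_4: "x \<in> L \<Longrightarrow> x \<noteq> 0 \<Longrightarrow> (norm x)\<^sup>2 \<ge> 4"
proof -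
  assume x: "x \<in> L" "x \<noteq> 0"
  then obtain k :: int where k: "(norm x)\<^sup>2 = 2 * of_int k" using even_norm by blast
  have "(norm x)\<^sup>2 > 0" using x by simp
  then have "k > 0" using k by simp
  moreover have "k \<noteq> 1" using no_roots[OF x(1)] k by auto
  ultimately show ?thesis using k by simp
qed

lemma cc_values:
  "cc n 1 = real (card (shell L n)) * (2 * real n) / 24"
  "cc n 2 = cc n 1 * 3 * (2 * real n) / 26"
  "cc n 3 = cc n 2 * 5 * (2 * real n) / 28"
  "cc n 4 = cc n 3 * 7 * (2 * real n) / 30"
  "cc n 5 = cc n 4 * 9 * (2 * real n) / 32"
  using cc_Suc[of 0 n] cc_Suc[of 1 n, unfolded Suc_1] cc_Suc[of 2 n] cc_Suc[of 3 n] cc_Suc[of 4 n]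
  by (simp_all add: cc_0 field_simps)

lemma p_2_4_6:
  assumes "u \<bullet> u = r"
  shows "p u 2 n = cc n 1 * r" "p u 4 n = cc n 2 * r ^ 2" "p u 6 n = cc n 3 * r ^ 3"
    "p u 8 n = cc n 4 * r ^ 4" "p u 10 n = cc n 5 * r ^ 5"
  using p_even[of 1 u n] p_even[of 2 u n] p_even[of 3 u n] p_even[of 4 u n] p_even[of 5 u n] assms
  by simp_all

text \<open>The polynomial t^2 (t^2 - 1) (t^2 - 4) vanishes at the inner products of
  \<open>x0\<close> with all shell vectors except \<open>x0\<close> and its negative, as these are
  integers of absolute value at most 2. Its sum over the shell is 2 * 2880, and the moments express
  the same sum as a constant times the cardinality.\<close>

lemma card_shell_2_if_nonempty:
  assumes x0: "x0 \<in> shell L 2"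
  shows "card (shell L 2) = 196560"
proof -
  define f :: "real \<Rightarrow> real" where "f t = t^6 - 5 * t^4 + 4 * t^2" for t
  have n0: "(norm x0)\<^sup>2 = 4" "x0 \<in> L" "x0 \<bullet> x0 = 4" using x0 by (auto simp: shell_def power2_norm_eq_inner)
  have "(\<Sum>x\<in>shell L 2. f (x \<bullet> x0)) = f (x0 \<bullet> x0) + f (- x0 \<bullet> x0)"
  proof (rule sum_two_points[OF finite_shell x0 uminus_shell[OF x0]])
    show "x0 \<noteq> - x0" using n0 inner_minus_left[of x0 x0] by fastforce
    fix x assume x: "x \<in> shell L 2" "x \<noteq> x0" "x \<noteq> - x0"
    then have xL: "x \<in> L" "(norm x)\<^sup>2 = 4" by (auto simp: shell_def)
    have "(norm (x - x0))\<^sup>2 \<ge> 4" "(norm (x + x0))\<^sup>2 \<ge> 4"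
      using x xL n0 by (auto intro!: norm2_ge_4 diff_mem add_mem simp: eq_neg_iff_add_eq_0)
    then have "\<bar>x \<bullet> x0\<bar> \<le> 2" unfolding norm2_diff norm2_add using xL n0 by linarith
    moreover have "x \<bullet> x0 \<in> \<int>" using xL n0 by (intro inner_Ints)
    ultimately have "x \<bullet> x0 \<in> {-2, -1, 0, 1, 2}" using Ints_abs_le_cases[of "x \<bullet> x0"] by auto
    then show "f (x \<bullet> x0) = 0" by (auto simp: f_def)
  qed
  also have "\<dots> = 5760" using n0 by (simp add: f_def)
  finally have "p x0 6 2 - 5 * p x0 4 2 + 4 * p x0 2 2 = 5760"
    unfolding f_def p_def by (simp add: sum.distrib sum_subtractf sum_distrib_left)
  then have "real (card (shell L 2)) = 196560"
    unfolding p_2_4_6[OF n0(3)] cc_values by simp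
  then show ?thesis by linarith
qed

text \<open>Otherwise the minimal squared length is 6, and w meets the vectors of its shell other
  than w and -w in integers of absolute value at most 3. Then t^2 (t^2 - 1) (t^2 - 4) (t^2 - 9) and
  t^2 times it give two incompatible equations for the size of that shell.\<close>

lemma shell_2_nonempty:
  assumes w: "w \<in> shell L 3"
  shows "shell L 2 \<noteq> {}"
proof
  assume empty: "shell L 2 = {}"
  have n0: "(norm w)\<^sup>2 = 6" "w \<in> L" "w \<bullet> w = 6" using w by (auto simp: shell_def power2_norm_eq_inner)
  have ge6: "(norm x)\<^sup>2 \<ge> 6" if x: "x \<in> L" "x \<noteq> 0" for x
  proof -
    obtain k where k: "x \<in> shell L k" using ex_shell[OF x(1)] by blast
    then have "(norm x)\<^sup>2 = 2 * real k" by (simp add: shell_def)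
    moreover have "k \<noteq> 2" using k empty by auto
    ultimately show ?thesis using norm2_ge_4[OF x] by linarith
  qed
  have main: "(\<Sum>x\<in>shell L 3. f (x \<bullet> w)) = f 6 + f (-6)"
    if f: "\<And>t::real. t \<in> {-3, -2, -1, 0, 1, 2, 3} \<Longrightarrow> f t = (0::real)" for f
  proof -
    have "(\<Sum>x\<in>shell L 3. f (x \<bullet> w)) = f (w \<bullet> w) + f (- w \<bullet> w)"
    proof (rule sum_two_points[OF finite_shell w uminus_shell[OF w]])
      show "w \<noteq> - w" using n0 inner_minus_left[of w w] by fastforce
      fix x assume x: "x \<in> shell L 3" "x \<noteq> w" "x \<noteq> - w"
      then have xL: "x \<in> L" "(norm x)\<^sup>2 = 6" by (auto simp: shell_def)
      have "(norm (x - w))\<^sup>2 \<ge> 6" "(norm (x + w))\<^sup>2 \<ge> 6"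
        using x xL n0 by (auto intro!: ge6 diff_mem add_mem simp: eq_neg_iff_add_eq_0)
      then have "\<bar>x \<bullet> w\<bar> < 4" unfolding norm2_diff norm2_add using xL n0 by linarith
      moreover have "x \<bullet> w \<in> \<int>" using xL n0 by (intro inner_Ints)
      ultimately show "f (x \<bullet> w) = 0" by (intro f Ints_abs_le_cases)
    qed
    then show ?thesis using n0 by simp
  qed
  define f8 :: "real \<Rightarrow> real" where "f8 t = t^8 - 14 * t^6 + 49 * t^4 - 36 * t^2" for t
  define f10 :: "real \<Rightarrow> real" where "f10 t = t^10 - 14 * t^8 + 49 * t^6 - 36 * t^4" for t
  have "(\<Sum>x\<in>shell L 3. f8 (x \<bullet> w)) = 2177280"
    by (subst main) (auto simp: f8_def)
  then have 1: "p w 8 3 - 14 * p w 6 3 + 49 * p w 4 3 - 36 * p w 2 3 = 2177280"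
    unfolding f8_def p_def by (simp add: sum.distrib sum_subtractf sum_distrib_left)
  have "(\<Sum>x\<in>shell L 3. f10 (x \<bullet> w)) = 36 * 2177280"
    by (subst main) (auto simp: f10_def)
  then have 2: "p w 10 3 - 14 * p w 8 3 + 49 * p w 6 3 - 36 * p w 4 3 = 36 * 2177280"
    unfolding f10_def p_def by (simp add: sum.distrib sum_subtractf sum_distrib_left)
  from 1 2 show False unfolding p_2_4_6[OF n0(3)] cc_values by simp
qed

lemma mu_odd:
  assumes "odd (i + j)"
  shows "mu w y n i j = 0"
proof -
  have img: "uminus ` shell L n = shell L n"
    using uminus_shell by (metis (mono_tags, lifting) add.inverse_inverse equalityI image_subset_iff image_eqI subsetI)
  have "mu w y n i j = (\<Sum>x\<in>uminus ` shell L n. (x \<bullet> w) ^ i * (x \<bullet> y) ^ j)"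
    unfolding mu_def img ..
  also have "\<dots> = (\<Sum>x\<in>shell L n. (- (x \<bullet> w)) ^ i * (- (x \<bullet> y)) ^ j)"
    by (subst sum.reindex) (auto simp: inj_on_def)
  also have "\<dots> = - mu w y n i j"
    unfolding mu_def sum_negf[symmetric] using assms by (intro sum.cong) (auto simp: power_minus_odd power_minus_even)
  finally show ?thesis by simp
qed

lemma mu_zero:
  assumes "w \<bullet> y = 0" "i + j \<le> 10" "odd i \<or> odd j"
  shows "mu w y n i j = 0"
proof (cases "even (i + j)")
  case True
  then obtain k where k: "i + j = 2 * k" by (elim evenE)
  then have i: "2 * k - j = i" by simp
  have "odd j" using assms(3) True by auto
  then have "real (2 * k choose j) * mu w y n i j = 0"
    using mu_choose[OF assms(1), of k j n] assms(2) k i by simp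
  then show ?thesis using k by simp
next
  case False
  then show ?thesis by (rule mu_odd)
qed

end

locale leech_vector = rootless_leech L for L :: "(real^24) set" +
  fixes w :: "real^24"
  assumes w_shell: "w \<in> shell L 3"
begin

lemma w: "w \<in> L" "(norm w)\<^sup>2 = 6" "w \<bullet> w = 6"
  using w_shell by (auto simp: shell_def power2_norm_eq_inner)

lemma card_shell_2: "card (shell L 2) = 196560"
  using shell_2_nonempty[OF w_shell] card_shell_2_if_nonempty by blast

text \<open>Neither x - w nor x + w may be shorter than a minimal vector.\<close>

lemma inner_w_cases:
  assumes "x \<in> shell L 2"
  shows "x \<bullet> w \<in> {-3, -2, -1, 0, 1, 2, 3}"
proof (rule Ints_abs_le_cases)
  have x: "x \<in> L" "(norm x)\<^sup>2 = 4" using assms by (auto simp: shell_def)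
  then show "x \<bullet> w \<in> \<int>" using w by (intro inner_Ints)
  have "x \<noteq> w" "x \<noteq> - w" using x w by auto
  then have "(norm (x - w))\<^sup>2 \<ge> 4" "(norm (x + w))\<^sup>2 \<ge> 4"
    using x w by (auto intro!: norm2_ge_4 diff_mem add_mem simp: eq_neg_iff_add_eq_0)
  then show "\<bar>x \<bullet> w\<bar> < 4" unfolding norm2_diff norm2_add using x w by linarith
qed

definition slice :: "real \<Rightarrow> (real^24) set" where
  "slice a = {x \<in> shell L 2. x \<bullet> w = a}"

lemma finite_slice: "finite (slice a)"
  unfolding slice_def using finite_shell by simp

lemma slice_sum:
  fixes g :: "real^24 \<Rightarrow> real"
  assumes "\<And>b. b \<in> {-3, -2, -1, 0, 1, 2, 3} \<Longrightarrow> q b = (if b = a then 1 else 0)"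
  shows "(\<Sum>x\<in>slice a. g x) = (\<Sum>x\<in>shell L 2. q (x \<bullet> w) * g x)"
proof -
  have "(\<Sum>x\<in>shell L 2. q (x \<bullet> w) * g x) = (\<Sum>x\<in>shell L 2. if x \<bullet> w = a then g x else 0)"
    by (rule sum.cong) (use assms inner_w_cases in auto)
  then show ?thesis unfolding slice_def using finite_shell by (simp add: sum.inter_filter)
qed

lemma slice_3_moment:
  "(\<Sum>x\<in>slice 3. (x \<bullet> y) ^ j) = (mu w y 2 6 j + 3 * mu w y 2 5 j - 5 * mu w y 2 4 j - 15 * mu w y 2 3 j
     + 4 * mu w y 2 2 j + 12 * mu w y 2 1 j) / 720"
proof -
  \<comment> \<open>This is t (t^2 - 1) (t^2 - 4) (t + 3) / 720, which is 1 at 3 and 0 at the other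
    six values. Degree 6 in the direction w leaves degree j <= 5 out of the strength 11 of the
    shell.\<close>
  define q where "q t = (t^6 + 3 * t^5 - 5 * t^4 - 15 * t^3 + 4 * t^2 + 12 * t) / 720" for t :: real
  have "(\<Sum>x\<in>slice 3. (x \<bullet> y) ^ j) = (\<Sum>x\<in>shell L 2. q (x \<bullet> w) * (x \<bullet> y) ^ j)"
    by (rule slice_sum) (auto simp: q_def)
  also have "\<dots> = (mu w y 2 6 j + 3 * mu w y 2 5 j - 5 * mu w y 2 4 j - 15 * mu w y 2 3 j
     + 4 * mu w y 2 2 j + 12 * mu w y 2 1 j) / 720"
    unfolding mu_def q_def
    by (simp add: sum_distrib_left sum_distrib_right algebra_simps add_divide_distrib diff_divide_distrib
        sum.distrib sum_subtractf sum_divide_distrib)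
  finally show ?thesis .
qed

lemma slice_2_moment:
  "(\<Sum>x\<in>slice 2. (x \<bullet> y) ^ j) = - (mu w y 2 6 j + 2 * mu w y 2 5 j - 10 * mu w y 2 4 j - 20 * mu w y 2 3 j
     + 9 * mu w y 2 2 j + 18 * mu w y 2 1 j) / 120"
proof -
  \<comment> \<open>This is -t (t^2 - 1) (t^2 - 9) (t + 2) / 120, which is 1 at 2 and 0 at the other
    six values.\<close>
  define q where "q t = - (t^6 + 2 * t^5 - 10 * t^4 - 20 * t^3 + 9 * t^2 + 18 * t) / 120" for t :: real
  have "(\<Sum>x\<in>slice 2. (x \<bullet> y) ^ j) = (\<Sum>x\<in>shell L 2. q (x \<bullet> w) * (x \<bullet> y) ^ j)"
    by (rule slice_sum) (auto simp: q_def)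
  also have "\<dots> = - (mu w y 2 6 j + 2 * mu w y 2 5 j - 10 * mu w y 2 4 j - 20 * mu w y 2 3 j
     + 9 * mu w y 2 2 j + 18 * mu w y 2 1 j) / 120"
    unfolding mu_def q_def
    by (simp add: sum_distrib_left sum_distrib_right algebra_simps add_divide_distrib diff_divide_distrib
        sum.distrib sum_subtractf sum_divide_distrib)
  finally show ?thesis .
qed

lemma cc_2: "cc 2 1 = 32760" "cc 2 2 = 15120" "cc 2 3 = 10800" "cc 2 4 = 10080" "cc 2 5 = 11340"
  unfolding cc_values card_shell_2 by simp_all

context
  fixes y assumes y: "w \<bullet> y = 0"
begin

lemma mu_j0: "mu w y 2 2 0 = 196560" "mu w y 2 4 0 = 544320" "mu w y 2 6 0 = 2332800"
  using mu_choose[OF y, of 1 0 2] mu_choose[OF y, of 2 0 2] mu_choose[OF y, of 3 0 2]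
  by (simp_all add: cc_2[simplified] w)

lemma mu_j2: "mu w y 2 2 2 = 30240 * (y \<bullet> y)" "mu w y 2 4 2 = 77760 * (y \<bullet> y)" "mu w y 2 6 2 = 311040 * (y \<bullet> y)"
  using mu_choose[OF y, of 2 2 2] mu_choose[OF y, of 3 2 2] mu_choose[OF y, of 4 2 2]
  by (simp_all add: cc_2[simplified] w choose_two)

lemma mu_j4: "mu w y 2 2 4 = 12960 * (y \<bullet> y)\<^sup>2" "mu w y 2 4 4 = 31104 * (y \<bullet> y)\<^sup>2" "mu w y 2 6 4 = 116640 * (y \<bullet> y)\<^sup>2"
  using mu_choose[OF y, of 3 4 2] mu_choose[OF y, of 4 4 2] mu_choose[OF y, of 5 4 2]
  by (simp_all add: cc_2[simplified] w choose_two binomial_fact fact_numeral)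

lemma slice_3_moments:
  "(\<Sum>x\<in>slice 3. x \<bullet> y) = 0" "(\<Sum>x\<in>slice 3. (x \<bullet> y)^2) = 60 * (y \<bullet> y)" "(\<Sum>x\<in>slice 3. (x \<bullet> y)^3) = 0"
  "(\<Sum>x\<in>slice 3. (x \<bullet> y)^4) = 18 * (y \<bullet> y)\<^sup>2" "(\<Sum>x\<in>slice 3. (x \<bullet> y)^5) = 0"
  using slice_3_moment[of y 1] slice_3_moment[of y 2] slice_3_moment[of y 3] slice_3_moment[of y 4] slice_3_moment[of y 5]
  by (simp_all add: mu_j2 mu_j4 mu_zero[OF y] mu_odd)

lemma slice_2_moments:
  "(\<Sum>x\<in>slice 2. x \<bullet> y) = 0" "(\<Sum>x\<in>slice 2. (x \<bullet> y)^2) = 1620 * (y \<bullet> y)" "(\<Sum>x\<in>slice 2. (x \<bullet> y)^3) = 0"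
  "(\<Sum>x\<in>slice 2. (x \<bullet> y)^4) = 648 * (y \<bullet> y)\<^sup>2" "(\<Sum>x\<in>slice 2. (x \<bullet> y)^5) = 0"
  using slice_2_moment[of y 1] slice_2_moment[of y 2] slice_2_moment[of y 3] slice_2_moment[of y 4] slice_2_moment[of y 5]
  by (simp_all add: mu_j2 mu_j4 mu_zero[OF y] mu_odd)

end

text \<open>The zeroth moment, with y = 0 as a dummy direction orthogonal to w.\<close>

lemma card_slice_3: "card (slice 3) = 552"
proof -
  have "real (card (slice 3)) = 552"
    using slice_3_moment[of 0 0] mu_j0[of 0] mu_zero[of w 0 _ 0 2] by (simp add: mu_zero)
  then show ?thesis by linarith
qed

lemma card_slice_2: "card (slice 2) = 11178"
proof -
  have "real (card (slice 2)) = 11178"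
    using slice_2_moment[of 0 0] mu_j0[of 0] by (simp add: mu_zero)
  then show ?thesis by linarith
qed

end

section \<open>Duals of the lattices generated by the slices\<close>

lemma Ints_abs_le_2:
  assumes "t \<in> \<int>" "\<bar>t\<bar> \<le> (2::real)"
  shows "t \<in> {-2, -1, 0, 1, 2}"
  using Ints_abs_le_cases[of t] assms by auto

context leech_vector
begin

lemma slice_mem:
  assumes "x \<in> slice a"
  shows "x \<in> L" "(norm x)\<^sup>2 = 4" "x \<bullet> w = a" "x \<bullet> x = 4"
  using assms by (auto simp: slice_def shell_def power2_norm_eq_inner)

lemma sliceI: "x \<in> L \<Longrightarrow> (norm x)\<^sup>2 = 4 \<Longrightarrow> x \<bullet> w = a \<Longrightarrow> x \<in> slice a"
  by (simp add: slice_def shell_def)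

lemma reflect_slice_3: "b \<in> slice 3 \<Longrightarrow> w - b \<in> slice 3"
proof -
  assume b: "b \<in> slice 3"
  show ?thesis
  proof (rule sliceI)
    show "w - b \<in> L" using slice_mem[OF b] w by (intro diff_mem)
    have wb: "w \<bullet> b = 3" using slice_mem[OF b] by (simp add: inner_commute)
    show "(norm (w - b))\<^sup>2 = 4" unfolding norm2_diff wb using slice_mem[OF b] w by simp
    show "(w - b) \<bullet> w = 3" using slice_mem[OF b] w by (simp add: inner_diff_left)
  qed
qed

lemma slices_nonempty: "slice 3 \<noteq> {}" "slice 2 \<noteq> {}"
  using card_slice_3 card_slice_2 by auto

lemma even_norm_nat: "x \<in> L \<Longrightarrow> \<exists>k::nat. (norm x)\<^sup>2 = 2 * real k"
  using ex_shell by (auto simp: shell_def)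

lemma ex_minimal_outside:
  assumes "v \<in> L" "v \<notin> G" "Q v"
  obtains u where "u \<in> L" "u \<notin> G" "Q u" "\<And>x. x \<in> L \<Longrightarrow> x \<notin> G \<Longrightarrow> Q x \<Longrightarrow> (norm u)\<^sup>2 \<le> (norm x)\<^sup>2"
proof -
  define P where "P u \<longleftrightarrow> u \<in> L \<and> u \<notin> G \<and> Q u" for u
  define N where "N x = nat \<lfloor>(norm x)\<^sup>2\<rfloor>" for x :: "real^24"
  have N: "(norm x)\<^sup>2 = real (N x)" if "x \<in> L" for x
    using even_norm_nat[OF that] by (auto simp: N_def)
  have "P v" using assms by (simp add: P_def)
  from ex_has_least_nat[of P, OF this, of N] obtain u where u: "P u" "\<And>y. P y \<Longrightarrow> N u \<le> N y" by blast
  show ?thesis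
    by (rule that[of u]) (use u N in \<open>auto simp: P_def\<close>)
qed

lemma sum_const_slice: "(\<And>x. x \<in> slice a \<Longrightarrow> f x = c) \<Longrightarrow> (\<Sum>x\<in>slice a. f x) = real (card (slice a)) * c"
  by simp

text \<open>A shortest vector outside a subgroup cannot be shortened by an element of the subgroup,
  so it has small inner products with the generators.\<close>

lemma minimal_outside:
  fixes d :: real
  assumes G: "0 \<in> G" "\<And>x y. x \<in> G \<Longrightarrow> y \<in> G \<Longrightarrow> x - y \<in> G"
    and v: "v \<in> L" "v \<bullet> w = d * of_int k" "v \<notin> G"
  obtains mn u0 where "mn u0" "\<And>u. mn u \<Longrightarrow> u \<in> L" "\<And>u. mn u \<Longrightarrow> u \<notin> G" "\<And>u. mn u \<Longrightarrow> mn (- u)"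
    "\<And>u. mn u \<Longrightarrow> \<exists>j::int. u \<bullet> w = d * of_int j"
    "\<And>u x j. mn u \<Longrightarrow> x \<in> G \<Longrightarrow> x \<in> L \<Longrightarrow> x \<bullet> w = d * of_int j \<Longrightarrow> 2 * \<bar>u \<bullet> x\<bar> \<le> (norm x)\<^sup>2"
    "\<And>u x j. mn u \<Longrightarrow> x \<in> G \<Longrightarrow> x \<in> L \<Longrightarrow> x \<bullet> w = d * of_int j \<Longrightarrow> 2 * (u \<bullet> x) = (norm x)\<^sup>2 \<Longrightarrow> mn (u - x)"
proof -
  define Q where "Q u \<longleftrightarrow> (\<exists>k::int. u \<bullet> w = d * of_int k)" for u
  have "Q v" using v by (auto simp: Q_def)
  from ex_minimal_outside[of v G Q, OF v(1) \<open>v \<notin> G\<close> this] obtain u0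
    where u0: "u0 \<in> L" "u0 \<notin> G" "Q u0" "\<And>x. x \<in> L \<Longrightarrow> x \<notin> G \<Longrightarrow> Q x \<Longrightarrow> (norm u0)\<^sup>2 \<le> (norm x)\<^sup>2" by blast
  define mn where "mn u \<longleftrightarrow> u \<in> L \<and> u \<notin> G \<and> Q u \<and> (norm u)\<^sup>2 = (norm u0)\<^sup>2" for u
  have neg: "- x \<in> G" if "x \<in> G" for x using G(2)[OF G(1) that] by simp
  have add: "x + y \<in> G" if "x \<in> G" "y \<in> G" for x y using G(2)[OF that(1) neg[OF that(2)]] by simp
  have Q_diff: "Q (x - y)" if "Q x" "Q y" for x y
  proof -
    from that obtain i j :: int where "x \<bullet> w = d * of_int i" "y \<bullet> w = d * of_int j" unfolding Q_def by blast
    then have "(x - y) \<bullet> w = d * of_int (i - j)" by (simp add: inner_diff_left algebra_simps)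
    then show ?thesis unfolding Q_def by blast
  qed
  have Q0: "Q 0" unfolding Q_def by (rule exI[of _ 0]) simp
  have Q_neg: "Q (- x)" if "Q x" for x using Q_diff[OF Q0 that] by simp
  have shift: "(norm u0)\<^sup>2 \<le> (norm (u - x))\<^sup>2" "u - x \<notin> G" if "mn u" "x \<in> G" "x \<in> L" "Q x" for u x
  proof -
    show "u - x \<notin> G" using add[of "u - x" x] that by (auto simp: mn_def)
    then show "(norm u0)\<^sup>2 \<le> (norm (u - x))\<^sup>2" using that by (intro u0(4) diff_mem Q_diff) (auto simp: mn_def)
  qed
  show ?thesis
  proof
    show "mn u0" using u0 by (simp add: mn_def)
    show "u \<in> L" "u \<notin> G" "\<exists>j::int. u \<bullet> w = d * of_int j" if "mn u" for u using that by (auto simp: mn_def Q_def)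
    show "mn (- u)" if "mn u" for u using that neg[of "- u"] by (auto simp: mn_def uminus_mem Q_neg)
    show "2 * \<bar>u \<bullet> x\<bar> \<le> (norm x)\<^sup>2" if u: "mn u" and x: "x \<in> G" "x \<in> L" "x \<bullet> w = d * of_int j" for u x j
    proof -
      have Qx: "Q x" using x by (auto simp: Q_def)
      have "(norm u0)\<^sup>2 = (norm u)\<^sup>2" using u by (simp add: mn_def)
      then show ?thesis
        using shift(1)[OF u x(1,2) Qx] shift(1)[OF u neg[OF x(1)] uminus_mem[OF x(2)] Q_neg[OF Qx]]
        by (simp add: norm2_diff norm2_add)
    qed
    show "mn (u - x)" if u: "mn u" and x: "x \<in> G" "x \<in> L" "x \<bullet> w = d * of_int j" and e: "2 * (u \<bullet> x) = (norm x)\<^sup>2" for u x j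
    proof -
      have Qx: "Q x" using x by (auto simp: Q_def)
      have "(norm (u - x))\<^sup>2 = (norm u0)\<^sup>2" using e u by (simp add: norm2_diff mn_def)
      then show ?thesis using shift(2)[OF u x(1,2) Qx] u x(2) Qx by (auto simp: mn_def intro!: diff_mem Q_diff)
    qed
  qed
qed

text \<open>Equality of second and fourth moments of a slice will force the squared length b / a on
  a nonzero vector; this is impossible if b / a is not an even integer.\<close>

lemma even_norm_eq_0:
  assumes "x \<in> L" "a * (x \<bullet> x)\<^sup>2 = b * (x \<bullet> x)" "a \<noteq> 0" "\<And>k::nat. a * (2 * real k) \<noteq> b"
  shows "x = 0"
proof (rule ccontr)
  assume "x \<noteq> 0"
  then have "a * (x \<bullet> x) = b" using assms(2) by (simp add: power2_eq_square)
  moreover obtain k :: nat where "x \<bullet> x = 2 * real k"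
    using even_norm_nat[OF assms(1)] by (auto simp: power2_norm_eq_inner)
  ultimately show False using assms(4)[of k] by simp
qed

text \<open>\<open>G\<close> is any subgroup containing the slice, hence also w = b + (w - b). A
  shortest missing vector u then has \<open>u \<bullet> w\<close> in {-3, 0, 3}. Its inner products
  with the slice are so few that the second and fourth moments contradict each other (for 3) or the
  evenness of the norm (for 0).\<close>

lemma slice_3_generates:
  assumes G: "0 \<in> G" "\<And>x y. x \<in> G \<Longrightarrow> y \<in> G \<Longrightarrow> x - y \<in> G" and sub: "slice 3 \<subseteq> G"
    and v: "v \<in> L" "v \<bullet> w = 3 * of_int k"
  shows "v \<in> G"
proof (rule ccontr)
  assume "v \<notin> G"
  obtain mn u0
    where u0mn: "mn u0" and mn: "\<And>u. mn u \<Longrightarrow> u \<in> L" "\<And>u. mn u \<Longrightarrow> u \<notin> G" "\<And>u. mn u \<Longrightarrow> mn (- u)"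
      "\<And>u. mn u \<Longrightarrow> \<exists>j::int. u \<bullet> w = 3 * of_int j"
    and bound: "\<And>u x j. mn u \<Longrightarrow> x \<in> G \<Longrightarrow> x \<in> L \<Longrightarrow> x \<bullet> w = 3 * of_int j \<Longrightarrow> 2 * \<bar>u \<bullet> x\<bar> \<le> (norm x)\<^sup>2"
    and shift: "\<And>u x j. mn u \<Longrightarrow> x \<in> G \<Longrightarrow> x \<in> L \<Longrightarrow> x \<bullet> w = 3 * of_int j \<Longrightarrow> 2 * (u \<bullet> x) = (norm x)\<^sup>2 \<Longrightarrow> mn (u - x)"
    by (rule minimal_outside[OF G(1) _ v \<open>v \<notin> G\<close>], (rule G(2); assumption), (rule that; assumption))
  have B: "b \<in> G" "b \<in> L" "b \<bullet> w = 3 * of_int 1" if "b \<in> slice 3" for b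
    using that sub slice_mem[OF that] by auto
  obtain b0 where b0: "b0 \<in> slice 3" using slices_nonempty by blast
  have "b0 - (0 - (w - b0)) \<in> G" by (intro G B reflect_slice_3 b0)
  then have wG: "w \<in> G" by simp
  have not3: "u \<bullet> w \<noteq> 3" if u: "mn u" for u
  proof
    assume uw: "u \<bullet> w = 3"
    \<comment> \<open>The part of u orthogonal to w meets the slice only in 1/2 and -1/2. The second
      moment then gives \<open>y \<bullet> y\<close> = 23/10, the fourth gives 23/12 for its
      square.\<close>
    define y where "y = u - (1/2) *\<^sub>R w"
    have y: "w \<bullet> y = 0" using uw w by (simp add: y_def inner_diff_right inner_commute)
    have s: "(b \<bullet> y)\<^sup>2 = 1/4" if b: "b \<in> slice 3" for b
    proof -
      have 1: "\<bar>u \<bullet> b\<bar> \<le> 2" using bound[OF u B[OF b]] slice_mem[OF b] by simp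
      have b': "w - b \<in> slice 3" by (rule reflect_slice_3[OF b])
      have "\<bar>u \<bullet> (w - b)\<bar> \<le> 2" using bound[OF u B[OF b']] slice_mem[OF b'] by simp
      then have "\<bar>3 - u \<bullet> b\<bar> \<le> 2" using uw by (simp add: inner_diff_right)
      moreover have "u \<bullet> b \<in> \<int>" by (rule inner_Ints[OF mn(1)[OF u] slice_mem(1)[OF b]])
      ultimately have "u \<bullet> b = 1 \<or> u \<bullet> b = 2" using Ints_abs_le_2[of "u \<bullet> b"] 1 by auto
      moreover have "b \<bullet> y = u \<bullet> b - 3/2" using slice_mem[OF b] by (simp add: y_def inner_diff_right inner_commute)
      ultimately show ?thesis by (auto simp: power2_eq_square)
    qed
    have "(\<Sum>b\<in>slice 3. (b \<bullet> y)^2) = 138" by (subst sum_const_slice[OF s]) (auto simp: card_slice_3)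
    then have 2: "60 * (y \<bullet> y) = 138" using slice_3_moments(2)[OF y] by simp
    have s4: "(b \<bullet> y)^4 = 1/16" if "b \<in> slice 3" for b
    proof -
      have "(b \<bullet> y)^4 = ((b \<bullet> y)\<^sup>2)\<^sup>2" by (simp flip: power_mult)
      also have "\<dots> = (1/4)\<^sup>2" by (simp only: s[OF that])
      finally show ?thesis by (simp add: power_divide)
    qed
    have "(\<Sum>b\<in>slice 3. (b \<bullet> y)^4) = 69/2" by (subst sum_const_slice[OF s4]) (auto simp: card_slice_3)
    then have "18 * (y \<bullet> y)\<^sup>2 = 69/2" using slice_3_moments(4)[OF y] by simp
    moreover have "y \<bullet> y = 23/10" using 2 by simp
    ultimately show False by (simp add: power2_eq_square)
  qed
  have "u0 \<bullet> w = 0"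
  proof -
    have "\<bar>u0 \<bullet> w\<bar> \<le> 3" using bound[OF u0mn wG w(1), of 2] w by simp
    moreover obtain j :: int where j: "u0 \<bullet> w = 3 * of_int j" using mn(4)[OF u0mn] by blast
    ultimately have "\<bar>j\<bar> \<le> 1" by linarith
    then have "j = 0 \<or> j = 1 \<or> j = -1" by linarith
    moreover have "j \<noteq> 1" using not3[OF u0mn] j by auto
    moreover have "j \<noteq> -1" using not3[OF mn(3)[OF u0mn]] j by auto
    ultimately show ?thesis using j by simp
  qed
  then have y: "w \<bullet> u0 = 0" by (simp add: inner_commute)
  have small: "(b \<bullet> u0)^4 = (b \<bullet> u0)^2" if b: "b \<in> slice 3" for b
  proof -
    have ub: "\<bar>u0 \<bullet> b\<bar> \<le> 2" using bound[OF u0mn B[OF b]] slice_mem[OF b] by simp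
    \<comment> \<open>An inner product 2 would make b - u another shortest vector, now with inner
      product 3 with w.\<close>
    have no2: "u \<bullet> b \<noteq> 2" if u: "mn u" "u \<bullet> w = 0" for u
    proof
      assume e: "u \<bullet> b = 2"
      have "mn (- (u - b))" by (rule mn(3), rule shift[OF u(1) B[OF b]]) (use e slice_mem[OF b] in simp)
      moreover have "(- (u - b)) \<bullet> w = 3" using u(2) slice_mem[OF b] by (simp add: inner_diff_left)
      ultimately show False using not3 by blast
    qed
    have "u0 \<bullet> b \<in> \<int>" by (rule inner_Ints[OF mn(1)[OF u0mn] slice_mem(1)[OF b]])
    moreover have "u0 \<bullet> b \<noteq> 2" "u0 \<bullet> b \<noteq> -2"
      using no2[OF u0mn \<open>u0 \<bullet> w = 0\<close>] no2[OF mn(3)[OF u0mn]] \<open>u0 \<bullet> w = 0\<close> by auto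
    ultimately have "u0 \<bullet> b \<in> {-1, 0, 1}" using Ints_abs_le_2[OF _ ub] by auto
    then show ?thesis by (auto simp: inner_commute)
  qed
  have "18 * (u0 \<bullet> u0)\<^sup>2 = 60 * (u0 \<bullet> u0)"
    unfolding slice_3_moments(2)[OF y, symmetric] slice_3_moments(4)[OF y, symmetric]
    using small by simp
  then have "u0 = 0"
  proof (rule even_norm_eq_0[OF mn(1)[OF u0mn]])
    show "18 * (2 * real k) \<noteq> 60" for k
    proof
      assume "18 * (2 * real k) = 60"
      then have "real (3 * k) = real 5" by simp
      then have "3 * k = 5" by (simp only: of_nat_eq_iff)
      then show False by presburger
    qed
  qed simp
  then show False using mn(2)[OF u0mn] G(1) by simp
qed

text \<open>The scheme of \<open>slice_3_generates\<close>, with w supplied as a generator. For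
  \<open>u \<bullet> w\<close> = 2, comparison with w - c, of squared length 6, excludes
  \<open>u \<bullet> c\<close> = -2 and leaves -1, 0, 1, 2.\<close>

lemma slice_2_generates:
  assumes G: "0 \<in> G" "\<And>x y. x \<in> G \<Longrightarrow> y \<in> G \<Longrightarrow> x - y \<in> G" and sub: "slice 2 \<subseteq> G" and wG: "w \<in> G"
    and v: "v \<in> L" "v \<bullet> w = 2 * of_int k"
  shows "v \<in> G"
proof (rule ccontr)
  assume "v \<notin> G"
  obtain mn u0
    where u0mn: "mn u0" and mn: "\<And>u. mn u \<Longrightarrow> u \<in> L" "\<And>u. mn u \<Longrightarrow> u \<notin> G" "\<And>u. mn u \<Longrightarrow> mn (- u)"
      "\<And>u. mn u \<Longrightarrow> \<exists>j::int. u \<bullet> w = 2 * of_int j"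
    and bound: "\<And>u x j. mn u \<Longrightarrow> x \<in> G \<Longrightarrow> x \<in> L \<Longrightarrow> x \<bullet> w = 2 * of_int j \<Longrightarrow> 2 * \<bar>u \<bullet> x\<bar> \<le> (norm x)\<^sup>2"
    and shift: "\<And>u x j. mn u \<Longrightarrow> x \<in> G \<Longrightarrow> x \<in> L \<Longrightarrow> x \<bullet> w = 2 * of_int j \<Longrightarrow> 2 * (u \<bullet> x) = (norm x)\<^sup>2 \<Longrightarrow> mn (u - x)"
    by (rule minimal_outside[OF G(1) _ v \<open>v \<notin> G\<close>], (rule G(2); assumption), (rule that; assumption))
  have C: "c \<in> G" "c \<in> L" "c \<bullet> w = 2 * of_int 1" if "c \<in> slice 2" for c
    using that sub slice_mem[OF that] by auto
  have not2: "u \<bullet> w \<noteq> 2" if u: "mn u" for u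
  proof
    assume uw: "u \<bullet> w = 2"
    define y where "y = u - (1/3) *\<^sub>R w"
    have y: "w \<bullet> y = 0" using uw w by (simp add: y_def inner_diff_right inner_commute)
    \<comment> \<open>The quartic has the roots -5/3, -2/3, 1/3, 4/3, which are the possible values
      of \<open>u \<bullet> c\<close> minus 2/3. Summed over the slice it becomes a quadratic in
      \<open>y \<bullet> y\<close> that is everywhere positive.\<close>
    have s: "(c \<bullet> y)^4 + 2/3 * (c \<bullet> y)^3 - 7/3 * (c \<bullet> y)^2 - 22/27 * (c \<bullet> y) + 40/81 = 0" if c: "c \<in> slice 2" for c
    proof -
      have 1: "\<bar>u \<bullet> c\<bar> \<le> 2" using bound[OF u C[OF c]] slice_mem[OF c] by simp
      have wc: "w \<bullet> c = 2" using slice_mem[OF c] by (simp add: inner_commute)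
      have "(norm (w - c))\<^sup>2 = 6" unfolding norm2_diff wc using slice_mem[OF c] w by simp
      moreover have "2 * \<bar>u \<bullet> (w - c)\<bar> \<le> (norm (w - c))\<^sup>2"
      proof (rule bound[OF u])
        show "w - c \<in> G" by (intro G wG C c)
        show "w - c \<in> L" by (intro diff_mem w C c)
        show "(w - c) \<bullet> w = 2 * of_int 2" using slice_mem[OF c] w by (simp add: inner_diff_left)
      qed
      ultimately have "\<bar>2 - u \<bullet> c\<bar> \<le> 3" using uw by (simp add: inner_diff_right)
      moreover have "u \<bullet> c \<in> \<int>" by (rule inner_Ints[OF mn(1)[OF u] slice_mem(1)[OF c]])
      ultimately have "u \<bullet> c \<in> {-1, 0, 1, 2}" using Ints_abs_le_2[of "u \<bullet> c"] 1 by auto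
      moreover have "c \<bullet> y = u \<bullet> c - 2/3" using slice_mem[OF c] by (simp add: y_def inner_diff_right inner_commute)
      ultimately show ?thesis by (auto simp: eval_nat_numeral)
    qed
    have "(\<Sum>c\<in>slice 2. (c \<bullet> y)^4 + 2/3 * (c \<bullet> y)^3 - 7/3 * (c \<bullet> y)^2 - 22/27 * (c \<bullet> y) + 40/81) = 0"
      using s by simp
    then have "648 * (y \<bullet> y)\<^sup>2 - 3780 * (y \<bullet> y) + 5520 = 0"
      unfolding sum.distrib sum_subtractf sum_distrib_left[symmetric] slice_2_moments[OF y]
      by (simp add: card_slice_2)
    moreover have "648 * (y \<bullet> y)\<^sup>2 - 3780 * (y \<bullet> y) + 5520 = 648 * (y \<bullet> y - 35/12)\<^sup>2 + 15/2"
      by (simp add: power2_eq_square algebra_simps)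
    ultimately show False using zero_le_power2[of "y \<bullet> y - 35/12"] by linarith
  qed
  have "u0 \<bullet> w = 0"
  proof -
    have "\<bar>u0 \<bullet> w\<bar> \<le> 3" using bound[OF u0mn wG w(1), of 3] w by simp
    moreover obtain j :: int where j: "u0 \<bullet> w = 2 * of_int j" using mn(4)[OF u0mn] by blast
    ultimately have "\<bar>j\<bar> \<le> 1" by linarith
    then have "j = 0 \<or> j = 1 \<or> j = -1" by linarith
    moreover have "j \<noteq> 1" using not2[OF u0mn] j by auto
    moreover have "j \<noteq> -1" using not2[OF mn(3)[OF u0mn]] j by auto
    ultimately show ?thesis using j by auto
  qed
  then have y: "w \<bullet> u0 = 0" by (simp add: inner_commute)
  have small: "(c \<bullet> u0)^4 = (c \<bullet> u0)^2" if c: "c \<in> slice 2" for c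
  proof -
    have ub: "\<bar>u0 \<bullet> c\<bar> \<le> 2" using bound[OF u0mn C[OF c]] slice_mem[OF c] by simp
    have no2: "u \<bullet> c \<noteq> 2" if u: "mn u" "u \<bullet> w = 0" for u
    proof
      assume e: "u \<bullet> c = 2"
      have "mn (- (u - c))" by (rule mn(3), rule shift[OF u(1) C[OF c]]) (use e slice_mem[OF c] in simp)
      moreover have "(- (u - c)) \<bullet> w = 2" using u(2) slice_mem[OF c] by (simp add: inner_diff_left)
      ultimately show False using not2 by blast
    qed
    have "u0 \<bullet> c \<in> \<int>" by (rule inner_Ints[OF mn(1)[OF u0mn] slice_mem(1)[OF c]])
    moreover have "u0 \<bullet> c \<noteq> 2" "u0 \<bullet> c \<noteq> -2"
      using no2[OF u0mn \<open>u0 \<bullet> w = 0\<close>] no2[OF mn(3)[OF u0mn]] \<open>u0 \<bullet> w = 0\<close> by auto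
    ultimately have "u0 \<bullet> c \<in> {-1, 0, 1}" using Ints_abs_le_2[OF _ ub] by auto
    then show ?thesis by (auto simp: inner_commute)
  qed
  have "648 * (u0 \<bullet> u0)\<^sup>2 = 1620 * (u0 \<bullet> u0)"
    unfolding slice_2_moments(2)[OF y, symmetric] slice_2_moments(4)[OF y, symmetric]
    using small by simp
  then have "u0 = 0"
  proof (rule even_norm_eq_0[OF mn(1)[OF u0mn]])
    show "648 * (2 * real k) \<noteq> 1620" for k
    proof
      assume "648 * (2 * real k) = 1620"
      then have "real (4 * k) = real 5" by simp
      then have "4 * k = 5" by (simp only: of_nat_eq_iff)
      then show False by presburger
    qed
  qed simp
  then show False using mn(2)[OF u0mn] G(1) by simp
qed

text \<open>By \<open>slice_3_generates\<close>, y is integral on the sublattice of index 3 on which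
  3 divides the inner product with w; the dual of that sublattice is \<open>L\<close> + Z w/3. Of
  the three cosets, the trivial one gives y in the slice and the second gives the mirror image (2/3)
  w - y. The third is excluded, since y + (2/3) w would have squared length 28/3.\<close>

lemma dual_slice_3:
  assumes int: "\<And>b. b \<in> slice 3 \<Longrightarrow> b \<bullet> y \<in> \<int>" and y: "y \<bullet> w = 2" "(norm y)\<^sup>2 = 4"
  shows "y \<in> slice 2 \<or> (2/3) *\<^sub>R w - y \<in> slice 2"
proof -
  obtain c where c: "c \<in> slice 2" using slices_nonempty by blast
  have gen: "v \<bullet> y \<in> \<int>" if "v \<in> L" "v \<bullet> w = 3 * of_int k" for v k
    using slice_3_generates[of "{x. x \<bullet> y \<in> \<int>}" v k] that int by (auto simp: inner_diff_left)
  have "(3 *\<^sub>R c) \<bullet> y \<in> \<int>"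
    using c slice_mem[OF c] by (intro gen[of _ 2] scale_mem) auto
  then obtain p :: int where p: "3 * (c \<bullet> y) = of_int p" by (auto elim: Ints_cases)
  have y'L: "y + (of_int p / 3) *\<^sub>R w \<in> L"
  proof (rule selfdual)
    fix v assume v: "v \<in> L"
    obtain r :: int where r: "v \<bullet> w = of_int r" using inner_Ints[OF v w(1)] by (auto elim: Ints_cases)
    \<comment> \<open>The vector 2 c has inner product 4 with w, which is 1 modulo 3, so subtracting
      r copies moves v into the sublattice.\<close>
    have "(v - (2 * of_int r) *\<^sub>R c) \<bullet> y \<in> \<int>"
      by (rule gen[of _ "- r"]) (use v c r slice_mem[OF c] in \<open>auto simp: inner_diff_left intro!: diff_mem scale_mem\<close>)
    then have "v \<bullet> y - 2 * of_int r * (c \<bullet> y) + of_int (r * p) \<in> \<int>"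
      by (intro Ints_add) (auto simp: inner_diff_left)
    moreover have "v \<bullet> (y + (of_int p / 3) *\<^sub>R w) = v \<bullet> y - 2 * of_int r * (c \<bullet> y) + of_int (r * p)"
    proof -
      have cy: "c \<bullet> y = of_int p / 3" using p by simp
      show ?thesis unfolding inner_add_right inner_scaleR_right r cy by (simp add: field_simps)
    qed
    ultimately show "v \<bullet> (y + (of_int p / 3) *\<^sub>R w) \<in> \<int>" by simp
  qed
  define q where "q = p mod 3"
  have eq: "y + (of_int q / 3) *\<^sub>R w = (y + (of_int p / 3) *\<^sub>R w) - of_int (p div 3) *\<^sub>R w"
  proof -
    have "real_of_int p = 3 * of_int (p div 3) + of_int q"
      unfolding q_def by (metis mult_div_mod_eq of_int_add of_int_mult of_int_numeral)
    then have "of_int p / 3 = of_int (p div 3) + real_of_int q / 3" by simp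
    then have "(of_int p / 3) *\<^sub>R w = of_int (p div 3) *\<^sub>R w + (of_int q / 3) *\<^sub>R w"
      by (simp only: scaleR_add_left)
    then show ?thesis by simp
  qed
  have L: "y + (of_int q / 3) *\<^sub>R w \<in> L"
    unfolding eq by (intro diff_mem scale_mem y'L w Ints_of_int)
  have "q = 0 \<or> q = 1 \<or> q = 2" unfolding q_def by presburger
  then consider "q = 0" | "q = 1" | "q = 2" by blast
  then show ?thesis
  proof cases
    case 1
    then show ?thesis using L y by (auto intro!: sliceI)
  next
    case 2
    have "w - (y + (1 / 3) *\<^sub>R w) \<in> L" using L w 2 by (intro diff_mem) auto
    moreover have "w - (y + (1 / 3) *\<^sub>R w) = (2/3) *\<^sub>R w - y"
    proof -
      have "(1/3) *\<^sub>R w + (2/3) *\<^sub>R w = w" by (simp flip: scaleR_add_left)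
      then have "(2/3) *\<^sub>R w = w - (1/3) *\<^sub>R w" by (simp only: eq_diff_eq add.commute)
      then show ?thesis by simp
    qed
    ultimately have "(2/3) *\<^sub>R w - y \<in> L" by simp
    moreover have "(norm ((2/3) *\<^sub>R w - y))\<^sup>2 = 4"
      using y by (simp add: norm2_diff power_mult_distrib w inner_commute power_divide)
    moreover have "((2/3) *\<^sub>R w - y) \<bullet> w = 2" using y w by (simp add: inner_diff_left)
    ultimately show ?thesis by (auto intro: sliceI)
  next
    case 3
    have "(norm (y + (2 / 3) *\<^sub>R w))\<^sup>2 = 28/3"
      using y by (simp add: norm2_add power_mult_distrib w power_divide)
    moreover obtain k :: nat where "(norm (y + (2 / 3) *\<^sub>R w))\<^sup>2 = 2 * real k"
      using even_norm_nat[OF L] 3 by auto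
    ultimately have "real (3 * k) = real 14" by simp
    then have "3 * k = 14" by (simp only: of_nat_eq_iff)
    then have False by presburger
    then show ?thesis ..
  qed
qed

text \<open>Here the sublattice has index 2 and its dual is \<open>L\<close> + Z w/2. The nontrivial
  coset is excluded, since y + w/2 would have squared length 17/2; so, unlike in
  \<open>dual_slice_3\<close>, no mirror image appears.\<close>

lemma dual_slice_2:
  assumes int: "\<And>c. c \<in> slice 2 \<Longrightarrow> c \<bullet> y \<in> \<int>" and y: "y \<bullet> w = 3" "(norm y)\<^sup>2 = 4"
  shows "y \<in> slice 3"
proof -
  obtain b where b: "b \<in> slice 3" using slices_nonempty by blast
  have wy: "w \<bullet> y = 3" using y(1) by (simp add: inner_commute)
  have gen: "v \<bullet> y \<in> \<int>" if "v \<in> L" "v \<bullet> w = 2 * of_int k" for v k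
    using slice_2_generates[of "{x. x \<bullet> y \<in> \<int>}" v k] that int wy by (auto simp: inner_diff_left)
  have "(2 *\<^sub>R b) \<bullet> y \<in> \<int>"
    using b slice_mem[OF b] by (intro gen[of _ 3] scale_mem) auto
  then obtain p :: int where p: "2 * (b \<bullet> y) = of_int p" by (auto elim: Ints_cases)
  have y'L: "y + (of_int p / 2) *\<^sub>R w \<in> L"
  proof (rule selfdual)
    fix v assume v: "v \<in> L"
    obtain r :: int where r: "v \<bullet> w = of_int r" using inner_Ints[OF v w(1)] by (auto elim: Ints_cases)
    have "(v - of_int r *\<^sub>R b) \<bullet> y \<in> \<int>"
      by (rule gen[of _ "- r"]) (use v b r slice_mem[OF b] in \<open>auto simp: inner_diff_left intro!: diff_mem scale_mem\<close>)
    then have "v \<bullet> y - of_int r * (b \<bullet> y) + of_int (r * p) \<in> \<int>"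
      by (intro Ints_add) (auto simp: inner_diff_left)
    moreover have "v \<bullet> (y + (of_int p / 2) *\<^sub>R w) = v \<bullet> y - of_int r * (b \<bullet> y) + of_int (r * p)"
    proof -
      have bY: "b \<bullet> y = of_int p / 2" using p by simp
      show ?thesis unfolding inner_add_right inner_scaleR_right r bY by (simp add: field_simps)
    qed
    ultimately show "v \<bullet> (y + (of_int p / 2) *\<^sub>R w) \<in> \<int>" by simp
  qed
  define q where "q = p mod 2"
  have eq: "y + (of_int q / 2) *\<^sub>R w = (y + (of_int p / 2) *\<^sub>R w) - of_int (p div 2) *\<^sub>R w"
  proof -
    have "real_of_int p = 2 * of_int (p div 2) + of_int q"
      unfolding q_def by (metis mult_div_mod_eq of_int_add of_int_mult of_int_numeral)
    then have "of_int p / 2 = of_int (p div 2) + real_of_int q / 2" by simp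
    then have "(of_int p / 2) *\<^sub>R w = of_int (p div 2) *\<^sub>R w + (of_int q / 2) *\<^sub>R w"
      by (simp only: scaleR_add_left)
    then show ?thesis by simp
  qed
  have L: "y + (of_int q / 2) *\<^sub>R w \<in> L"
    unfolding eq by (intro diff_mem scale_mem y'L w Ints_of_int)
  have "q = 0 \<or> q = 1" unfolding q_def by presburger
  then show ?thesis
  proof
    assume "q = 0"
    then show ?thesis using L y by (auto intro!: sliceI)
  next
    assume q: "q = 1"
    have "(norm (y + (1 / 2) *\<^sub>R w))\<^sup>2 = 17/2"
      using y by (simp add: norm2_add power_mult_distrib w power_divide)
    moreover obtain k :: nat where "(norm (y + (1 / 2) *\<^sub>R w))\<^sup>2 = 2 * real k"
      using even_norm_nat[OF L] q by auto
    ultimately have "real (4 * k) = real 17" by simp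
    then have "4 * k = 17" by (simp only: of_nat_eq_iff)
    then have False by presburger
    then show ?thesis ..
  qed
qed

end

section \<open>Hermite interpolation\<close>

lemma iterated_rolle:
  fixes F :: "nat \<Rightarrow> real \<Rightarrow> real" and z :: "nat \<Rightarrow> real"
  assumes "\<And>j t. j < n \<Longrightarrow> t \<in> {lo<..<hi} \<Longrightarrow> (F j has_real_derivative F (Suc j) t) (at t)"
    and "\<And>i. i \<le> n \<Longrightarrow> z i \<in> {lo<..<hi} \<and> F 0 (z i) = 0"
    and "\<And>i. i < n \<Longrightarrow> z i < z (Suc i)"
  shows "\<exists>\<xi>\<in>{lo<..<hi}. F n \<xi> = 0"
  using assms
proof (induction n arbitrary: F z)
  case 0
  then show ?case by (intro bexI[of _ "z 0"]) auto
next
  case (Suc n)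
  have "\<exists>y. z i < y \<and> y < z (Suc i) \<and> F 1 y = 0" if i: "i \<le> n" for i
  proof -
    have I: "{z i..z (Suc i)} \<subseteq> {lo<..<hi}"
      using Suc.prems(2)[of i] Suc.prems(2)[of "Suc i"] i by auto
    have d: "(F 0 has_real_derivative F 1 t) (at t)" if "t \<in> {z i..z (Suc i)}" for t
      using Suc.prems(1)[of 0 t] I that by auto
    have "\<exists>y. z i < y \<and> y < z (Suc i) \<and> (\<lambda>h. h * F 1 y) = (\<lambda>_. 0)"
    proof (rule Rolle_deriv)
      show "z i < z (Suc i)" using Suc.prems(3) i by simp
      show "F 0 (z i) = F 0 (z (Suc i))" using Suc.prems(2) i by simp
      show "continuous_on {z i..z (Suc i)} (F 0)"
        using d DERIV_isCont by (intro continuous_at_imp_continuous_on) blast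
      show "(F 0 has_derivative (\<lambda>h. h * F 1 x)) (at x)" if "z i < x" "x < z (Suc i)" for x
        using d[of x] that by (simp add: has_field_derivative_def mult_commute_abs)
    qed
    then obtain y where "z i < y" "y < z (Suc i)" "(\<lambda>h. h * F 1 y) = (\<lambda>_. 0)" by blast
    moreover from this(3) have "F 1 y = 0" using fun_cong[of _ _ 1] by fastforce
    ultimately show ?thesis by blast
  qed
  then have "\<forall>i. \<exists>y. i \<le> n \<longrightarrow> z i < y \<and> y < z (Suc i) \<and> F 1 y = 0" by blast
  from choice[OF this] obtain y where y: "\<And>i. i \<le> n \<Longrightarrow> z i < y i \<and> y i < z (Suc i) \<and> F 1 (y i) = 0" by blast
  have "\<exists>\<xi>\<in>{lo<..<hi}. F (Suc n) \<xi> = 0"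
  proof (rule Suc.IH[of "\<lambda>j. F (Suc j)" y])
    show "(F (Suc j) has_real_derivative F (Suc (Suc j)) t) (at t)" if "j < n" "t \<in> {lo<..<hi}" for j t
      using Suc.prems(1) that by simp
    show "y i \<in> {lo<..<hi} \<and> F (Suc 0) (y i) = 0" if "i \<le> n" for i
      using y[OF that] Suc.prems(2)[of i] Suc.prems(2)[of "Suc i"] that by auto
    show "y i < y (Suc i)" if "i < n" for i
      using y[of i] y[of "Suc i"] that by auto
  qed
  then show ?case .
qed

lemma rolle_zero:
  fixes G G' :: "real \<Rightarrow> real"
  assumes "a < b" "G a = 0" "G b = 0" "continuous_on {a..b} G"
    and "\<And>x. a < x \<Longrightarrow> x < b \<Longrightarrow> (G has_real_derivative G' x) (at x)"
  obtains y where "a < y" "y < b" "G' y = 0"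
proof -
  have "\<exists>y. a < y \<and> y < b \<and> (\<lambda>h. h * G' y) = (\<lambda>_. 0)"
    by (rule Rolle_deriv) (use assms in \<open>auto simp: has_field_derivative_def mult_commute_abs\<close>)
  then obtain y where "a < y" "y < b" "(\<lambda>h. h * G' y) = (\<lambda>_. 0)" by blast
  moreover from this(3) have "G' y = 0" using fun_cong[of _ _ 1] by fastforce
  ultimately show ?thesis using that by blast
qed

text \<open>Even and odd parts of the interpolant decouple at symmetric nodes: \<open>A\<close> and
  \<open>e\<close> determine \<open>c2\<close> and \<open>c4\<close>, while \<open>B\<close> and
  \<open>D\<close> determine \<open>c3\<close> and \<open>c5\<close>.\<close>

lemma hermite_coeffs:
  fixes a p0 pp pm d0 dp dm :: real
  assumes a: "a > 0"
  obtains c0 c1 c2 c3 c4 c5 where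
    "poly [:c0, c1, c2, c3, c4, c5:] 0 = p0" "poly [:c0, c1, c2, c3, c4, c5:] a = pp" "poly [:c0, c1, c2, c3, c4, c5:] (- a) = pm"
    "poly (pderiv [:c0, c1, c2, c3, c4, c5:]) 0 = d0" "poly (pderiv [:c0, c1, c2, c3, c4, c5:]) a = dp"
    "poly (pderiv [:c0, c1, c2, c3, c4, c5:]) (- a) = dm"
proof -
  define A where "A = (pp + pm) / 2 - p0"
  define e where "e = (dp - dm) / 2"
  define B where "B = (pp - pm) / 2 - d0 * a"
  define D where "D = (dp + dm) / 2 - d0"
  define c2 where "c2 = (2 * A - a * e / 2) / a^2"
  define c4 where "c4 = (a * e / 2 - A) / a^4"
  define c3 where "c3 = (5 * B - a * D) / (2 * a^3)"
  define c5 where "c5 = (a * D - 3 * B) / (2 * a^5)"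
  have 1: "c2 * a^2 + c4 * a^4 = A" using a by (simp add: c2_def c4_def)
  have 2: "2 * c2 * a + 4 * c4 * a^3 = e"
    using a by (simp add: c2_def c4_def field_simps eval_nat_numeral)
  have 3: "c3 * a^3 + c5 * a^5 = B" using a by (simp add: c3_def c5_def field_simps)
  have 4: "3 * c3 * a^2 + 5 * c5 * a^4 = D"
    using a by (simp add: c3_def c5_def field_simps eval_nat_numeral)
  have P: "poly [:p0, d0, c2, c3, c4, c5:] x = p0 + d0 * x + c2 * x^2 + c3 * x^3 + c4 * x^4 + c5 * x^5" for x
    by (simp add: eval_nat_numeral algebra_simps)
  have P': "poly (pderiv [:p0, d0, c2, c3, c4, c5:]) x = d0 + 2 * c2 * x + 3 * c3 * x^2 + 4 * c4 * x^3 + 5 * c5 * x^4" for x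
    by (simp add: pderiv_pCons eval_nat_numeral algebra_simps)
  show ?thesis
  proof (rule that[of p0 d0 c2 c3 c4 c5])
    show "poly [:p0, d0, c2, c3, c4, c5:] 0 = p0" "poly (pderiv [:p0, d0, c2, c3, c4, c5:]) 0 = d0"
      unfolding P P' by simp_all
    have "p0 + d0 * a + c2 * a^2 + c3 * a^3 + c4 * a^4 + c5 * a^5 = pp"
      using 1 3 unfolding A_def B_def by argo
    then show "poly [:p0, d0, c2, c3, c4, c5:] a = pp" unfolding P .
    have "p0 - d0 * a + c2 * a^2 - c3 * a^3 + c4 * a^4 - c5 * a^5 = pm"
      using 1 3 unfolding A_def B_def by argo
    then show "poly [:p0, d0, c2, c3, c4, c5:] (- a) = pm" unfolding P by simp
    have "d0 + 2 * c2 * a + 3 * c3 * a^2 + 4 * c4 * a^3 + 5 * c5 * a^4 = dp"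
      using 2 4 unfolding D_def e_def by argo
    then show "poly (pderiv [:p0, d0, c2, c3, c4, c5:]) a = dp" unfolding P' .
    have "d0 - 2 * c2 * a + 3 * c3 * a^2 - 4 * c4 * a^3 + 5 * c5 * a^4 = dm"
      using 2 4 unfolding D_def e_def by argo
    then show "poly (pderiv [:p0, d0, c2, c3, c4, c5:]) (- a) = dm" unfolding P' by simp
  qed
qed

lemma potential_finite:
  assumes "potential h" "t \<in> {-1..<1}"
  shows "\<bar>h t\<bar> \<noteq> \<infinity>"
  using assms(2) by (rule assms(1)[unfolded potential_def, THEN conjunct2, THEN conjunct1, THEN bspec])

text \<open>The error of Hermite interpolation at three double nodes is a value of the sixth
  derivative times \<open>om\<close> / 720, and \<open>om\<close> is a square vanishing only at the
  nodes. An infinite value of h at 1 satisfies the bound trivially.\<close>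

theorem hermite_lower_bound:
  fixes h :: "real \<Rightarrow> ereal" and a :: real
  assumes h: "potential h" "pos_deriv 6 h" and a: "0 < a" "a < 1"
  obtains c0 c1 c2 c3 c4 c5 where
    "\<And>t. t \<in> {-1..1} \<Longrightarrow> ereal (poly [:c0, c1, c2, c3, c4, c5:] t) \<le> h t"
    "\<And>t. t \<in> {-1..1} \<Longrightarrow> h t = ereal (poly [:c0, c1, c2, c3, c4, c5:] t) \<longleftrightarrow> t \<in> {-a, 0, a}"
proof -
  define f where "f t = real_of_ereal (h t)" for t
  have F: "((deriv ^^ j) f has_real_derivative (deriv ^^ Suc j) f t) (at t)" if "j < 6" "t \<in> {-1<..<1}" for j t
    using h(2) that unfolding pos_deriv_def f_def[abs_def]
    by (simp add: DERIV_deriv_iff_field_differentiable)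
  have F6: "(deriv ^^ 6) f t > 0" if "t \<in> {-1<..<1}" for t
    using h(2) that unfolding pos_deriv_def f_def[abs_def] by blast
  have F0: "(f has_real_derivative deriv f t) (at t)" if "t \<in> {-1<..<1}" for t
    using F[of 0 t] that by simp
  obtain c0 c1 c2 c3 c4 c5 where
    c: "poly [:c0, c1, c2, c3, c4, c5:] 0 = f 0" "poly [:c0, c1, c2, c3, c4, c5:] a = f a" "poly [:c0, c1, c2, c3, c4, c5:] (- a) = f (- a)"
    "poly (pderiv [:c0, c1, c2, c3, c4, c5:]) 0 = deriv f 0" "poly (pderiv [:c0, c1, c2, c3, c4, c5:]) a = deriv f a"
    "poly (pderiv [:c0, c1, c2, c3, c4, c5:]) (- a) = deriv f (- a)"
    by (rule hermite_coeffs[OF a(1)])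
  define H where "H = [:c0, c1, c2, c3, c4, c5:]"
  note c = c[folded H_def]
  define om where "om t = (t * (t\<^sup>2 - a\<^sup>2))\<^sup>2" for t :: real
  have fin: "h t = ereal (f t)" if "t \<in> {-1..1}" "h t \<noteq> \<infinity>" for t
    using potential_not_MInf[OF h(1) that(1)] that(2) unfolding f_def by (cases "h t") auto
  have key: "f t > poly H t" if t: "t \<in> {-1..1}" "h t \<noteq> \<infinity>" "t \<notin> {-a, 0, a}" for t :: real
  proof -
    \<comment> \<open>The endpoint 1 is included only when it is t itself, because h may be infinite
      there. At -1 and 1 only continuity is available, which is all that Rolle's theorem asks for at
      the ends.\<close>
    define S where "S = {-1..<1} \<union> {t}"
    have "\<bar>h s\<bar> \<noteq> \<infinity>" if "s \<in> S" for s
    proof (cases "s = t")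
      case True
      then show ?thesis using fin[OF t(1,2)] by simp
    next
      case False
      then have "s \<in> {-1..<1}" using that by (simp add: S_def)
      then show ?thesis by (rule potential_finite[OF h(1)])
    qed
    moreover have "continuous_on S h"
      by (rule continuous_on_subset[OF h(1)[unfolded potential_def, THEN conjunct1]]) (use t(1) in \<open>auto simp: S_def\<close>)
    ultimately have fcont: "continuous_on S f"
      by (subst (asm) continuous_on_iff_real) (auto simp: f_def[abs_def] o_def)
    have om: "om t > 0"
    proof -
      have "t\<^sup>2 \<noteq> a\<^sup>2" using t(3) by (auto simp: power2_eq_iff)
      then have "t * (t\<^sup>2 - a\<^sup>2) \<noteq> 0" using t(3) by simp
      then show ?thesis unfolding om_def by (simp add: zero_less_power2)
    qed
    \<comment> \<open>The multiple of \<open>om\<close> that makes the error vanish at t as well;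
      its sign is the sign of the error.\<close>
    define l where "l = (f t - poly H t) / om t"
    define P where "P = [:c0, c1, c2 + l * a^4, c3, c4 - 2 * l * a^2, c5, l:]"
    have P: "poly P s = poly H s + l * om s" for s
      by (simp add: P_def H_def om_def power2_eq_square eval_nat_numeral algebra_simps)
    have P': "poly (pderiv P) s = poly (pderiv H) s + l * (2 * (s * (s\<^sup>2 - a\<^sup>2)) * (3 * s\<^sup>2 - a\<^sup>2))" for s
      by (simp add: P_def H_def pderiv_pCons eval_nat_numeral algebra_simps)
    have P6: "poly ((pderiv ^^ 6) P) s = 720 * l" for s
      by (simp add: P_def pderiv_pCons eval_nat_numeral)
    define G where "G j s = (deriv ^^ j) f s - poly ((pderiv ^^ j) P) s" for j s
    have Gd: "(G j has_real_derivative G (Suc j) s) (at s)" if "j < 6" "s \<in> {-1<..<1}" for j s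
      unfolding G_def using F[OF that] by (auto intro!: derivative_intros poly_DERIV)
    have G0: "G 0 s = f s - poly H s - l * om s" for s by (simp add: G_def P)
    have G1: "G 1 s = deriv f s - poly (pderiv H) s - l * (2 * (s * (s\<^sup>2 - a\<^sup>2)) * (3 * s\<^sup>2 - a\<^sup>2))" for s
      by (simp add: G_def P')
    have Gz: "G 0 (-a) = 0" "G 0 0 = 0" "G 0 a = 0" using c by (simp_all add: G0 om_def)
    have Gt: "G 0 t = 0" using om by (simp add: G0 l_def)
    have Gz': "G 1 (-a) = 0" "G 1 0 = 0" "G 1 a = 0" unfolding G1 using c by simp_all
    have Gcont: "continuous_on S (G 0)" unfolding G0[abs_def] om_def by (intro continuous_intros fcont)
    have between: "\<exists>y. u < y \<and> y < v \<and> G 1 y = 0" if "u < v" "G 0 u = 0" "G 0 v = 0" "u \<in> insert t {-a, 0, a}" "v \<in> insert t {-a, 0, a}" for u v :: real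
    proof -
      have uv: "-1 \<le> u" "v \<le> 1" "u < 1" using that a t by auto
      have "{u..v} \<subseteq> S" using that a t uv by (auto simp: S_def)
      then have cont: "continuous_on {u..v} (G 0)" by (rule continuous_on_subset[OF Gcont])
      have d: "(G 0 has_real_derivative G 1 x) (at x)" if "u < x" "x < v" for x
        using Gd[of 0 x] that uv by simp
      show ?thesis by (rule rolle_zero[OF that(1-3) cont d]) blast+
    qed
    \<comment> \<open>The first derivative has three zeros between the four zeros of
      \<open>G 0\<close> and three more at the double nodes; five further uses of Rolle reach the
      sixth derivative.\<close>
    have six: "l > 0" if z: "sorted_wrt (<) zs" "length zs = 6" "\<And>z. z \<in> set zs \<Longrightarrow> -1 < z \<and> z < 1 \<and> G 1 z = 0" for zs
    proof -
      have "\<exists>\<xi>\<in>{-1<..<1}. G (Suc 5) \<xi> = 0"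
      proof (rule iterated_rolle[where F = "\<lambda>j. G (Suc j)" and z = "\<lambda>i. zs ! i"])
        show "(G (Suc j) has_real_derivative G (Suc (Suc j)) t) (at t)" if "j < 5" "t \<in> {-1<..<1}" for j t
          using that by (intro Gd) auto
        show "zs ! i \<in> {-1<..<1} \<and> G (Suc 0) (zs ! i) = 0" if "i \<le> 5" for i
          using z(3)[of "zs ! i"] z(2) that by simp
        show "zs ! i < zs ! Suc i" if "i < 5" for i
          using z(1,2) that by (simp add: sorted_wrt_iff_nth_less)
      qed
      then obtain \<xi> where x: "\<xi> \<in> {-1<..<1}" "G 6 \<xi> = 0" by auto
      then have "720 * l = (deriv ^^ 6) f \<xi>" by (simp add: G_def P6 del: funpow.simps)
      then show ?thesis using F6[OF x(1)] by simp
    qed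
    have "l > 0"
    proof -
      consider "t < -a" | "-a < t" "t < 0" | "0 < t" "t < a" | "a < t" using t(3) by fastforce
      then show ?thesis
      proof cases
        case 1
        obtain y0 y1 y2 where "t < y0" "y0 < -a" "G 1 y0 = 0" "-a < y1" "y1 < 0" "G 1 y1 = 0" "0 < y2" "y2 < a" "G 1 y2 = 0"
          using between[of t "-a"] between[of "-a" 0] between[of 0 a] Gz Gt 1 a by auto
        then show ?thesis using t a Gz' by (intro six[of "[y0, -a, y1, 0, y2, a]"]) auto
      next
        case 2
        obtain y0 y1 y2 where "-a < y0" "y0 < t" "G 1 y0 = 0" "t < y1" "y1 < 0" "G 1 y1 = 0" "0 < y2" "y2 < a" "G 1 y2 = 0"
          using between[of "-a" t] between[of t 0] between[of 0 a] Gz Gt 2 a by auto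
        then show ?thesis using t a Gz' by (intro six[of "[-a, y0, y1, 0, y2, a]"]) auto
      next
        case 3
        obtain y0 y1 y2 where "-a < y0" "y0 < 0" "G 1 y0 = 0" "0 < y1" "y1 < t" "G 1 y1 = 0" "t < y2" "y2 < a" "G 1 y2 = 0"
          using between[of "-a" 0] between[of 0 t] between[of t a] Gz Gt 3 a by auto
        then show ?thesis using t a Gz' by (intro six[of "[-a, y0, 0, y1, y2, a]"]) auto
      next
        case 4
        obtain y0 y1 y2 where "-a < y0" "y0 < 0" "G 1 y0 = 0" "0 < y1" "y1 < a" "G 1 y1 = 0" "a < y2" "y2 < t" "G 1 y2 = 0"
          using between[of "-a" 0] between[of 0 a] between[of a t] Gz Gt 4 a by auto
        then show ?thesis using t a Gz' by (intro six[of "[-a, y0, 0, y1, a, y2]"]) auto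
      qed
    qed
    then have "(f t - poly H t) / om t > 0" by (simp only: l_def)
    then show ?thesis using om by (simp add: zero_less_divide_iff)
  qed
  have node: "h t = ereal (poly H t)" if "t \<in> {-a, 0, a}" for t
  proof -
    have "t \<in> {-1..<1}" using that a by auto
    then have "h t \<noteq> \<infinity>" using potential_finite[OF h(1)] by fastforce
    then have "h t = ereal (f t)" using \<open>t \<in> {-1..<1}\<close> by (intro fin) auto
    moreover have "f t = poly H t" using that c by auto
    ultimately show ?thesis by simp
  qed
  show ?thesis
  proof (rule that[of c0 c1 c2 c3 c4 c5, folded H_def])
    fix t :: real assume t: "t \<in> {-1..1}"
    show "ereal (poly H t) \<le> h t"
    proof (cases "t \<in> {-a, 0, a}")
      case False
      then show ?thesis using key[OF t] fin[OF t] by (cases "h t = \<infinity>") auto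
    qed (use node in simp)
    show "h t = ereal (poly H t) \<longleftrightarrow> t \<in> {-a, 0, a}"
    proof (cases "t \<in> {-a, 0, a}")
      case False
      then have "h t \<noteq> ereal (poly H t)" using key[OF t _ False] fin[OF t] by (cases "h t = \<infinity>") auto
      then show ?thesis using False by blast
    qed (use node in simp)
  qed
qed

section \<open>Polarization of the codes\<close>

abbreviation (input) node :: real where "node \<equiv> sqrt 3 / 5"

lemma node_bounds: "0 < node" "node < 1"
  using real_sqrt_less_mono[of 3 25] by simp_all

lemma node_sqrt: "node = sqrt (3/25)"
  using real_sqrt_divide[of 3 "5\<^sup>2"] by simp

lemma rescale_node:
  assumes "a * node = r" "r > 0" "r * t \<in> {- node, 0, node}"
  shows "a * t \<in> {-1, 0, 1}"
proof -
  obtain e where e: "r * t = e * node" "e \<in> {-1, 0, 1}"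
    using assms(3) by (metis insertE insertI1 insertI2 mult_1 mult_minus1 mult_zero_left singletonD)
  have "r * (a * t) = r * e" unfolding mult.left_commute[of r a] e(1) by (simp only: assms(1)[symmetric] mult_ac)
  then show ?thesis using assms(2) e(2) by simp
qed

lemma node_powers: "node ^ 2 = 3/25" "node ^ 4 = 9/625"
proof -
  show 2: "node ^ 2 = 3/25" by (simp add: power_divide)
  have "node ^ 4 = (node ^ 2) ^ 2" by (simp flip: power_mult)
  then show "node ^ 4 = 9/625" unfolding 2 by (simp add: power_divide)
qed

text \<open>The moments are those of the uniform measure on the unit sphere in dimension 23, namely
  1/23 and 3/(23 * 25) after division by \<open>N\<close>. So the interpolant has the same potential
  \<open>K\<close> at every point, and Gauss quadrature rewrites \<open>K\<close> in terms of the
  values at the nodes. The point \<open>x0\<close> shows that \<open>K\<close> is attained.\<close>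

lemma polarization_of_design:
  fixes Z :: "'a::euclidean_space set" and N :: real
  assumes Z: "finite Z" "Z \<subseteq> sphere 0 1" "N = card Z"
    and m1: "\<And>x. x \<in> sphere 0 1 \<Longrightarrow> (\<Sum>z\<in>Z. x \<bullet> z) = 0"
    and m2: "\<And>x. x \<in> sphere 0 1 \<Longrightarrow> (\<Sum>z\<in>Z. (x \<bullet> z)^2) = N / 23"
    and m3: "\<And>x. x \<in> sphere 0 1 \<Longrightarrow> (\<Sum>z\<in>Z. (x \<bullet> z)^3) = 0"
    and m4: "\<And>x. x \<in> sphere 0 1 \<Longrightarrow> (\<Sum>z\<in>Z. (x \<bullet> z)^4) = 3 * N / 575"
    and m5: "\<And>x. x \<in> sphere 0 1 \<Longrightarrow> (\<Sum>z\<in>Z. (x \<bullet> z)^5) = 0"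
    and x0: "x0 \<in> sphere 0 1" "\<And>z. z \<in> Z \<Longrightarrow> x0 \<bullet> z \<in> {- node, 0, node}"
    and h: "potential h" "pos_deriv 6 h"
  shows "polarization h Z = ereal (25 * N / 138) * h (- node) + ereal (88 * N / 138) * h 0 + ereal (25 * N / 138) * h node"
    and "minimizers h Z = {x \<in> sphere 0 1. \<forall>z\<in>Z. x \<bullet> z \<in> {- node, 0, node}}"
proof -
  obtain c0 c1 c2 c3 c4 c5 where
    le: "\<And>t. t \<in> {-1..1} \<Longrightarrow> ereal (poly [:c0, c1, c2, c3, c4, c5:] t) \<le> h t" and
    eq: "\<And>t. t \<in> {-1..1} \<Longrightarrow> h t = ereal (poly [:c0, c1, c2, c3, c4, c5:] t) \<longleftrightarrow> t \<in> {- node, 0, node}"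
    by (rule hermite_lower_bound[OF h node_bounds]) blast
  define H where "H t = c0 + c1 * t + c2 * t^2 + c3 * t^3 + c4 * t^4 + c5 * t^5" for t :: real
  have "poly [:c0, c1, c2, c3, c4, c5:] t = H t" for t
    by (simp add: H_def eval_nat_numeral algebra_simps)
  note le = le[unfolded this] and eq = eq[unfolded this]
  define K where "K = N * (c0 + c2 / 23 + 3 * c4 / 575)"
  have K: "(\<Sum>z\<in>Z. H (x \<bullet> z)) = K" if "x \<in> sphere 0 1" for x
    unfolding H_def sum.distrib sum_distrib_left[symmetric] m1[OF that] m2[OF that] m3[OF that] m4[OF that] m5[OF that]
    by (simp add: K_def Z(3) algebra_simps)
  have rng: "x \<bullet> z \<in> {-1..1}" if "x \<in> sphere 0 1" "z \<in> Z" for x z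
    using that Z(2) by (intro inner_unit_sphere) auto
  have ge: "ereal K \<le> disc_potential h x Z" if x: "x \<in> sphere 0 1" for x
  proof -
    have "ereal K = (\<Sum>z\<in>Z. ereal (H (x \<bullet> z)))" by (simp add: K[OF x, symmetric])
    also have "\<dots> \<le> disc_potential h x Z"
      unfolding disc_potential_def by (intro sum_mono le rng x)
    finally show ?thesis .
  qed
  have eq_iff: "disc_potential h x Z = ereal K \<longleftrightarrow> (\<forall>z\<in>Z. x \<bullet> z \<in> {- node, 0, node})" if x: "x \<in> sphere 0 1" for x
  proof
    assume "\<forall>z\<in>Z. x \<bullet> z \<in> {- node, 0, node}"
    then have "h (x \<bullet> z) = ereal (H (x \<bullet> z))" if "z \<in> Z" for z
      using eq[OF rng[OF x that]] that by blast
    then have "disc_potential h x Z = (\<Sum>z\<in>Z. ereal (H (x \<bullet> z)))"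
      unfolding disc_potential_def by (intro sum.cong) auto
    then show "disc_potential h x Z = ereal K" by (simp add: K[OF x])
  next
    assume e: "disc_potential h x Z = ereal K"
    show "\<forall>z\<in>Z. x \<bullet> z \<in> {- node, 0, node}"
    proof (rule ballI, rule ccontr)
      fix z assume z: "z \<in> Z" "x \<bullet> z \<notin> {- node, 0, node}"
      define A where "A = (\<Sum>z\<in>Z - {z}. h (x \<bullet> z))"
      have f1: "ereal (H (x \<bullet> z)) < h (x \<bullet> z)"
        using le[OF rng[OF x z(1)]] eq[OF rng[OF x z(1)]] z(2) by (metis order_le_imp_less_or_eq)
      have "(\<Sum>z\<in>Z - {z}. ereal (H (x \<bullet> z))) \<le> A"
        unfolding A_def by (intro sum_mono le rng x) auto
      then have f2: "ereal (\<Sum>z\<in>Z - {z}. H (x \<bullet> z)) \<le> A" by simp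
      have f3: "h (x \<bullet> z) + A = ereal K"
        using sum.remove[OF Z(1) z(1), of "\<lambda>z. h (x \<bullet> z)"] e by (simp add: disc_potential_def A_def)
      have f4: "H (x \<bullet> z) + (\<Sum>z\<in>Z - {z}. H (x \<bullet> z)) = K"
        using sum.remove[OF Z(1) z(1), of "\<lambda>z. H (x \<bullet> z)"] K[OF x] by simp
      show False using f1 f2 f3 f4 by (cases A; cases "h (x \<bullet> z)") auto
    qed
  qed
  have pol: "polarization h Z = ereal K"
    unfolding polarization_def
    by (rule antisym) (use eq_iff[OF x0(1)] x0 ge in \<open>auto intro!: INF_greatest INF_lower2[of x0]\<close>)
  have vals: "h (- node) = ereal (H (- node))" "h 0 = ereal (H 0)" "h node = ereal (H node)"
    using eq[of "- node"] eq[of 0] eq[of node] node_bounds by auto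
  have "K = 25 * N / 138 * H (- node) + 88 * N / 138 * H 0 + 25 * N / 138 * H node"
  proof -
    have "H (- node) + H node = 2 * c0 + 2 * c2 * node^2 + 2 * c4 * node^4" by (simp add: H_def)
    also have "\<dots> = 2 * c0 + 6 * c2 / 25 + 18 * c4 / 625" unfolding node_powers by simp
    finally have s: "H (- node) + H node = 2 * c0 + 6 * c2 / 25 + 18 * c4 / 625" .
    have H0: "H 0 = c0" by (simp add: H_def)
    have "25 * N / 138 * H (- node) + 88 * N / 138 * H 0 + 25 * N / 138 * H node =
        25 * N / 138 * (H (- node) + H node) + 88 * N / 138 * H 0"
      by (simp only: distrib_left)
    then show ?thesis unfolding s H0 K_def by (simp add: field_simps)
  qed
  then show "polarization h Z = ereal (25 * N / 138) * h (- node) + ereal (88 * N / 138) * h 0 + ereal (25 * N / 138) * h node"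
    unfolding pol vals by simp
  show "minimizers h Z = {x \<in> sphere 0 1. \<forall>z\<in>Z. x \<bullet> z \<in> {- node, 0, node}}"
  proof (intro set_eqI iffI)
    fix x assume "x \<in> minimizers h Z"
    then have x: "x \<in> sphere 0 1" "\<not> disc_potential h x0 Z < disc_potential h x Z"
      using x0(1) by (auto simp: minimizers_def is_arg_min_def)
    then have "disc_potential h x Z \<le> ereal K" using eq_iff[OF x0(1)] x0 by (simp add: not_less)
    then have "disc_potential h x Z = ereal K" using ge[OF x(1)] by (rule antisym)
    then show "x \<in> {x \<in> sphere 0 1. \<forall>z\<in>Z. x \<bullet> z \<in> {- node, 0, node}}" using eq_iff[OF x(1)] x(1) by blast
  next
    fix x assume "x \<in> {x \<in> sphere 0 1. \<forall>z\<in>Z. x \<bullet> z \<in> {- node, 0, node}}"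
    then have x: "x \<in> sphere 0 1" "disc_potential h x Z = ereal K" using eq_iff by blast+
    then show "x \<in> minimizers h Z" using ge by (auto simp: minimizers_def is_arg_min_def not_less)
  qed
qed

section \<open>The codes as projections of the slices\<close>

text \<open>\<open>T\<close> identifies the hyperplane orthogonal to w with R^23; isometry is
  required on that hyperplane only.\<close>

locale leech_projection = leech_vector L w for L :: "(real^24) set" and w :: "real^24" +
  fixes T :: "real^24 \<Rightarrow> real^23"
  assumes linear_T: "linear T" and norm_T: "x \<in> (span {w})\<^sup>\<bottom> \<Longrightarrow> norm (T x) = norm x"
begin

lemma perp_iff: "x \<in> (span {w})\<^sup>\<bottom> \<longleftrightarrow> w \<bullet> x = 0"
proof
  assume "x \<in> (span {w})\<^sup>\<bottom>"
  then show "w \<bullet> x = 0" using span_base[of w "{w}"] by (auto simp: orthogonal_comp_def orthogonal_def)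
next
  assume x: "w \<bullet> x = 0"
  show "x \<in> (span {w})\<^sup>\<bottom>"
    by (auto simp: orthogonal_comp_def orthogonal_def span_singleton x)
qed

lemma T_inner:
  assumes "w \<bullet> x = 0" "w \<bullet> y = 0"
  shows "T x \<bullet> T y = x \<bullet> y"
proof -
  have n: "(norm (T z))\<^sup>2 = (norm z)\<^sup>2" if "w \<bullet> z = 0" for z
    using norm_T[of z] perp_iff that by simp
  have "(norm (T (x + y)))\<^sup>2 = (norm (x + y))\<^sup>2" using assms by (intro n) (simp add: inner_add_right)
  then show ?thesis
    using n[OF assms(1)] n[OF assms(2)] by (simp add: linear_add[OF linear_T] norm2_add)
qed

lemma T_inj: "w \<bullet> x = 0 \<Longrightarrow> w \<bullet> y = 0 \<Longrightarrow> T x = T y \<Longrightarrow> x = y"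
proof -
  assume a: "w \<bullet> x = 0" "w \<bullet> y = 0" "T x = T y"
  have "norm (T (x - y)) = norm (x - y)" using a by (intro norm_T) (simp add: perp_iff inner_diff_right)
  then show ?thesis using a(3) by (simp add: linear_diff[OF linear_T])
qed

lemma T_surj: obtains y where "w \<bullet> y = 0" "T y = v"
proof -
  define S where "S = {x. w \<bullet> x = 0}"
  have S: "subspace S" unfolding S_def by (rule subspace_hyperplane)
  have "w \<noteq> 0" using w by auto
  then have "dim S = 23" unfolding S_def using dim_hyperplane[of w] by simp
  moreover have "dim (T ` S) = dim S"
  proof (rule dim_image_eq[OF linear_T])
    show "inj_on T (span S)"
      unfolding span_eq_iff[THEN iffD2, OF S] by (rule inj_onI) (auto simp: S_def intro: T_inj)
  qed
  ultimately have "dim (T ` S) = DIM(real^23)" by simp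
  then have "span (T ` S) = UNIV" by (simp only: dim_eq_full)
  then have "T ` S = UNIV" using linear_subspace_image[OF linear_T S] by (simp add: span_eq_iff[THEN iffD2])
  then obtain y where "y \<in> S" "T y = v" by (metis UNIV_I imageE)
  then show ?thesis using that by (simp add: S_def)
qed

lemma normalized_proj_span:
  "normalized_proj (span {w}) x = (x - ((x \<bullet> w) / 6) *\<^sub>R w) /\<^sub>R norm (x - ((x \<bullet> w) / 6) *\<^sub>R w)"
proof -
  have "orth_proj (span {w}) x = ((x \<bullet> w) / 6) *\<^sub>R w"
    unfolding orth_proj_def
  proof (rule the1_equality[OF orth_proj_unique_ex[OF subspace_span]])
    show "((x \<bullet> w) / 6) *\<^sub>R w \<in> span {w} \<and> x - ((x \<bullet> w) / 6) *\<^sub>R w \<in> (span {w})\<^sup>\<bottom>"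
    proof
      show "((x \<bullet> w) / 6) *\<^sub>R w \<in> span {w}" by (rule span_scale[OF span_base]) simp
      show "x - ((x \<bullet> w) / 6) *\<^sub>R w \<in> (span {w})\<^sup>\<bottom>"
        unfolding perp_iff using w by (simp add: inner_diff_right inner_commute[of w x])
    qed
  qed
  then show ?thesis by (simp add: normalized_proj_def)
qed

text \<open>Closed forms of the normalized projections: b - w/2 and c - w/3 have squared lengths 5/2
  and 10/3.\<close>

definition pb :: "real^24 \<Rightarrow> real^24" where "pb b = sqrt (2/5) *\<^sub>R (b - (1/2) *\<^sub>R w)"
definition pc :: "real^24 \<Rightarrow> real^24" where "pc c = sqrt (3/10) *\<^sub>R (c - (1/3) *\<^sub>R w)"

lemma norm2_sub_scale_w: "(norm (x - r *\<^sub>R w))\<^sup>2 = (norm x)\<^sup>2 - 2 * r * (x \<bullet> w) + 6 * r\<^sup>2"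
  using w by (simp add: norm2_diff power_mult_distrib)

lemma normalized_proj_slice_3: "b \<in> slice 3 \<Longrightarrow> normalized_proj (span {w}) b = pb b"
proof -
  assume b: "b \<in> slice 3"
  have "(norm (b - (1/2) *\<^sub>R w))\<^sup>2 = 5/2"
    unfolding norm2_sub_scale_w using slice_mem[OF b] by (simp add: power2_eq_square)
  then have n: "norm (b - (1/2) *\<^sub>R w) = sqrt (5/2)" by (metis norm_ge_zero real_sqrt_unique)
  have "inverse (sqrt (5/2)) = sqrt (2/5)" by (simp add: real_sqrt_divide real_sqrt_inverse[symmetric])
  then show ?thesis unfolding normalized_proj_span pb_def slice_mem(3)[OF b] by (simp add: n)
qed

lemma normalized_proj_slice_2:
  assumes c: "c \<in> slice 2"
  shows "normalized_proj (span {w}) c = pc c" "normalized_proj (span {w}) (w - c) = - pc c"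
proof -
  have "(norm (c - (1/3) *\<^sub>R w))\<^sup>2 = 10/3"
    unfolding norm2_sub_scale_w using slice_mem[OF c] by (simp add: power2_eq_square)
  then have n: "norm (c - (1/3) *\<^sub>R w) = sqrt (10/3)" by (metis norm_ge_zero real_sqrt_unique)
  have i: "inverse (sqrt (10/3)) = sqrt (3/10)" by (simp add: real_sqrt_divide real_sqrt_inverse[symmetric])
  show "normalized_proj (span {w}) c = pc c"
    unfolding normalized_proj_span pc_def slice_mem(3)[OF c] by (simp add: n i)
  have "(w - c) \<bullet> w = 4" using slice_mem[OF c] w by (simp add: inner_diff_left)
  \<comment> \<open>Removing the component (2/3) w from w - c leaves the negative of the projection
    of c, so the reflected slice yields the antipodal code.\<close>
  then have e: "(w - c) - (((w - c) \<bullet> w) / 6) *\<^sub>R w = - (c - (1/3) *\<^sub>R w)"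
    by (simp add: vec_eq_iff)
  show "normalized_proj (span {w}) (w - c) = - pc c"
    unfolding normalized_proj_span e pc_def norm_minus_cancel n i by (rule scaleR_minus_right)
qed

definition C552 :: "(real^23) set" where "C552 = (\<lambda>b. T (pb b)) ` slice 3"
definition C11178 :: "(real^23) set" where "C11178 = (\<lambda>c. T (pc c)) ` slice 2"
definition C22356 :: "(real^23) set" where "C22356 = C11178 \<union> uminus ` C11178"

lemma perp_pb: "b \<in> slice 3 \<Longrightarrow> w \<bullet> pb b = 0"
  using slice_mem[of b 3] w by (simp add: pb_def inner_diff_right inner_commute[of w b])

lemma perp_pc: "c \<in> slice 2 \<Longrightarrow> w \<bullet> pc c = 0"
  using slice_mem[of c 2] w by (simp add: pc_def inner_diff_right inner_commute[of w c])

lemma inner_pb: "w \<bullet> y = 0 \<Longrightarrow> b \<in> slice 3 \<Longrightarrow> T y \<bullet> T (pb b) = sqrt (2/5) * (b \<bullet> y)"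
  by (subst T_inner) (simp_all add: perp_pb, simp add: pb_def inner_diff_right inner_commute[of y])

lemma inner_pc: "w \<bullet> y = 0 \<Longrightarrow> c \<in> slice 2 \<Longrightarrow> T y \<bullet> T (pc c) = sqrt (3/10) * (c \<bullet> y)"
  by (subst T_inner) (simp_all add: perp_pc, simp add: pc_def inner_diff_right inner_commute[of y])

lemma inj_T_pb: "inj_on (\<lambda>b. T (pb b)) (slice 3)"
proof (rule inj_onI)
  fix b b' assume b: "b \<in> slice 3" "b' \<in> slice 3" "T (pb b) = T (pb b')"
  then have "pb b = pb b'" by (intro T_inj perp_pb)
  then show "b = b'" by (simp add: pb_def)
qed

lemma inj_T_pc: "inj_on (\<lambda>c. T (pc c)) (slice 2)"
proof (rule inj_onI)
  fix c c' assume c: "c \<in> slice 2" "c' \<in> slice 2" "T (pc c) = T (pc c')"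
  then have "pc c = pc c'" by (intro T_inj perp_pc)
  then show "c = c'" by (simp add: pc_def)
qed

lemma finite_codes: "finite C552" "finite C11178" "finite C22356"
  unfolding C552_def C11178_def C22356_def using finite_slice by auto

lemma card_C552: "card C552 = 552" and card_C11178: "card C11178 = 11178"
  unfolding C552_def C11178_def card_image[OF inj_T_pb] card_image[OF inj_T_pc]
  by (rule card_slice_3 card_slice_2)+

text \<open>A common point would give c + c' = (2/3) w, a nonzero lattice vector of squared length
  8/3 < 4.\<close>

lemma C11178_antipodal_disjoint: "C11178 \<inter> uminus ` C11178 = {}"
proof (rule ccontr)
  assume "C11178 \<inter> uminus ` C11178 \<noteq> {}"
  then obtain c c' where c: "c \<in> slice 2" "c' \<in> slice 2" "T (pc c) = - T (pc c')"
    unfolding C11178_def by auto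
  then have "T (pc c) = T (- pc c')" by (simp add: linear_neg[OF linear_T])
  then have "pc c = - pc c'" using c by (intro T_inj perp_pc) (auto simp: perp_pc)
  then have "sqrt (3/10) *\<^sub>R (c - (1/3) *\<^sub>R w) = sqrt (3/10) *\<^sub>R (- (c' - (1/3) *\<^sub>R w))"
    unfolding pc_def scaleR_minus_right .
  then have "c - (1/3) *\<^sub>R w = - (c' - (1/3) *\<^sub>R w)" by (subst (asm) scaleR_cancel_left) simp
  then have "c + c' = (1/3) *\<^sub>R w + (1/3) *\<^sub>R w" by (simp add: algebra_simps)
  then have e: "c + c' = (2/3) *\<^sub>R w" by (simp flip: scaleR_add_left)
  then have "(norm (c + c'))\<^sup>2 = (2/3)\<^sup>2 * 6" using w by (simp add: power_mult_distrib power_divide)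
  moreover have "c + c' \<noteq> 0" unfolding e using w by auto
  then have "(norm (c + c'))\<^sup>2 \<ge> 4" using slice_mem[OF c(1)] slice_mem[OF c(2)] by (intro norm2_ge_4 add_mem)
  ultimately show False by (simp add: power_divide)
qed

lemma sum_C22356: "sum f C22356 = sum f C11178 + (\<Sum>z\<in>C11178. f (- z))" for f :: "real^23 \<Rightarrow> real"
  unfolding C22356_def
  by (subst sum.union_disjoint) (use finite_codes C11178_antipodal_disjoint in \<open>auto simp: sum.reindex\<close>)

lemma card_C22356: "card C22356 = 22356"
  unfolding C22356_def
  by (subst card_Un_disjoint) (use finite_codes C11178_antipodal_disjoint in \<open>auto simp: card_image card_C11178\<close>)

lemma codes_sphere: "C552 \<subseteq> sphere 0 1" "C11178 \<subseteq> sphere 0 1" "C22356 \<subseteq> sphere 0 1"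
proof -
  have n: "norm (T y) = 1" if "w \<bullet> y = 0" "y \<bullet> y = 1" for y
    using norm_T[of y] that by (simp add: perp_iff norm_eq_1)
  show 1: "C552 \<subseteq> sphere 0 1"
  proof -
    have "pb b \<bullet> pb b = 1" if b: "b \<in> slice 3" for b
    proof -
      have "(norm (pb b))\<^sup>2 = 2/5 * (norm (b - (1/2) *\<^sub>R w))\<^sup>2" by (simp add: pb_def power_mult_distrib)
      then show ?thesis unfolding norm2_sub_scale_w using slice_mem[OF b] by (simp add: power2_norm_eq_inner power_divide)
    qed
    then show ?thesis unfolding C552_def using n perp_pb by auto
  qed
  show 2: "C11178 \<subseteq> sphere 0 1"
  proof -
    have "pc c \<bullet> pc c = 1" if c: "c \<in> slice 2" for c
    proof -
      have "(norm (pc c))\<^sup>2 = 3/10 * (norm (c - (1/3) *\<^sub>R w))\<^sup>2" by (simp add: pc_def power_mult_distrib)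
      then show ?thesis unfolding norm2_sub_scale_w using slice_mem[OF c] by (simp add: power2_norm_eq_inner power_divide)
    qed
    then show ?thesis unfolding C11178_def using n perp_pc by auto
  qed
  show "C22356 \<subseteq> sphere 0 1" using 2 by (auto simp: C22356_def)
qed

text \<open>The upper bound 2 expresses that b - c is not shorter than a minimal vector; applied to
  the mirror image w - b it becomes the lower bound 0.\<close>

lemma inner_slices:
  assumes b: "b \<in> slice 3" and c: "c \<in> slice 2"
  shows "b \<bullet> c \<in> {0, 1, 2}"
proof -
  have le: "b \<bullet> c \<le> 2" if b: "b \<in> slice 3" for b
  proof -
    have "b \<noteq> c" using slice_mem(3)[OF b] slice_mem(3)[OF c] by auto
    then have "(norm (b - c))\<^sup>2 \<ge> 4" using slice_mem[OF b] slice_mem[OF c] by (intro norm2_ge_4 diff_mem) auto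
    then show ?thesis unfolding norm2_diff using slice_mem[OF b] slice_mem[OF c] by simp
  qed
  have "w \<bullet> c = 2" using slice_mem(3)[OF c] by (simp add: inner_commute)
  then have "2 - b \<bullet> c \<le> 2" using le[OF reflect_slice_3[OF b]] by (simp add: inner_diff_left)
  then have "\<bar>b \<bullet> c\<bar> \<le> 2" "b \<bullet> c \<ge> 0" using le[OF b] by auto
  moreover have "b \<bullet> c \<in> \<int>" using slice_mem[OF b] slice_mem[OF c] by (intro inner_Ints)
  ultimately show ?thesis using Ints_abs_le_2[of "b \<bullet> c"] by auto
qed

lemma unit_preimage:
  assumes "v \<in> sphere 0 1"
  obtains y where "w \<bullet> y = 0" "T y = v" "y \<bullet> y = 1"
proof -
  obtain y where y: "w \<bullet> y = 0" "T y = v" by (rule T_surj)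
  then have "norm y = 1" using norm_T[of y] assms by (simp add: perp_iff)
  then show ?thesis using that y by (simp add: norm_eq_1)
qed

lemma moments_C552:
  assumes v: "v \<in> sphere 0 1"
  shows "(\<Sum>z\<in>C552. v \<bullet> z) = 0" "(\<Sum>z\<in>C552. (v \<bullet> z)^2) = 552 / 23" "(\<Sum>z\<in>C552. (v \<bullet> z)^3) = 0"
    "(\<Sum>z\<in>C552. (v \<bullet> z)^4) = 3 * 552 / 575" "(\<Sum>z\<in>C552. (v \<bullet> z)^5) = 0"
proof -
  obtain y where y: "w \<bullet> y = 0" "T y = v" "y \<bullet> y = 1" using v by (rule unit_preimage)
  have s: "(\<Sum>z\<in>C552. (v \<bullet> z)^k) = sqrt (2/5) ^ k * (\<Sum>b\<in>slice 3. (b \<bullet> y)^k)" for k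
    unfolding C552_def sum.reindex[OF inj_T_pb] sum_distrib_left o_def
    by (intro sum.cong refl) (simp only: inner_pb[OF y(1)] y(2)[symmetric] power_mult_distrib)
  have r: "sqrt (2/5) ^ 2 = 2/5" "sqrt (2/5) ^ 4 = 4/25"
    using power_mult[of "sqrt (2/5)" 2 2] by (simp_all add: power_divide)
  show "(\<Sum>z\<in>C552. v \<bullet> z) = 0" using s[of 1] slice_3_moments(1)[OF y(1)] by simp
  show "(\<Sum>z\<in>C552. (v \<bullet> z)^2) = 552 / 23" unfolding s slice_3_moments(2)[OF y(1)] r y(3) by simp
  show "(\<Sum>z\<in>C552. (v \<bullet> z)^3) = 0" unfolding s slice_3_moments(3)[OF y(1)] by simp
  show "(\<Sum>z\<in>C552. (v \<bullet> z)^4) = 3 * 552 / 575" unfolding s slice_3_moments(4)[OF y(1)] r y(3) by simp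
  show "(\<Sum>z\<in>C552. (v \<bullet> z)^5) = 0" unfolding s slice_3_moments(5)[OF y(1)] by simp
qed

lemma moments_C11178:
  assumes v: "v \<in> sphere 0 1"
  shows "(\<Sum>z\<in>C11178. v \<bullet> z) = 0" "(\<Sum>z\<in>C11178. (v \<bullet> z)^2) = 11178 / 23" "(\<Sum>z\<in>C11178. (v \<bullet> z)^3) = 0"
    "(\<Sum>z\<in>C11178. (v \<bullet> z)^4) = 3 * 11178 / 575" "(\<Sum>z\<in>C11178. (v \<bullet> z)^5) = 0"
proof -
  obtain y where y: "w \<bullet> y = 0" "T y = v" "y \<bullet> y = 1" using v by (rule unit_preimage)
  have s: "(\<Sum>z\<in>C11178. (v \<bullet> z)^k) = sqrt (3/10) ^ k * (\<Sum>c\<in>slice 2. (c \<bullet> y)^k)" for k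
    unfolding C11178_def sum.reindex[OF inj_T_pc] sum_distrib_left o_def
    by (intro sum.cong refl) (simp only: inner_pc[OF y(1)] y(2)[symmetric] power_mult_distrib)
  have r: "sqrt (3/10) ^ 2 = 3/10" "sqrt (3/10) ^ 4 = 9/100"
    using power_mult[of "sqrt (3/10)" 2 2] by (simp_all add: power_divide)
  show "(\<Sum>z\<in>C11178. v \<bullet> z) = 0" using s[of 1] slice_2_moments(1)[OF y(1)] by simp
  show "(\<Sum>z\<in>C11178. (v \<bullet> z)^2) = 11178 / 23" unfolding s slice_2_moments(2)[OF y(1)] r y(3) by simp
  show "(\<Sum>z\<in>C11178. (v \<bullet> z)^3) = 0" unfolding s slice_2_moments(3)[OF y(1)] by simp
  show "(\<Sum>z\<in>C11178. (v \<bullet> z)^4) = 3 * 11178 / 575" unfolding s slice_2_moments(4)[OF y(1)] r y(3) by simp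
  show "(\<Sum>z\<in>C11178. (v \<bullet> z)^5) = 0" unfolding s slice_2_moments(5)[OF y(1)] by simp
qed

lemma inner_codes:
  assumes "b \<in> slice 3" "c \<in> slice 2"
  shows "T (pb b) \<bullet> T (pc c) \<in> {- node, 0, node}"
proof -
  have wc: "w \<bullet> c = 2" using slice_mem(3)[OF assms(2)] by (simp only: inner_commute)
  have "pb b \<bullet> pc c = sqrt (2/5) * sqrt (3/10) * ((b - (1/2) *\<^sub>R w) \<bullet> (c - (1/3) *\<^sub>R w))"
    by (simp add: pb_def pc_def)
  also have "(b - (1/2) *\<^sub>R w) \<bullet> (c - (1/3) *\<^sub>R w) = b \<bullet> c - 1"
    using slice_mem(3)[OF assms(1)] wc w by (simp add: inner_diff_left inner_diff_right)
  also have "sqrt (2/5) * sqrt (3/10) = node" unfolding node_sqrt by (simp flip: real_sqrt_mult)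
  finally have "T (pb b) \<bullet> T (pc c) = node * (b \<bullet> c - 1)"
    unfolding T_inner[OF perp_pb[OF assms(1)] perp_pc[OF assms(2)]] .
  moreover have "b \<bullet> c - 1 \<in> {- 1, 0, 1}" using inner_slices[OF assms] by auto
  ultimately show ?thesis by auto
qed

lemma inner_C552_C22356:
  assumes "x \<in> C552" "z \<in> C22356"
  shows "x \<bullet> z \<in> {- node, 0, node}"
proof -
  obtain b c where "b \<in> slice 3" "c \<in> slice 2" "x = T (pb b)" "z = T (pc c) \<or> z = - T (pc c)"
    using assms unfolding C552_def C22356_def C11178_def by blast
  then show ?thesis using inner_codes[of b c] by auto
qed

lemma scaled_node: "sqrt (5/2) * node = sqrt (3/10)" "sqrt (10/3) * node = sqrt (2/5)"
  unfolding node_sqrt by (simp_all flip: real_sqrt_mult)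

text \<open>A point meeting the code only in the nodes lifts to a vector \<open>Y\<close> of squared
  length 4, with inner product 3 with w and integral inner products with the slice;
  \<open>dual_slice_2\<close> then places \<open>Y\<close> in the other slice.\<close>

lemma node_set_C11178: "{x \<in> sphere 0 1. \<forall>z\<in>C11178. x \<bullet> z \<in> {- node, 0, node}} = C552"
proof (intro equalityI subsetI)
  fix x assume "x \<in> C552"
  then show "x \<in> {x \<in> sphere 0 1. \<forall>z\<in>C11178. x \<bullet> z \<in> {- node, 0, node}}"
    using codes_sphere(1) inner_C552_C22356[of x] unfolding C22356_def by blast
next
  fix x assume "x \<in> {x \<in> sphere 0 1. \<forall>z\<in>C11178. x \<bullet> z \<in> {- node, 0, node}}"
  then have x: "x \<in> sphere 0 1" "\<And>z. z \<in> C11178 \<Longrightarrow> x \<bullet> z \<in> {- node, 0, node}" by blast+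
  obtain y where y: "w \<bullet> y = 0" "T y = x" "y \<bullet> y = 1" using x(1) by (rule unit_preimage)
  have yw: "y \<bullet> w = 0" using y(1) by (simp only: inner_commute)
  define Y where "Y = (1/2) *\<^sub>R w + sqrt (5/2) *\<^sub>R y"
  have n: "(norm Y)\<^sup>2 = 4"
  proof -
    have "(norm Y)\<^sup>2 = (norm ((1/2) *\<^sub>R w))\<^sup>2 + (norm (sqrt (5/2) *\<^sub>R y))\<^sup>2"
      unfolding Y_def norm2_add using y(1) by simp
    also have "\<dots> = 4" using w y(3) by (simp add: power_mult_distrib power2_norm_eq_inner power_divide)
    finally show ?thesis .
  qed
  have "Y \<in> slice 3"
  proof (rule dual_slice_2[OF _ _ n])
    show "Y \<bullet> w = 3" unfolding Y_def using w yw by (simp add: inner_add_left)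
    fix c assume c: "c \<in> slice 2"
    have "sqrt (3/10) * (c \<bullet> y) \<in> {- node, 0, node}"
      using x(2)[of "T (pc c)"] c inner_pc[OF y(1) c] unfolding y(2) C11178_def by auto
    then have "sqrt (5/2) * (c \<bullet> y) \<in> {-1, 0, 1}"
      by (rule rescale_node[rotated 2]) (simp_all only: scaled_node, simp)
    moreover have "c \<bullet> Y = 1 + sqrt (5/2) * (c \<bullet> y)"
      unfolding Y_def using slice_mem(3)[OF c] by (simp add: inner_add_right)
    ultimately show "c \<bullet> Y \<in> \<int>" by auto
  qed
  moreover have "pb Y = y"
  proof -
    have "pb Y = (sqrt (2/5) * sqrt (5/2)) *\<^sub>R y" by (simp add: pb_def Y_def)
    also have "sqrt (2/5) * sqrt (5/2) = 1" by (simp flip: real_sqrt_mult)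
    finally show ?thesis by simp
  qed
  ultimately show "x \<in> C552" unfolding C552_def y(2)[symmetric] by (metis imageI)
qed

lemma node_set_C22356: "{x \<in> sphere 0 1. \<forall>z\<in>C22356. x \<bullet> z \<in> {- node, 0, node}} = C552"
  unfolding node_set_C11178[symmetric] by (fastforce simp: C22356_def)

text \<open>The two admissible cosets in \<open>dual_slice_3\<close> account for
  \<open>C11178\<close> and its antipodal copy. This is why the partner of \<open>C552\<close> is
  \<open>C22356\<close>.\<close>

lemma node_set_C552: "{x \<in> sphere 0 1. \<forall>z\<in>C552. x \<bullet> z \<in> {- node, 0, node}} = C22356"
proof (intro equalityI subsetI)
  fix x assume x: "x \<in> C22356"
  have "x \<bullet> z \<in> {- node, 0, node}" if "z \<in> C552" for z
    using inner_C552_C22356[OF that x] by (subst inner_commute)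
  then show "x \<in> {x \<in> sphere 0 1. \<forall>z\<in>C552. x \<bullet> z \<in> {- node, 0, node}}"
    using codes_sphere(3) x by blast
next
  fix x assume "x \<in> {x \<in> sphere 0 1. \<forall>z\<in>C552. x \<bullet> z \<in> {- node, 0, node}}"
  then have x: "x \<in> sphere 0 1" "\<And>z. z \<in> C552 \<Longrightarrow> x \<bullet> z \<in> {- node, 0, node}" by blast+
  obtain y where y: "w \<bullet> y = 0" "T y = x" "y \<bullet> y = 1" using x(1) by (rule unit_preimage)
  have yw: "y \<bullet> w = 0" using y(1) by (simp only: inner_commute)
  define Y where "Y = (1/3) *\<^sub>R w + sqrt (10/3) *\<^sub>R y"
  have n: "(norm Y)\<^sup>2 = 4"
  proof -
    have "(norm Y)\<^sup>2 = (norm ((1/3) *\<^sub>R w))\<^sup>2 + (norm (sqrt (10/3) *\<^sub>R y))\<^sup>2"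
      unfolding Y_def norm2_add using y(1) by simp
    also have "\<dots> = 4" using w y(3) by (simp add: power_mult_distrib power2_norm_eq_inner power_divide)
    finally show ?thesis .
  qed
  have "Y \<in> slice 2 \<or> (2/3) *\<^sub>R w - Y \<in> slice 2"
  proof (rule dual_slice_3[OF _ _ n])
    show "Y \<bullet> w = 2" unfolding Y_def using w yw by (simp add: inner_add_left)
    fix b assume b: "b \<in> slice 3"
    have "sqrt (2/5) * (b \<bullet> y) \<in> {- node, 0, node}"
      using x(2)[of "T (pb b)"] b inner_pb[OF y(1) b] unfolding y(2) C552_def by auto
    then have "sqrt (10/3) * (b \<bullet> y) \<in> {-1, 0, 1}"
      by (rule rescale_node[rotated 2]) (simp_all only: scaled_node, simp)
    moreover have "b \<bullet> Y = 1 + sqrt (10/3) * (b \<bullet> y)"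
      unfolding Y_def using slice_mem(3)[OF b] by (simp add: inner_add_right)
    ultimately show "b \<bullet> Y \<in> \<int>" by auto
  qed
  moreover have r: "sqrt (3/10) * sqrt (10/3) = 1" by (simp flip: real_sqrt_mult)
  have "pc Y = (sqrt (3/10) * sqrt (10/3)) *\<^sub>R y" by (simp add: pc_def Y_def)
  then have "pc Y = y" unfolding r by simp
  moreover have "pc ((2/3) *\<^sub>R w - Y) = - y"
  proof -
    have "((2/3) *\<^sub>R w - Y) - (1/3) *\<^sub>R w = - (sqrt (10/3) *\<^sub>R y)" by (simp add: Y_def vec_eq_iff)
    then have "pc ((2/3) *\<^sub>R w - Y) = - ((sqrt (3/10) * sqrt (10/3)) *\<^sub>R y)" by (simp add: pc_def)
    then show ?thesis unfolding r by simp
  qed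
  ultimately have "x \<in> C11178 \<or> - x \<in> C11178"
    unfolding C11178_def y(2)[symmetric] linear_neg[OF linear_T, symmetric] by (metis imageI)
  then show "x \<in> C22356" unfolding C22356_def by (metis UnI1 UnI2 add.inverse_inverse imageI)
qed

section \<open>Values and minimizers for the three codes\<close>

lemma codes_nonempty: "\<exists>x0. x0 \<in> C552" "\<exists>x0. x0 \<in> C11178"
  using slices_nonempty unfolding C552_def C11178_def by blast+

lemma optimality_C552:
  assumes h: "potential h" "pos_deriv 6 h"
  shows "polarization h C552 = 100 * h (- node) + 352 * h 0 + 100 * h node" "minimizers h C552 = C22356"
proof -
  obtain x0 where "x0 \<in> C11178" using codes_nonempty by blast
  then have "x0 \<in> {x \<in> sphere 0 1. \<forall>z\<in>C552. x \<bullet> z \<in> {- node, 0, node}}"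
    unfolding node_set_C552 by (simp add: C22356_def)
  then have x0: "x0 \<in> sphere 0 1" "\<And>z. z \<in> C552 \<Longrightarrow> x0 \<bullet> z \<in> {- node, 0, node}" by blast+
  have N: "552 = real (card C552)" by (simp add: card_C552)
  note d = polarization_of_design[OF finite_codes(1) codes_sphere(1) N moments_C552 x0 h]
  show "polarization h C552 = 100 * h (- node) + 352 * h 0 + 100 * h node" using d(1) by simp
  show "minimizers h C552 = C22356" using d(2) unfolding node_set_C552 .
qed

lemma optimality_C11178:
  assumes h: "potential h" "pos_deriv 6 h"
  shows "polarization h C11178 = 2025 * h (- node) + 7128 * h 0 + 2025 * h node" "minimizers h C11178 = C552"
proof -
  obtain x0 where "x0 \<in> C552" using codes_nonempty by blast
  then have "x0 \<in> {x \<in> sphere 0 1. \<forall>z\<in>C11178. x \<bullet> z \<in> {- node, 0, node}}"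
    unfolding node_set_C11178 .
  then have x0: "x0 \<in> sphere 0 1" "\<And>z. z \<in> C11178 \<Longrightarrow> x0 \<bullet> z \<in> {- node, 0, node}" by blast+
  have N: "11178 = real (card C11178)" by (simp add: card_C11178)
  note d = polarization_of_design[OF finite_codes(2) codes_sphere(2) N moments_C11178 x0 h]
  show "polarization h C11178 = 2025 * h (- node) + 7128 * h 0 + 2025 * h node" using d(1) by simp
  show "minimizers h C11178 = C552" using d(2) unfolding node_set_C11178 .
qed

lemma moments_C22356:
  assumes v: "v \<in> sphere 0 1"
  shows "(\<Sum>z\<in>C22356. v \<bullet> z) = 0" "(\<Sum>z\<in>C22356. (v \<bullet> z)^2) = 22356 / 23" "(\<Sum>z\<in>C22356. (v \<bullet> z)^3) = 0"
    "(\<Sum>z\<in>C22356. (v \<bullet> z)^4) = 3 * 22356 / 575" "(\<Sum>z\<in>C22356. (v \<bullet> z)^5) = 0"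
  unfolding sum_C22356 inner_minus_right using moments_C11178[OF v]
  by (simp_all add: sum_negf)

lemma optimality_C22356:
  assumes h: "potential h" "pos_deriv 6 h"
  shows "polarization h C22356 = 4050 * h (- node) + 14256 * h 0 + 4050 * h node" "minimizers h C22356 = C552"
proof -
  obtain x0 where "x0 \<in> C552" using codes_nonempty by blast
  then have "x0 \<in> {x \<in> sphere 0 1. \<forall>z\<in>C22356. x \<bullet> z \<in> {- node, 0, node}}"
    unfolding node_set_C22356 .
  then have x0: "x0 \<in> sphere 0 1" "\<And>z. z \<in> C22356 \<Longrightarrow> x0 \<bullet> z \<in> {- node, 0, node}" by blast+
  have N: "22356 = real (card C22356)" by (simp add: card_C22356)
  note d = polarization_of_design[OF finite_codes(3) codes_sphere(3) N moments_C22356 x0 h]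
  show "polarization h C22356 = 4050 * h (- node) + 14256 * h 0 + 4050 * h node" using d(1) by simp
  show "minimizers h C22356 = C552" using d(2) unfolding node_set_C22356 .
qed

text \<open>The nodes stay away from 1, so h is finite there and the identities reduce to real
  numbers.\<close>

lemma polarization_ratios:
  assumes h: "potential h" "pos_deriv 6 h"
  shows "polarization h C552 / 552 = polarization h C22356 / 22356"
    "polarization h C22356 / 22356 = polarization h C11178 / 11178"
proof -
  have "- node \<in> {-1..<1}" "0 \<in> {-1..<1::real}" "node \<in> {-1..<1}"
    using node_bounds unfolding atLeastLessThan_iff by linarith+
  note f = this[THEN potential_finite[OF h(1)]]
  obtain p q r where "h (- node) = ereal p" "h 0 = ereal q" "h node = ereal r"
    using f(1,2,3) by (cases "h (- node)"; cases "h 0"; cases "h node") blast+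
  note v = optimality_C552(1)[OF h] optimality_C11178(1)[OF h] optimality_C22356(1)[OF h] this
  show "polarization h C552 / 552 = polarization h C22356 / 22356"
    "polarization h C22356 / 22356 = polarization h C11178 / 11178"
    unfolding v by simp_all
qed

text \<open>On the minimal shell the squared distance to w is 10 minus twice the inner product with
  w.\<close>

lemma slice_3_eq: "{x \<in> shell L 2. norm (x - w) = 2} = slice 3"
proof -
  have "norm (x - w) = 2 \<longleftrightarrow> x \<bullet> w = 3" if "x \<in> shell L 2" for x
  proof -
    have "norm (x - w) = 2 \<longleftrightarrow> (norm (x - w))\<^sup>2 = 2\<^sup>2" by (subst power2_eq_iff_nonneg) auto
    then show ?thesis using that w by (simp add: norm2_diff shell_def)
  qed
  then show ?thesis unfolding slice_def by blast
qed

lemma slice_2_eq: "{x \<in> shell L 2. norm (x - w) = sqrt 6} = slice 2"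
proof -
  have "norm (x - w) = sqrt 6 \<longleftrightarrow> x \<bullet> w = 2" if "x \<in> shell L 2" for x
  proof -
    have "norm (x - w) = sqrt 6 \<longleftrightarrow> (norm (x - w))\<^sup>2 = (sqrt 6)\<^sup>2" by (subst power2_eq_iff_nonneg) auto
    then show ?thesis using that w by (simp add: norm2_diff shell_def)
  qed
  then show ?thesis unfolding slice_def by blast
qed

lemma codes_eq:
  "T ` normalized_proj (span {w}) ` slice 3 = C552"
  "T ` normalized_proj (span {w}) ` slice 2 = C11178"
  "T ` normalized_proj (span {w}) ` (slice 2 \<union> (\<lambda>x. w - x) ` slice 2) = C22356"
proof -
  show "T ` normalized_proj (span {w}) ` slice 3 = C552"
    unfolding C552_def image_image by (intro image_cong refl) (simp only: normalized_proj_slice_3)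
  show 2: "T ` normalized_proj (span {w}) ` slice 2 = C11178"
    unfolding C11178_def image_image by (intro image_cong refl) (simp only: normalized_proj_slice_2)
  have "T ` normalized_proj (span {w}) ` (\<lambda>x. w - x) ` slice 2 = uminus ` C11178"
    unfolding C11178_def image_image
    by (intro image_cong refl) (simp only: normalized_proj_slice_2 linear_neg[OF linear_T])
  then show "T ` normalized_proj (span {w}) ` (slice 2 \<union> (\<lambda>x. w - x) ` slice 2) = C22356"
    unfolding image_Un 2 C22356_def by simp
qed

end

theorem theorem5p10:
  fixes \<Lambda> :: "(real^24) set" and w :: "real^24"
    and \<B> \<C> \<C>' W :: "(real^24) set"
    and T :: "real^24 \<Rightarrow> real^23"
    and C552 C11178 C22356 :: "(real^23) set"
  assumes "leech_lattice \<Lambda>" and "w \<in> shell \<Lambda> 3"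
    and "\<B> = {x \<in> shell \<Lambda> 2. norm (x - w) = 2}"
    and "\<C> = {x \<in> shell \<Lambda> 2. norm (x - w) = sqrt 6}"
    and "\<C>' = (\<lambda>x. w - x) ` \<C>"
    and "W = span {w}"
    and "linear T" and "\<forall>x\<in>W\<^sup>\<bottom>. norm (T x) = norm x"
    and "C552 = T ` normalized_proj W ` \<B>"
    and "C11178 = T ` normalized_proj W ` \<C>"
    and "C22356 = T ` normalized_proj W ` (\<C> \<union> \<C>')"
  shows "card \<B> = 552 \<and> card \<C> = 11178 \<and>
    (\<forall>h. potential h \<and> pos_deriv 6 h \<longrightarrow>
       polarization h C11178 =
         2025 * h (- (sqrt 3 / 5)) + 7128 * h 0 + 2025 * h (sqrt 3 / 5) \<and>
       polarization h C22356 =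
         4050 * h (- (sqrt 3 / 5)) + 14256 * h 0 + 4050 * h (sqrt 3 / 5) \<and>
       polarization h C552 =
         100 * h (- (sqrt 3 / 5)) + 352 * h 0 + 100 * h (sqrt 3 / 5) \<and>
       polarization h C552 / 552 = polarization h C22356 / 22356 \<and>
       polarization h C22356 / 22356 = polarization h C11178 / 11178) \<and>
    (\<forall>h. potential h \<and> strictly_absolutely_monotone h \<longrightarrow>
       minimizers h C11178 = C552 \<and>
       minimizers h C22356 = C552 \<and>
       minimizers h C552 = C22356) \<and>
    universal_polar_dual_pair C552 C22356"
proof -
  interpret rootless_leech \<Lambda> using assms(1) by (rule leech_lattice_imp_rootless)
  interpret leech_projection \<Lambda> w T
  proof
    show "w \<in> shell \<Lambda> 3" by fact
    show "T (x + y) = T x + T y" "T (r *\<^sub>R x) = r *\<^sub>R T x" for x y r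
      using assms(7) by (rule linear_add linear_scale)+
    show "norm (T x) = norm x" if "x \<in> (span {w})\<^sup>\<bottom>" for x
      using assms(6,8) that by blast
  qed
  have BC: "\<B> = slice 3" "\<C> = slice 2" unfolding assms(3,4) by (rule slice_3_eq slice_2_eq)+
  have C: "C552 = leech_projection.C552 \<Lambda> w T" "C11178 = leech_projection.C11178 \<Lambda> w T"
    "C22356 = leech_projection.C22356 \<Lambda> w T"
    unfolding assms(5,6,9-11) BC by (rule codes_eq)+
  have sam: "pos_deriv 6 h" if "strictly_absolutely_monotone h" for h
    using that by (simp add: strictly_absolutely_monotone_def)
  show ?thesis
    unfolding universal_polar_dual_pair_def BC C
    by (intro conjI allI impI card_slice_3 card_slice_2; elim conjE;
        rule optimality_C552 optimality_C11178 optimality_C22356 polarization_ratios;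
        (assumption | rule sam, assumption))
qed

end
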